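(* Let $f\in H_p(D)$, $0<p<q<\infty$, $\alpha\in\mathbb{N}\cup((1/q-1)_+,\infty)$, $\theta=1/p-1/q$, and $\alpha+\theta\in\mathbb{N}\cup(1/p-1,\infty)$. Then, for any $\delta\in(0,1)$, $$\omega_\alpha(f,\delta)_{H_q}\lesssim\left(\int_0^\delta\left(\frac{\omega_{\alpha+\theta}(f,t)_{H_p}}{t^\theta}\right)^q\frac{dt}{t}\right)^{\frac1q}.$$
   Context: $D=\{z\in\mathbb{C}:|z|<1\}$. The analytic Hardy space $H_p=H_p(D)$ consists of analytic functions $f$ on $D$ with $\|f\|_{H_p}=\sup_{0<\rho<1}\left(\int_0^{2\pi}|f(\rho e^{it})|^p\,dt\right)^{1/p}<\infty$. The modulus of smoothness of order $\alpha>0$ is $\omega_\alpha(f,\delta)_{H_p}=\sup_{|h|\le\delta}\|\Delta_h^\alpha f\|_{H_p}$, where the difference acts in the angular variable: $\Delta_h^\alpha f(z)=\sum_{\nu=0}^\infty(-1)^\nu\binom\alpha\nu f(ze^{i(\alpha-\nu)h})$, $h\in\mathbb{R}$. $a_+=\max(a,0)$. $A\lesssim B$ means $A\le CB$ with $C$ independent of $f$ and $\delta$. *)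

theory Defs
  imports "HOL-Analysis.Analysis" "HOL-Complex_Analysis.Complex_Analysis"
begin

text \<open>Real powers of extended nonnegative numbers; only used for exponents \<open>a > 0\<close>,
  where \<open>\<infinity>\<^sup>a = \<infinity>\<close> and \<open>0\<^sup>a = 0\<close>.\<close>

definition epowr :: "ennreal \<Rightarrow> real \<Rightarrow> ennreal" where
  "epowr x a = (if x = \<infinity> then \<infinity> else ennreal (enn2real x powr a))"

text \<open>The (quasi-)norm takes the value \<open>\<infinity>\<close> outside of \<open>H\<^sub>p\<close>. The integral carries no
  factor \<open>1 / (2 * pi)\<close>.\<close>

definition Hp_norm :: "real \<Rightarrow> (complex \<Rightarrow> complex) \<Rightarrow> ennreal" where
  "Hp_norm p f =
     (SUP \<rho>\<in>{0<..<1}.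
        epowr (\<integral>\<^sup>+t\<in>{0..2 * pi}.
          ennreal (norm (f (complex_of_real \<rho> * exp (\<i> * complex_of_real t))) powr p) \<partial>lborel)
        (1 / p))"

definition hardy_space :: "real \<Rightarrow> (complex \<Rightarrow> complex) set" where
  "hardy_space p = {f. f holomorphic_on ball 0 1 \<and> Hp_norm p f < \<infinity>}"

text \<open>For \<open>\<alpha> > 0\<close> the binomial coefficients are absolutely summable, so for \<open>f\<close> holomorphic on
  the unit disc and \<open>z\<close> in the disc the series converges absolutely.\<close>

definition frac_diff :: "real \<Rightarrow> real \<Rightarrow> (complex \<Rightarrow> complex) \<Rightarrow> complex \<Rightarrow> complex" where
  "frac_diff \<alpha> h f z =
     (\<Sum>\<nu>. (-1) ^ \<nu> * complex_of_real (\<alpha> gchoose \<nu>) *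
           f (z * exp (\<i> * complex_of_real ((\<alpha> - real \<nu>) * h))))"

definition Hp_modulus :: "real \<Rightarrow> real \<Rightarrow> (complex \<Rightarrow> complex) \<Rightarrow> real \<Rightarrow> ennreal" where
  "Hp_modulus p \<alpha> f \<delta> = (SUP h\<in>{h. \<bar>h\<bar> \<le> \<delta>}. Hp_norm p (frac_diff \<alpha> h f))"

end

theory Submission
  imports Defs "HOL-Computational_Algebra.Fundamental_Theorem_Algebra"
begin

text \<open>
  Everything is proved for polynomials with constants independent of the degree; the slices
  \<open>z \<mapsto> f (\<rho> z)\<close> are reached by Fatou's lemma. Given \<open>h\<close>, decompose \<open>f\<close> into a part of degree
  about \<open>1 / \<bar>h\<bar>\<close> and dyadic blocks \<open>g\<^sub>l\<close> with frequencies about \<open>2\<^sup>l\<close>, by de la Vallee-Poussin operators.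

  On the low part, \<open>\<Delta>\<^sub>h\<^sup>\<alpha>\<close> is a fractional integral of order \<open>\<theta>\<close> of \<open>\<bar>h\<bar> powr (-\<theta>) \<Delta>\<^sub>h\<^sup>\<alpha>\<^sup>+\<^sup>\<theta>\<close> up to a
  multiplier holomorphic in \<open>k h\<close>, which is harmless by Bernstein's inequality, and the
  Hardy--Littlewood theorem on fractional integrals (in Hedberg's form: split the radial integral where the
  maximal function meets the growth bound) takes \<open>H\<^sub>p\<close> to \<open>H\<^sub>q\<close>. On a block, frequencies are bounded
  from both sides, so its \<open>H\<^sub>p\<close> norm is at most a constant times the modulus of order \<open>\<alpha> + \<theta>\<close> at \<open>2\<^sup>-\<^sup>l\<close>;
  the blocks are summed in \<open>H\<^sub>q\<close> by interpolating their \<open>L\<^sub>p\<close> and \<open>L\<^sub>\<infinity>\<close> bounds pointwise.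

  The range \<open>p < 1\<close> costs nothing extra because \<open>\<bar>P\<bar>\<^sup>s\<close> has a Poisson majorant for every \<open>s > 0\<close>:
  each linear factor of \<open>P\<close> is replaced by one without zeros in the disc and with the same modulus on
  the circle.
\<close>

text \<open>For p < 1 the integral of |g|^p is not convex in g, so a convolution operator cannot be
  bounded by averaging translates; pointwise domination by maximal functions takes the place of that
  argument. The radial maximal function is needed in L_p for all p > 0, and an L_2 bound applied to
  the modulus raised to p/2 gives every p with one constant. Several estimates end with an error
  that is a fraction of the estimated quantity itself; absorbing it requires that quantity to be
  finite, which is automatic for polynomials. The integral over (0, \<delta>) controls the modulus
  only at arguments u with 2u \<le> \<delta>, because it bounds it through the interval [u, 2u). A
  difference with step h, where |h| may equal \<delta>, must therefore be estimated by differences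
  with steps at most |h|/2. This explains the half step in the low-frequency quotient and the level
  at which low part and blocks separate. Norm bounds are carried as
  \<open>Jnorm p g \<le> ennreal (A powr p)\<close> with a real A, so that roots of extended reals
  appear only where the modulus itself enters.\<close>

definition circ :: "real measure" where
  "circ = density lborel (\<lambda>t. indicator {0..2 * pi} t)"

lemma sets_circ [simp, measurable_cong]: "sets circ = sets borel"
  by (simp add: circ_def)

lemma space_circ [simp]: "space circ = UNIV"
  by (simp add: circ_def)

lemma nn_integral_circ:
  assumes "f \<in> borel_measurable borel"
  shows "(\<integral>\<^sup>+t. f t \<partial>circ) = (\<integral>\<^sup>+t\<in>{0..2 * pi}. f t \<partial>lborel)"
  using assms unfolding circ_def by (subst nn_integral_density) (auto simp: mult.commute)

lemma emeasure_circ: "emeasure circ UNIV = ennreal (2 * pi)"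
proof -
  have "emeasure circ UNIV = (\<integral>\<^sup>+t. 1 \<partial>circ)" by simp
  also have "\<dots> = ennreal (2 * pi)"
    by (subst nn_integral_circ) auto
  finally show ?thesis .
qed

interpretation circ: finite_measure circ
  by standard (simp add: emeasure_circ)

lemma nn_integral_circ_integral:
  assumes f: "f \<in> borel_measurable borel" and nn: "\<And>t. 0 \<le> f t"
    and I: "(f has_integral I) {0..2 * pi}"
  shows "(\<integral>\<^sup>+t. ennreal (f t) \<partial>circ) = ennreal I"
  using nn_integral_has_integral_lebesgue'[OF _ I] nn f by (subst nn_integral_circ) auto

lemma norm_integral_le_circ:
  fixes F :: "real \<Rightarrow> complex"
  assumes c: "continuous_on UNIV F" and I: "(F has_integral I) {0..2 * pi}"
  shows "ennreal (norm I) \<le> (\<integral>\<^sup>+t. ennreal (norm (F t)) \<partial>circ)"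
proof -
  have c': "continuous_on UNIV (\<lambda>t. norm (F t))"
    using c by (intro continuous_intros)
  have i: "(\<lambda>t. norm (F t)) integrable_on {0..2 * pi}"
    by (rule integrable_continuous_interval) (rule continuous_on_subset[OF c'], simp)
  have "norm (integral {0..2 * pi} F) \<le> integral {0..2 * pi} (\<lambda>t. norm (F t))"
    by (rule integral_norm_bound_integral) (use I i in auto)
  hence "norm I \<le> integral {0..2 * pi} (\<lambda>t. norm (F t))"
    using I by (simp add: integral_unique)
  also have "ennreal \<dots> = (\<integral>\<^sup>+t. ennreal (norm (F t)) \<partial>circ)"
    by (subst nn_integral_circ_integral[OF _ _ integrable_integral[OF i]])
       (use borel_measurable_continuous_onI[OF c'] in auto)
  finally show ?thesis by (simp add: ennreal_leI)
qed

subsection \<open>Poisson majorants of polynomials\<close>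

text \<open>The Poisson kernel with the factor 1/(2 pi) inside: \<open>circ\<close> has mass 2 pi,
  and the kernel has integral 1 against it.\<close>

definition pois :: "complex \<Rightarrow> complex \<Rightarrow> real" where
  "pois w u = (1 - (norm w)\<^sup>2) / (2 * pi * (norm (u - w))\<^sup>2)"

lemma cis_ne: "norm w < 1 \<Longrightarrow> cis t \<noteq> w"
  by (metis norm_cis less_irrefl)

lemma one_minus_mult_ne: "norm (w::complex) < 1 \<Longrightarrow> norm z \<le> 1 \<Longrightarrow> 1 - cnj w * z \<noteq> 0"
proof
  assume a: "norm w < 1" "norm z \<le> 1" "1 - cnj w * z = 0"
  hence "cnj w * z = 1" by simp
  hence "norm w * norm z = 1" by (metis complex_mod_cnj norm_mult norm_one)
  moreover have "norm w * norm z \<le> norm w" using a(2) by (simp add: mult_left_le)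
  ultimately show False using a by linarith
qed

lemma norm_one_minus_cnj_mult_cis: "norm (1 - cnj w * cis t) = norm (cis t - w)"
proof -
  have "1 - cnj w * cis t = cis t * cnj (cis t - w)"
    by (simp add: algebra_simps cis_cnj cis_mult)
  thus ?thesis by (simp only: norm_mult norm_cis complex_mod_cnj mult_1)
qed

text \<open>Cauchy's formula at w for G(z) = F(z) (1 - |w|^2) / (1 - cnj w z). The extra factor is 1
  at z = w, and on the circle the product of the two denominators is z |z - w|^2, which turns the
  Cauchy kernel into the Poisson kernel.\<close>

lemma poisson_has_integral:
  assumes c: "continuous_on (cball 0 1) F" and h: "F holomorphic_on ball 0 1" and w: "norm w < 1"
  shows "((\<lambda>t. F (cis t) * (1 - (norm w)\<^sup>2) / ((1 - cnj w * cis t) * (cis t - w)) * cis t / (2 * pi))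
            has_integral F w) {0..2 * pi}"
proof -
  define G where "G = (\<lambda>z. F z * (1 - (norm w)\<^sup>2) / (1 - cnj w * z))"
  have "((\<lambda>u. G u / (u - w)) has_contour_integral (2 * of_real pi * \<i> * G w)) (circlepath 0 1)"
  proof (rule Cauchy_integral_circlepath)
    show "continuous_on (cball 0 1) G" unfolding G_def
      using one_minus_mult_ne[OF w] c by (intro continuous_intros) (metis mem_cball_0)+
    show "G holomorphic_on (ball 0 1)" unfolding G_def
      using h one_minus_mult_ne[OF w] by (intro holomorphic_intros) (metis less_imp_le mem_ball_0)+
  qed (use w in auto)
  hence "((\<lambda>t. G (0 + 1 * cis t) / ((0 + 1 * cis t) - w) * 1 * \<i> * cis t) has_integral
           2 * of_real pi * \<i> * G w) {0..2 * pi}"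
    unfolding circlepath_def
    by (subst (asm) has_contour_integral_part_circlepath_iff) auto
  hence "((\<lambda>t. G (cis t) / (cis t - w) * \<i> * cis t / (2 * of_real pi * \<i>)) has_integral
           2 * of_real pi * \<i> * G w / (2 * of_real pi * \<i>)) {0..2 * pi}"
    by (intro has_integral_divide) simp
  moreover have "2 * of_real pi * \<i> * G w / (2 * of_real pi * \<i>) = F w"
  proof -
    have "1 - cnj w * w = 1 - (norm w)\<^sup>2"
      by (metis complex_norm_square mult.commute of_real_1 of_real_diff)
    moreover have "1 - cnj w * w \<noteq> 0" using w by (intro one_minus_mult_ne) auto
    ultimately show ?thesis by (simp add: G_def)
  qed
  moreover have "G (cis t) / (cis t - w) * \<i> * cis t / (2 * of_real pi * \<i>) =
     F (cis t) * (1 - (norm w)\<^sup>2) / ((1 - cnj w * cis t) * (cis t - w)) * cis t / (2 * pi)" for t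
    by (simp add: G_def mult_ac)
  ultimately show ?thesis by (simp only:)
qed

lemma cmod_one_minus_sq: "norm w < 1 \<Longrightarrow> norm (1 - (complex_of_real (norm w))\<^sup>2) = 1 - (norm w)\<^sup>2"
proof -
  assume "norm w < 1"
  hence "(norm w)\<^sup>2 \<le> 1" by (simp add: power_le_one)
  hence "norm (complex_of_real (1 - (norm w)\<^sup>2)) = 1 - (norm w)\<^sup>2" by (subst norm_of_real) simp
  thus ?thesis by simp
qed

lemma poisson_kernel_identity:
  fixes F :: "complex \<Rightarrow> complex"
  assumes w: "norm w < 1"
  shows "norm (F (cis t) * (1 - (norm w)\<^sup>2) / ((1 - cnj w * cis t) * (cis t - w)) * cis t / (2 * pi))
     = pois w (cis t) * norm (F (cis t))"
proof -
  have "norm (complex_of_real (1 - (norm w)\<^sup>2)) = 1 - (norm w)\<^sup>2"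
    using cmod_one_minus_sq[OF w] by simp
  thus ?thesis
    by (simp only: norm_mult norm_divide norm_one_minus_cnj_mult_cis norm_cis pois_def)
       (simp add: power2_eq_square mult_ac)
qed

lemma continuous_cis_comp:
  assumes "continuous_on (cball 0 1) F"
  shows "continuous_on UNIV (\<lambda>t. F (cis t))"
  by (rule continuous_on_compose2[OF assms]) (auto intro!: continuous_intros)

lemma poisson_le:
  assumes c: "continuous_on (cball 0 1) F" and h: "F holomorphic_on ball 0 1" and w: "norm w < 1"
  shows "ennreal (norm (F w)) \<le> (\<integral>\<^sup>+t. ennreal (pois w (cis t) * norm (F (cis t))) \<partial>circ)"
proof -
  have "continuous_on UNIV (\<lambda>t. F (cis t) * (1 - (norm w)\<^sup>2) / ((1 - cnj w * cis t) * (cis t - w)) * cis t / (2 * pi))"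
    using one_minus_mult_ne[OF w] cis_ne[OF w]
    by (intro continuous_intros continuous_cis_comp[OF c]) auto
  from norm_integral_le_circ[OF this poisson_has_integral[OF c h w]]
  show ?thesis by (simp only: poisson_kernel_identity[OF w, of F])
qed

lemma pois_nonneg: "norm w < 1 \<Longrightarrow> 0 \<le> pois w u"
  by (auto simp: pois_def power_le_one)

lemma cis_measurable [measurable]: "cis \<in> borel_measurable borel"
  by (intro borel_measurable_continuous_onI continuous_intros)

lemma pois_measurable [measurable]: "(\<lambda>t. pois w (cis t)) \<in> borel_measurable borel"
  unfolding pois_def by measurable

lemma nn_integral_pois:
  assumes w: "norm w < 1"
  shows "(\<integral>\<^sup>+t. ennreal (pois w (cis t)) \<partial>circ) = 1"
proof -
  have "((\<lambda>t. (1 - (norm w)\<^sup>2) / ((1 - cnj w * cis t) * (cis t - w)) * cis t / (2 * pi)) has_integral 1) {0..2 * pi}"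
    using poisson_has_integral[of "\<lambda>_. 1" w] w by simp
  moreover have "(1 - (norm w)\<^sup>2) / ((1 - cnj w * cis t) * (cis t - w)) * cis t / (2 * pi) = of_real (pois w (cis t))" for t
  proof -
    have "1 - cnj w * cis t = cis t * cnj (cis t - w)"
      by (simp add: algebra_simps cis_cnj cis_mult)
    hence "(1 - cnj w * cis t) * (cis t - w) = cis t * of_real ((norm (cis t - w))\<^sup>2)"
      by (simp only: complex_norm_square mult_ac)
    thus ?thesis using cis_ne[OF w, of t] by (simp add: pois_def)
  qed
  ultimately have "((\<lambda>t. complex_of_real (pois w (cis t))) has_integral 1) {0..2 * pi}"
    by simp
  hence "((\<lambda>t. Re (complex_of_real (pois w (cis t)))) has_integral Re 1) {0..2 * pi}"
    by (rule has_integral_linear[unfolded o_def]) (rule bounded_linear_Re)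
  hence "((\<lambda>t. pois w (cis t)) has_integral 1) {0..2 * pi}" by simp
  from nn_integral_circ_integral[OF _ _ this] show ?thesis
    using pois_nonneg[OF w] by simp
qed

lemma blaschke_identity:
  "(norm (1 - cnj a * z))\<^sup>2 - (norm (z - a))\<^sup>2 = (1 - (norm a)\<^sup>2) * (1 - (norm z)\<^sup>2)"
  unfolding cmod_power2 by (simp add: power2_eq_square) algebra

text \<open>For |a| < 1 the zero is reflected: 1 - cnj a z has the same modulus on the circle and a
  larger one inside. For |a| \<ge> 1 the factor z - a has no zero in the open disc and is only
  rescaled to -a (1 - z/a).\<close>

lemma outer_linear:
  assumes s: "s > 0"
  shows "\<exists>F. continuous_on (cball 0 1) F \<and> F holomorphic_on ball 0 1 \<and>
     (\<forall>z. norm z = 1 \<longrightarrow> norm (F z) = norm (z - a) powr s) \<and>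
     (\<forall>z. norm z < 1 \<longrightarrow> norm (z - a) powr s \<le> norm (F z))"
proof -
  \<comment> \<open>For |b| \<le> 1 the values 1 - b z lie in the right half plane, so the principal
    power is holomorphic inside the disc; s > 0 makes it continuous even at a zero on the
    circle.\<close>
  define G where "G = (\<lambda>b z::complex. (1 - b * z) powr (complex_of_real s))"
  have re: "Re (b * z) \<le> 1" if "norm b \<le> 1" "norm z \<le> 1" for b z :: complex
  proof -
    have "Re (b * z) \<le> norm (b * z)" by (rule complex_Re_le_cmod)
    also have "\<dots> \<le> 1" using that by (simp add: norm_mult mult_le_one)
    finally show ?thesis .
  qed
  have re': "Re (b * z) < 1" if "norm b \<le> 1" "norm z < 1" for b z :: complex
  proof -
    have "Re (b * z) \<le> norm (b * z)" by (rule complex_Re_le_cmod)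
    also have "\<dots> \<le> norm z" using that by (simp add: norm_mult mult_left_le_one_le)
    finally show ?thesis using that by simp
  qed
  have c: "continuous_on (cball 0 1) (G b)" if "norm b \<le> 1" for b
    unfolding G_def using re[OF that] s by (intro continuous_intros) auto
  have h: "G b holomorphic_on ball 0 1" if b: "norm b \<le> 1" for b
  proof -
    have "1 - b * z \<notin> \<real>\<^sub>\<le>\<^sub>0" if "norm z < 1" for z
      using re'[OF b that] by (auto simp: complex_nonpos_Reals_iff)
    thus ?thesis unfolding G_def by (intro holomorphic_intros) auto
  qed
  have n: "norm (G b z) = norm (1 - b * z) powr s" for b z
    unfolding G_def by (subst norm_powr_real_powr') auto
  show ?thesis
  proof (cases "norm a < 1")
    case True
    have b: "norm (cnj a) \<le> 1" using True by simp
    have 1: "norm (1 - cnj a * z) = norm (z - a)" if "norm z = 1" for z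
    proof -
      have "z = cis (Arg z)" using that cis_Arg[of z] by (cases "z = 0") (auto simp: sgn_div_norm)
      then obtain t where "z = cis t" by blast
      thus ?thesis by (simp add: norm_one_minus_cnj_mult_cis)
    qed
    have 2: "norm (z - a) \<le> norm (1 - cnj a * z)" if "norm z < 1" for z
    proof -
      have "(norm (1 - cnj a * z))\<^sup>2 - (norm (z - a))\<^sup>2 = (1 - (norm a)\<^sup>2) * (1 - (norm z)\<^sup>2)"
        by (rule blaschke_identity)
      also have "\<dots> \<ge> 0" using True that by (intro mult_nonneg_nonneg) (auto simp: power_le_one)
      finally have "(norm (z - a))\<^sup>2 \<le> (norm (1 - cnj a * z))\<^sup>2" by simp
      thus ?thesis by (rule power2_le_imp_le) simp
    qed
    show ?thesis
      by (intro exI[of _ "G (cnj a)"] conjI c[OF b] h[OF b]) (use 1 2 n s in \<open>auto intro!: powr_mono2\<close>)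
  next
    case False
    define b where "b = 1 / a"
    have a: "a \<noteq> 0" using False by auto
    have b: "norm b \<le> 1" using False a by (simp add: b_def norm_divide divide_le_eq_1 not_less)
    have 1: "norm (z - a) = norm a * norm (1 - b * z)" for z
    proof -
      have "z - a = - a * (1 - b * z)" using a by (simp add: b_def algebra_simps)
      thus ?thesis by (simp add: norm_mult)
    qed
    have n': "norm (of_real (norm a powr s) * G b z) = norm (z - a) powr s" for z
      by (simp add: norm_mult n 1 powr_mult)
    show ?thesis
      by (intro exI[of _ "\<lambda>z. of_real (norm a powr s) * G b z"] conjI continuous_intros c[OF b] holomorphic_intros h[OF b])
         (use n' in auto)
  qed
qed

lemma outer_majorant:
  fixes P :: "complex poly"
  assumes s: "s > 0"
  shows "\<exists>F. continuous_on (cball 0 1) F \<and> F holomorphic_on ball 0 1 \<and>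
     (\<forall>z. norm z = 1 \<longrightarrow> norm (F z) = norm (poly P z) powr s) \<and>
     (\<forall>z. norm z < 1 \<longrightarrow> norm (poly P z) powr s \<le> norm (F z))"
proof (induction "degree P" arbitrary: P rule: less_induct)
  case less
  show ?case
  proof (cases "degree P = 0")
    case True
    then obtain c where "P = [:c:]" by (metis degree_eq_zeroE)
    thus ?thesis by (intro exI[of _ "\<lambda>_. of_real (norm c powr s)"]) auto
  next
    case False
    then obtain a where "poly P a = 0"
      using fundamental_theorem_of_algebra[of P] by (auto simp: constant_degree)
    then obtain Q where Q: "P = [:-a, 1:] * Q" by (metis dvdE poly_eq_0_iff_dvd)
    have "Q \<noteq> 0" using Q False by auto
    hence "degree Q < degree P"
      by (simp add: Q degree_mult_eq del: mult_pCons_left)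
    from less[OF this] obtain F where F: "continuous_on (cball 0 1) F" "F holomorphic_on ball 0 1"
      "\<And>z. norm z = 1 \<Longrightarrow> norm (F z) = norm (poly Q z) powr s"
      "\<And>z. norm z < 1 \<Longrightarrow> norm (poly Q z) powr s \<le> norm (F z)" by blast
    from outer_linear[OF s, of a] obtain G where G: "continuous_on (cball 0 1) G" "G holomorphic_on ball 0 1"
      "\<And>z. norm z = 1 \<Longrightarrow> norm (G z) = norm (z - a) powr s"
      "\<And>z. norm z < 1 \<Longrightarrow> norm (z - a) powr s \<le> norm (G z)" by blast
    have n: "norm (poly P z) powr s = norm (z - a) powr s * norm (poly Q z) powr s" for z
    proof -
      have "poly P z = (z - a) * poly Q z" by (simp add: Q algebra_simps)
      thus ?thesis by (simp add: norm_mult powr_mult)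
    qed
    show ?thesis
      by (intro exI[of _ "\<lambda>z. G z * F z"] conjI continuous_intros holomorphic_intros F(1,2) G(1,2) allI impI)
         (auto simp: n norm_mult F(3) G(3) intro!: mult_mono F(4) G(4))
  qed
qed

text \<open>The Poisson formula is applied to the majorant, which dominates at w and has the modulus
  of the power of P on the circle, the only place where it is integrated.\<close>

lemma poly_poisson_le:
  fixes P :: "complex poly"
  assumes s: "s > 0" and w: "norm w < 1"
  shows "ennreal (norm (poly P w) powr s) \<le>
     (\<integral>\<^sup>+t. ennreal (pois w (cis t) * norm (poly P (cis t)) powr s) \<partial>circ)"
proof -
  from outer_majorant[OF s, of P] obtain F where F: "continuous_on (cball 0 1) F" "F holomorphic_on ball 0 1"
      "\<And>z. norm z = 1 \<Longrightarrow> norm (F z) = norm (poly P z) powr s"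
      "\<And>z. norm z < 1 \<Longrightarrow> norm (poly P z) powr s \<le> norm (F z)" by blast
  have "ennreal (norm (poly P w) powr s) \<le> ennreal (norm (F w))"
    using F(4)[OF w] by (rule ennreal_leI)
  also have "\<dots> \<le> (\<integral>\<^sup>+t. ennreal (pois w (cis t) * norm (F (cis t))) \<partial>circ)"
    by (rule poisson_le[OF F(1,2) w])
  finally show ?thesis by (simp add: F(3))
qed

section \<open>A symmetric kernel on the circle, comparable to Poisson's\<close>

definition kern :: "real \<Rightarrow> complex \<Rightarrow> complex \<Rightarrow> real" where
  "kern e z w = e / (e + norm (z - w))\<^sup>2"

lemma kern_nonneg [simp]: "0 \<le> e \<Longrightarrow> 0 \<le> kern e z w"
  by (simp add: kern_def)

lemma kern_commute: "kern e z w = kern e w z"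
  by (simp add: kern_def norm_minus_commute)

lemma kern_le: "0 < e \<Longrightarrow> kern e z w \<le> 1 / e"
proof -
  assume e: "0 < e"
  have p: "0 < e + norm (z - w)" using e by (simp add: add_pos_nonneg)
  have "e^2 \<le> (e + norm (z - w))\<^sup>2" using e by (intro power_mono) auto
  hence "e / (e + norm (z - w))\<^sup>2 \<le> e / e^2" using e
    by (intro divide_left_mono mult_pos_pos) (use p in auto)
  thus ?thesis using e by (simp add: kern_def power2_eq_square)
qed

lemma kern_halve:
  assumes e: "0 < e" and d: "norm (z - u) \<le> 2 * norm (z - w)"
  shows "kern e z w \<le> 4 * kern e z u"
proof -
  have "(e + norm (z - u))\<^sup>2 \<le> (2 * (e + norm (z - w)))\<^sup>2"
    using d e by (intro power_mono) auto
  hence 1: "(e + norm (z - u))\<^sup>2 \<le> 4 * (e + norm (z - w))\<^sup>2"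
    by (simp only: power_mult_distrib) simp
  have p: "0 < (e + norm (z - u))\<^sup>2" "0 < (e + norm (z - w))\<^sup>2"
    by (rule zero_less_power, use e in \<open>simp add: add_pos_nonneg\<close>)+
  have "e * (e + norm (z - u))\<^sup>2 \<le> e * (4 * (e + norm (z - w))\<^sup>2)"
    using 1 e by (intro mult_left_mono) auto
  thus ?thesis using p unfolding kern_def by (simp add: divide_simps mult_ac)
qed

text \<open>The point w is at least half as far from z or from u as these are from each other, and
  in the corresponding factor w can be traded for the opposite endpoint. In each resulting term one
  factor no longer depends on w, which is what makes products of kernels integrable in w.\<close>

lemma kern_mult_le:
  assumes e: "0 < e" "0 < e'"
  shows "kern e z w * kern e' w u \<le> 4 * (kern e z u * kern e' w u + kern e z w * kern e' z u)"
proof -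
  have nn: "0 \<le> kern e z u" "0 \<le> kern e' w u" "0 \<le> kern e z w" "0 \<le> kern e' z u" using e by auto
  have "norm (z - u) \<le> norm (z - w) + norm (w - u)"
    using norm_triangle_ineq[of "z - w" "w - u"] by simp
  hence "norm (z - u) \<le> 2 * norm (z - w) \<or> norm (u - z) \<le> 2 * norm (u - w)"
    by (simp add: norm_minus_commute) linarith
  thus ?thesis
  proof
    assume "norm (z - u) \<le> 2 * norm (z - w)"
    from mult_right_mono[OF kern_halve[OF e(1) this] nn(2)]
    show ?thesis using mult_nonneg_nonneg[OF nn(3,4)] by (simp add: algebra_simps)
  next
    assume "norm (u - z) \<le> 2 * norm (u - w)"
    from mult_left_mono[OF kern_halve[OF e(2) this] nn(3)]
    show ?thesis using mult_nonneg_nonneg[OF nn(1,2)] kern_commute[of e' u] by (simp add: algebra_simps)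
  qed
qed

lemma kern_cis_measurable [measurable]:
  "(\<lambda>x. kern (a x) (cis (f x)) (cis (g x))) \<in> borel_measurable M"
  if [measurable]: "a \<in> borel_measurable M" "f \<in> borel_measurable M" "g \<in> borel_measurable M"
proof -
  show ?thesis unfolding kern_def by measurable
qed

text \<open>|u - r z| is at least 1 - r and at least |z - u| - (1 - r), so (1 - r) + |z - u| \<le> 3
  |u - r z|. Squaring gives the 9, and 1 - r^2 \<le> 2 (1 - r) cancels the 2 in 2 pi.\<close>

lemma pois_le_kern:
  assumes r: "0 \<le> r" "r < 1" and z: "norm z = 1" and u: "norm u = 1"
  shows "pois (of_real r * z) u \<le> 9 / pi * kern (1 - r) z u"
proof -
  define d where "d = norm (u - of_real r * z)"
  have n: "norm (of_real r * z) = r" using r z by (simp add: norm_mult)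
  have d: "1 - r \<le> d"
    using norm_triangle_ineq2[of u "of_real r * z"] by (simp only: n u d_def)
  have "norm (z - u) \<le> norm (of_real r * z - u) + norm (z - of_real r * z)"
    using norm_triangle_ineq[of "of_real r * z - u" "z - of_real r * z"] by simp
  also have "z - of_real r * z = of_real (1 - r) * z" by (simp add: algebra_simps)
  also have "norm \<dots> = 1 - r" using r z by (simp add: norm_mult del: of_real_diff)
  finally have "(1 - r) + norm (z - u) \<le> 3 * d" using d by (simp add: d_def norm_minus_commute)
  hence "((1 - r) + norm (z - u))\<^sup>2 \<le> (3 * d)\<^sup>2" using r by (intro power_mono) auto
  hence k: "((1 - r) + norm (z - u))\<^sup>2 \<le> 9 * d\<^sup>2" by (simp add: power_mult_distrib)
  have p: "0 < ((1 - r) + norm (z - u))\<^sup>2" 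
    by (rule zero_less_power) (use r in \<open>simp add: add_pos_nonneg\<close>)
  have "0 < d" using d r by simp
  have "1 - r\<^sup>2 = (1 - r) * (1 + r)" by (simp add: power2_eq_square algebra_simps)
  also have "\<dots> \<le> (1 - r) * 2" using r by (intro mult_left_mono) auto
  finally have "pois (of_real r * z) u \<le> (1 - r) * 2 / (2 * pi * d\<^sup>2)"
    using \<open>0 < d\<close> unfolding pois_def n d_def[symmetric] by (intro divide_right_mono) auto
  also have "\<dots> = 9 / pi * ((1 - r) / (9 * d\<^sup>2))" using \<open>0 < d\<close> by (simp add: field_simps)
  also have "(1 - r) / (9 * d\<^sup>2) \<le> kern (1 - r) z u" unfolding kern_def
    using k p r \<open>0 < d\<close> by (intro divide_left_mono mult_pos_pos) auto
  finally show ?thesis by (simp add: divide_right_mono)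
qed

lemma kern_le_pois:
  assumes r: "0 \<le> r" "r < 1" and z: "norm z = 1" and u: "norm u = 1"
  shows "kern (1 - r) z u \<le> 2 * pi * pois (of_real r * z) u"
proof -
  define d where "d = norm (u - of_real r * z)"
  have n: "norm (of_real r * z) = r" using r z by (simp add: norm_mult)
  have d: "1 - r \<le> d"
    using norm_triangle_ineq2[of u "of_real r * z"] by (simp only: n u d_def)
  have "d \<le> norm (u - z) + norm (z - of_real r * z)"
    using norm_triangle_ineq[of "u - z" "z - of_real r * z"] by (simp add: d_def)
  also have "z - of_real r * z = of_real (1 - r) * z" by (simp add: algebra_simps)
  also have "norm \<dots> = 1 - r" using r z by (simp add: norm_mult del: of_real_diff)
  finally have "d \<le> (1 - r) + norm (z - u)" by (simp add: norm_minus_commute)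
  hence k: "d\<^sup>2 \<le> ((1 - r) + norm (z - u))\<^sup>2" using r d by (intro power_mono) auto
  have p: "0 < d" using d r by simp
  have "kern (1 - r) z u \<le> (1 - r) / d\<^sup>2" unfolding kern_def
    using k p r by (intro divide_left_mono) (auto intro: less_le_trans[of 0 "d\<^sup>2"])
  also have "\<dots> \<le> (1 - r\<^sup>2) / d\<^sup>2"
    using r by (intro divide_right_mono) (auto simp: power2_eq_square mult_left_le_one_le)
  also have "\<dots> = 2 * pi * pois (of_real r * z) u"
    using p unfolding pois_def n d_def[symmetric] by (simp add: field_simps)
  finally show ?thesis .
qed

text \<open>Comparison with 2 pi times the Poisson kernel at radius 1 - e, whose mass is 1; e = 1
  corresponds to the centre of the disc.\<close>

lemma nn_integral_kern_le:
  assumes e: "0 < e" "e \<le> 1" and z: "norm z = 1"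
  shows "(\<integral>\<^sup>+t. ennreal (kern e z (cis t)) \<partial>circ) \<le> ennreal (2 * pi)"
proof -
  have n: "norm (of_real (1 - e) * z) < 1" using e z by (simp add: norm_mult del: of_real_diff)
  have "(\<integral>\<^sup>+t. ennreal (kern e z (cis t)) \<partial>circ) \<le>
     (\<integral>\<^sup>+t. ennreal (2 * pi) * ennreal (pois (of_real (1 - e) * z) (cis t)) \<partial>circ)"
  proof (rule nn_integral_mono)
    fix t
    have "kern e z (cis t) \<le> 2 * pi * pois (of_real (1 - e) * z) (cis t)"
      using kern_le_pois[of "1 - e" z "cis t"] e z by simp
    thus "ennreal (kern e z (cis t)) \<le> ennreal (2 * pi) * ennreal (pois (of_real (1 - e) * z) (cis t))"
      using pois_nonneg[OF n] by (simp add: ennreal_mult'[symmetric] ennreal_leI del: of_real_diff)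
  qed
  also have "\<dots> = ennreal (2 * pi)"
    by (subst nn_integral_cmult) (auto simp: nn_integral_pois[OF n] simp del: of_real_diff)
  finally show ?thesis .
qed

lemma poly_kern_le:
  fixes P :: "complex poly"
  assumes s: "s > 0" and r: "0 \<le> r" "r < 1" and z: "norm z = 1"
  shows "ennreal (norm (poly P (of_real r * z)) powr s) \<le>
     ennreal (9 / pi) * (\<integral>\<^sup>+t. ennreal (kern (1 - r) z (cis t) * norm (poly P (cis t)) powr s) \<partial>circ)"
proof -
  have [measurable]: "(\<lambda>t. poly P (cis t)) \<in> borel_measurable borel"
    by (intro borel_measurable_continuous_onI continuous_intros)
  have [measurable]: "(\<lambda>t. kern (1 - r) z (cis t)) \<in> borel_measurable borel"
    unfolding kern_def by measurable
  have n: "norm (of_real r * z) < 1" using r z by (simp add: norm_mult)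
  have "ennreal (norm (poly P (of_real r * z)) powr s) \<le>
     (\<integral>\<^sup>+t. ennreal (pois (of_real r * z) (cis t) * norm (poly P (cis t)) powr s) \<partial>circ)"
    by (rule poly_poisson_le[OF s n])
  also have "\<dots> \<le> (\<integral>\<^sup>+t. ennreal (9 / pi) * ennreal (kern (1 - r) z (cis t) * norm (poly P (cis t)) powr s) \<partial>circ)"
  proof (rule nn_integral_mono)
    fix t
    have "pois (of_real r * z) (cis t) * norm (poly P (cis t)) powr s \<le>
       9 / pi * kern (1 - r) z (cis t) * norm (poly P (cis t)) powr s"
      by (intro mult_right_mono pois_le_kern r z) auto
    thus "ennreal (pois (of_real r * z) (cis t) * norm (poly P (cis t)) powr s)
      \<le> ennreal (9 / pi) * ennreal (kern (1 - r) z (cis t) * norm (poly P (cis t)) powr s)"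
      by (simp add: ennreal_mult'[symmetric] ennreal_leI mult.assoc)
  qed
  also have "\<dots> = ennreal (9 / pi) * (\<integral>\<^sup>+t. ennreal (kern (1 - r) z (cis t) * norm (poly P (cis t)) powr s) \<partial>circ)"
    by (rule nn_integral_cmult) measurable
  finally show ?thesis .
qed

subsection \<open>The radial maximal function\<close>

text \<open>Young's inequality with a free weight. It stands in for Cauchy-Schwarz: no roots occur
  and infinite values are allowed.\<close>

lemma ennreal_mult_le_sum_squares:
  fixes f g :: ennreal
  assumes l: "0 < l"
  shows "f * g \<le> ennreal (l / 2) * f\<^sup>2 + ennreal (1 / (2 * l)) * g\<^sup>2"
proof (cases "f = top \<or> g = top")
  case True
  thus ?thesis using l
    by (cases "f = 0"; cases "g = 0") (auto simp: ennreal_mult_eq_top_iff ennreal_top_mult ennreal_mult_top power2_eq_square)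
next
  case False
  then obtain a b where ab: "f = ennreal a" "g = ennreal b" "0 \<le> a" "0 \<le> b"
    by (metis ennreal_cases)
  have "0 \<le> (l * a - b)\<^sup>2 / (2 * l)" using l by simp
  also have "\<dots> = l / 2 * a\<^sup>2 + 1 / (2 * l) * b\<^sup>2 - a * b"
    using l by (simp add: field_simps power2_eq_square)
  finally have "a * b \<le> l / 2 * a\<^sup>2 + 1 / (2 * l) * b\<^sup>2" by simp
  hence "ennreal (a * b) \<le> ennreal (l / 2 * a\<^sup>2 + 1 / (2 * l) * b\<^sup>2)" by (rule ennreal_leI)
  thus ?thesis unfolding ab(1,2) using ab(3,4) l
    by (simp add: ennreal_power ennreal_mult'[symmetric] ennreal_plus[symmetric] del: ennreal_plus)
qed

text \<open>Finiteness of x is essential: for x infinite the first assumption always holds.\<close>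

lemma ennreal_absorb_half:
  fixes x a :: ennreal
  assumes "x \<le> a + ennreal (1 / 2) * x" "x < top"
  shows "x \<le> 2 * a"
proof (cases "a = top")
  case True
  thus ?thesis by (simp add: ennreal_mult_top)
next
  case False
  obtain x' where x: "x = ennreal x'" "0 \<le> x'" using assms(2) by (cases x) auto
  obtain a' where a: "a = ennreal a'" "0 \<le> a'" using False by (cases a) auto
  have "ennreal x' \<le> ennreal a' + ennreal (1 / 2) * ennreal x'" using assms(1) x a by simp
  also have "\<dots> = ennreal (a' + 1 / 2 * x')" using x a
    by (simp only: ennreal_plus[of a' "1 / 2 * x'"] ennreal_mult'[of "1 / 2" x'])
  finally have "ennreal x' \<le> ennreal (a' + 1 / 2 * x')" .
  hence "x' \<le> a' + 1 / 2 * x'"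
    by (subst (asm) ennreal_le_iff) (use x a in auto)
  hence "x' \<le> 2 * a'" by simp
  hence "ennreal x' \<le> ennreal (2 * a')" by (rule ennreal_leI)
  thus ?thesis using x a by (simp add: ennreal_mult')
qed

lemma nn_integral_mult_le_sum_squares:
  fixes f g :: "'a \<Rightarrow> ennreal"
  assumes [measurable]: "f \<in> borel_measurable M" "g \<in> borel_measurable M" and l: "0 < l"
  shows "(\<integral>\<^sup>+x. f x * g x \<partial>M) \<le>
     ennreal (l / 2) * (\<integral>\<^sup>+x. (f x)\<^sup>2 \<partial>M) + ennreal (1 / (2 * l)) * (\<integral>\<^sup>+x. (g x)\<^sup>2 \<partial>M)"
proof -
  have "(\<integral>\<^sup>+x. f x * g x \<partial>M) \<le> (\<integral>\<^sup>+x. ennreal (l / 2) * (f x)\<^sup>2 + ennreal (1 / (2 * l)) * (g x)\<^sup>2 \<partial>M)"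
    by (intro nn_integral_mono ennreal_mult_le_sum_squares l)
  also have "\<dots> = ennreal (l / 2) * (\<integral>\<^sup>+x. (f x)\<^sup>2 \<partial>M) + ennreal (1 / (2 * l)) * (\<integral>\<^sup>+x. (g x)\<^sup>2 \<partial>M)"
    by (subst nn_integral_add) (auto simp: nn_integral_cmult)
  finally show ?thesis .
qed

interpretation circ2: pair_sigma_finite circ circ by standard

lemma nn_integral_circ_le_const:
  assumes "\<And>x. f x \<le> c"
  shows "(\<integral>\<^sup>+x. f x \<partial>circ) \<le> c * ennreal (2 * pi)"
proof -
  have "(\<integral>\<^sup>+x. f x \<partial>circ) \<le> (\<integral>\<^sup>+x. c \<partial>circ)" by (intro nn_integral_mono assms)
  also have "\<dots> = c * ennreal (2 * pi)" by (simp add: emeasure_circ)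
  finally show ?thesis .
qed

text \<open>The \<open>T T\<^sup>*\<close> argument: with the radius frozen as a function of the angle, the maximal operator is
  linear and \<open>T T\<^sup>*\<close> is dominated by a multiple of \<open>T + T\<^sup>*\<close>.\<close>

lemma linearized_maximal_L2:
  fixes e :: "real \<Rightarrow> real" and f :: "real \<Rightarrow> ennreal"
  assumes e [measurable]: "e \<in> borel_measurable borel" and e0: "0 < e0" "\<And>t. e0 \<le> e t" "\<And>t. e t \<le> 1"
    and f [measurable]: "f \<in> borel_measurable borel" and B: "\<And>x. f x \<le> ennreal B" 
  shows "(\<integral>\<^sup>+t. (\<integral>\<^sup>+x. ennreal (kern (e t) (cis t) (cis x)) * f x \<partial>circ)\<^sup>2 \<partial>circ)
      \<le> ennreal ((16 * pi)\<^sup>2) * (\<integral>\<^sup>+x. (f x)\<^sup>2 \<partial>circ)"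
proof -
  \<comment> \<open>\<open>g\<close> is T f and \<open>S\<close> is the adjoint of T applied to
    \<open>g\<close>. Below, \<open>a\<close>, \<open>b\<close> and \<open>c\<close> are the squared
    L_2 norms of f, g and S.\<close>
  define k where "k = (\<lambda>t x. ennreal (kern (e t) (cis t) (cis x)))"
  define g where "g = (\<lambda>t. \<integral>\<^sup>+x. k t x * f x \<partial>circ)"
  define S where "S = (\<lambda>x. \<integral>\<^sup>+t. k t x * g t \<partial>circ)"
  have epos: "0 < e t" for t using e0(1) e0(2)[of t] by simp
  have km [measurable]: "(\<lambda>z. k (u z) (v z)) \<in> borel_measurable N"
    if [measurable]: "u \<in> borel_measurable N" "v \<in> borel_measurable N" for u v and N :: "'z measure"
    unfolding k_def by measurable
  have gm [measurable]: "g \<in> borel_measurable borel"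
  proof -
    have "g \<in> borel_measurable circ" unfolding g_def by measurable
    thus ?thesis by simp
  qed
  have Sm [measurable]: "S \<in> borel_measurable borel"
  proof -
    have "S \<in> borel_measurable circ" unfolding S_def by measurable
    thus ?thesis by simp
  qed
  have k_le: "k t x \<le> ennreal (1 / e0)" for t x
  proof -
    have "kern (e t) (cis t) (cis x) \<le> 1 / e t" by (rule kern_le[OF epos])
    also have "\<dots> \<le> 1 / e0" using e0(1) e0(2)[of t] by (intro divide_left_mono) auto
    finally show ?thesis unfolding k_def by (rule ennreal_leI)
  qed
  define G where "G = ennreal (1 / e0) * ennreal B * ennreal (2 * pi)"
  have g_le: "g t \<le> G" for t unfolding g_def G_def
    by (intro nn_integral_circ_le_const mult_mono k_le B) auto
  have S_le: "S t \<le> ennreal (1 / e0) * G * ennreal (2 * pi)" for t unfolding S_def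
    by (intro nn_integral_circ_le_const mult_mono k_le g_le) auto
  have Gf: "G < top" by (simp add: G_def ennreal_mult_less_top)
  define b where "b = (\<integral>\<^sup>+t. (g t)\<^sup>2 \<partial>circ)"
  define c where "c = (\<integral>\<^sup>+t. (S t)\<^sup>2 \<partial>circ)"
  define a where "a = (\<integral>\<^sup>+t. (f t)\<^sup>2 \<partial>circ)"
  \<comment> \<open>Crude finiteness through e0 and B. These do not enter the final constant; the
    bounds on b and c only permit the two absorptions at the end.\<close>
  have bf: "b < top"
  proof -
    have "b \<le> G\<^sup>2 * ennreal (2 * pi)" unfolding b_def
      by (intro nn_integral_circ_le_const power_mono g_le) auto
    also have "\<dots> < top" using Gf by (simp add: ennreal_mult_less_top power_less_top_ennreal)
    finally show ?thesis .
  qed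
  have cf: "c < top"
  proof -
    have "c \<le> (ennreal (1 / e0) * G * ennreal (2 * pi))\<^sup>2 * ennreal (2 * pi)" unfolding c_def
      by (intro nn_integral_circ_le_const power_mono S_le) auto
    also have "\<dots> < top" using Gf by (simp add: ennreal_mult_less_top power_less_top_ennreal)
    finally show ?thesis .
  qed
  have b_eq: "b = (\<integral>\<^sup>+x. f x * S x \<partial>circ)"
  proof -
    have "b = (\<integral>\<^sup>+t. \<integral>\<^sup>+x. g t * (k t x * f x) \<partial>circ \<partial>circ)"
      unfolding b_def power2_eq_square
      by (subst nn_integral_cmult) (auto simp: g_def)
    also have "\<dots> = (\<integral>\<^sup>+x. \<integral>\<^sup>+t. g t * (k t x * f x) \<partial>circ \<partial>circ)"
      by (rule circ2.Fubini') measurable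
    also have "\<dots> = (\<integral>\<^sup>+x. \<integral>\<^sup>+t. f x * (k t x * g t) \<partial>circ \<partial>circ)"
      by (simp add: mult_ac)
    also have "\<dots> = (\<integral>\<^sup>+x. f x * S x \<partial>circ)"
      unfolding S_def by (subst nn_integral_cmult) auto
    finally show ?thesis .
  qed
  \<comment> \<open>The kernel of T composed with its adjoint. After \<open>kern_mult_le\<close> one
    kernel is free to be integrated, with mass at most 2 pi; with the factor 4 this gives 8
    pi.\<close>
  have kk: "(\<integral>\<^sup>+x. k t x * k u x \<partial>circ) \<le> ennreal (8 * pi) * (k t u + k u t)" for t u
  proof -
    have ptw: "k t x * k u x \<le> ennreal 4 * (k t u * k u x + k u t * k t x)" for x
    proof -
      have "kern (e t) (cis t) (cis x) * kern (e u) (cis u) (cis x) \<le>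
        4 * (kern (e t) (cis t) (cis u) * kern (e u) (cis u) (cis x) +
             kern (e u) (cis u) (cis t) * kern (e t) (cis t) (cis x))"
        using kern_mult_le[OF epos[of t] epos[of u], of "cis t" "cis x" "cis u"]
        by (simp add: kern_commute[of _ "cis x" "cis u"] kern_commute[of "e u" "cis t" "cis u"] mult_ac)
      hence "ennreal (kern (e t) (cis t) (cis x) * kern (e u) (cis u) (cis x)) \<le>
        ennreal (4 * (kern (e t) (cis t) (cis u) * kern (e u) (cis u) (cis x) +
             kern (e u) (cis u) (cis t) * kern (e t) (cis t) (cis x)))" by (rule ennreal_leI)
      thus ?thesis unfolding k_def using epos[of t] epos[of u]
        by (simp add: ennreal_mult ennreal_plus)
    qed
    have int: "(\<integral>\<^sup>+x. k t x \<partial>circ) \<le> ennreal (2 * pi)" for t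
      unfolding k_def using epos[of t] e0(3)[of t] by (intro nn_integral_kern_le) auto
    have "(\<integral>\<^sup>+x. k t x * k u x \<partial>circ) \<le> (\<integral>\<^sup>+x. ennreal 4 * (k t u * k u x + k u t * k t x) \<partial>circ)"
      by (intro nn_integral_mono ptw)
    also have "\<dots> = ennreal 4 * (k t u * (\<integral>\<^sup>+x. k u x \<partial>circ) + k u t * (\<integral>\<^sup>+x. k t x \<partial>circ))"
      by (subst nn_integral_cmult, measurable)
         (subst nn_integral_add, measurable, simp add: nn_integral_cmult)
    also have "\<dots> \<le> ennreal 4 * (k t u * ennreal (2 * pi) + k u t * ennreal (2 * pi))"
      by (intro mult_left_mono add_mono int) auto
    also have "\<dots> = ennreal 4 * ennreal (2 * pi) * (k t u + k u t)"
      by (simp add: algebra_simps)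
    also have "ennreal 4 * ennreal (2 * pi) = ennreal (8 * pi)"
      by (subst ennreal_mult[symmetric]) auto
    finally show ?thesis .
  qed
  have gS: "(\<integral>\<^sup>+t. \<integral>\<^sup>+u. g t * g u * k t u \<partial>circ \<partial>circ) = (\<integral>\<^sup>+u. g u * S u \<partial>circ)"
  proof -
    have "(\<integral>\<^sup>+t. \<integral>\<^sup>+u. g t * g u * k t u \<partial>circ \<partial>circ) = (\<integral>\<^sup>+u. \<integral>\<^sup>+t. g u * (k t u * g t) \<partial>circ \<partial>circ)"
      by (subst circ2.Fubini') (auto simp: mult_ac)
    also have "\<dots> = (\<integral>\<^sup>+u. g u * S u \<partial>circ)"
      unfolding S_def by (subst nn_integral_cmult) auto
    finally show ?thesis .
  qed
  have gS': "(\<integral>\<^sup>+t. \<integral>\<^sup>+u. g t * g u * k u t \<partial>circ \<partial>circ) = (\<integral>\<^sup>+u. g u * S u \<partial>circ)"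
  proof -
    have "(\<integral>\<^sup>+t. \<integral>\<^sup>+u. g t * g u * k u t \<partial>circ \<partial>circ) = (\<integral>\<^sup>+t. \<integral>\<^sup>+u. g t * (k u t * g u) \<partial>circ \<partial>circ)"
      by (simp add: mult_ac)
    also have "\<dots> = (\<integral>\<^sup>+u. g u * S u \<partial>circ)"
      unfolding S_def by (subst nn_integral_cmult) auto
    finally show ?thesis .
  qed
  \<comment> \<open>c is the pairing of g with T applied to S, a double integral of g against the
    kernel just bounded. The two halves of the bound contribute the pairing of g and S once each, so
    8 pi doubles.\<close>
  have c_le: "c \<le> ennreal (16 * pi) * (\<integral>\<^sup>+u. g u * S u \<partial>circ)"
  proof -
    have "c = (\<integral>\<^sup>+x. \<integral>\<^sup>+t. \<integral>\<^sup>+u. (g t * g u) * (k t x * k u x) \<partial>circ \<partial>circ \<partial>circ)"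
      unfolding c_def power2_eq_square
    proof (rule nn_integral_cong)
      fix x
      have "(\<integral>\<^sup>+t. \<integral>\<^sup>+u. (g t * g u) * (k t x * k u x) \<partial>circ \<partial>circ) =
         (\<integral>\<^sup>+t. \<integral>\<^sup>+u. (k t x * g t) * (k u x * g u) \<partial>circ \<partial>circ)" by (simp add: mult_ac)
      also have "\<dots> = (\<integral>\<^sup>+t. (k t x * g t) * S x \<partial>circ)"
        unfolding S_def by (subst nn_integral_cmult) auto
      also have "\<dots> = S x * S x"
        by (subst nn_integral_multc) (auto simp: S_def)
      finally show "S x * S x = (\<integral>\<^sup>+t. \<integral>\<^sup>+u. (g t * g u) * (k t x * k u x) \<partial>circ \<partial>circ)" by simp
    qed
    also have "\<dots> = (\<integral>\<^sup>+t. \<integral>\<^sup>+x. \<integral>\<^sup>+u. (g t * g u) * (k t x * k u x) \<partial>circ \<partial>circ \<partial>circ)"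
      by (rule circ2.Fubini') measurable
    also have "\<dots> = (\<integral>\<^sup>+t. \<integral>\<^sup>+u. \<integral>\<^sup>+x. (g t * g u) * (k t x * k u x) \<partial>circ \<partial>circ \<partial>circ)"
      by (intro nn_integral_cong circ2.Fubini') measurable
    also have "\<dots> = (\<integral>\<^sup>+t. \<integral>\<^sup>+u. (g t * g u) * (\<integral>\<^sup>+x. k t x * k u x \<partial>circ) \<partial>circ \<partial>circ)"
      by (intro nn_integral_cong nn_integral_cmult) measurable
    also have "\<dots> \<le> (\<integral>\<^sup>+t. \<integral>\<^sup>+u. (g t * g u) * (ennreal (8 * pi) * (k t u + k u t)) \<partial>circ \<partial>circ)"
      by (intro nn_integral_mono mult_left_mono kk) auto
    also have "\<dots> = (\<integral>\<^sup>+t. \<integral>\<^sup>+u. ennreal (8 * pi) * (g t * g u * k t u + g t * g u * k u t) \<partial>circ \<partial>circ)"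
      by (simp add: algebra_simps)
    also have "\<dots> = (\<integral>\<^sup>+t. ennreal (8 * pi) * ((\<integral>\<^sup>+u. g t * g u * k t u \<partial>circ) + (\<integral>\<^sup>+u. g t * g u * k u t \<partial>circ)) \<partial>circ)"
      by (intro nn_integral_cong, subst nn_integral_cmult, measurable)
         (subst nn_integral_add, measurable)
    also have "\<dots> = ennreal (8 * pi) * ((\<integral>\<^sup>+t. \<integral>\<^sup>+u. g t * g u * k t u \<partial>circ \<partial>circ) + (\<integral>\<^sup>+t. \<integral>\<^sup>+u. g t * g u * k u t \<partial>circ \<partial>circ))"
      by (subst nn_integral_cmult, measurable) (subst nn_integral_add, measurable)
    also have "\<dots> = ennreal (8 * pi) * (2 * (\<integral>\<^sup>+u. g u * S u \<partial>circ))"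
      unfolding gS gS' by (simp add: mult_2)
    also have "\<dots> = ennreal (16 * pi) * (\<integral>\<^sup>+u. g u * S u \<partial>circ)"
    proof -
      have "ennreal (16 * pi) = ennreal (8 * pi) * 2"
        using ennreal_mult[of "8 * pi" 2] by simp
      thus ?thesis by (simp add: mult.assoc)
    qed
    finally show ?thesis .
  qed
  define K where "K = 16 * pi"
  have K: "K > 0" by (simp add: K_def)
  \<comment> \<open>Young twice: for the pairing of g and S with weight K, which yields c \<le> K^2
    b, and then for b, the pairing of f and S, with weight K^2, which yields b \<le> K^2 a.\<close>
  have "c \<le> ennreal K * (ennreal (K / 2) * b + ennreal (1 / (2 * K)) * c)"
    unfolding b_def c_def K_def
    by (rule order_trans[OF c_le[unfolded c_def] mult_left_mono[OF nn_integral_mult_le_sum_squares]]) auto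
  also have "\<dots> = ennreal (K\<^sup>2 / 2) * b + ennreal (1 / 2) * c"
  proof -
    have "ennreal K * ennreal (K / 2) = ennreal (K\<^sup>2 / 2)" "ennreal K * ennreal (1 / (2 * K)) = ennreal (1 / 2)"
      using K by (simp_all add: ennreal_mult[symmetric] power2_eq_square)
    thus ?thesis by (simp add: distrib_left mult.assoc[symmetric])
  qed
  finally have "c \<le> 2 * (ennreal (K\<^sup>2 / 2) * b)" using cf by (rule ennreal_absorb_half)
  also have "\<dots> = ennreal (K\<^sup>2) * b"
    using ennreal_mult[of 2 "K\<^sup>2 / 2"] by (simp add: mult.assoc[symmetric])
  finally have cb: "c \<le> ennreal (K\<^sup>2) * b" .
  have "b \<le> ennreal (K\<^sup>2 / 2) * a + ennreal (1 / (2 * K\<^sup>2)) * c"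
    unfolding a_def c_def
    by (subst b_eq) (rule nn_integral_mult_le_sum_squares, use K in auto)
  also have "\<dots> \<le> ennreal (K\<^sup>2 / 2) * a + ennreal (1 / (2 * K\<^sup>2)) * (ennreal (K\<^sup>2) * b)"
    by (intro add_mono mult_left_mono cb) auto
  also have "ennreal (1 / (2 * K\<^sup>2)) * (ennreal (K\<^sup>2) * b) = ennreal (1 / 2) * b"
  proof -
    have "ennreal (1 / (2 * K\<^sup>2)) * ennreal (K\<^sup>2) = ennreal (1 / 2)"
      using K by (simp add: ennreal_mult[symmetric])
    thus ?thesis by (simp add: mult.assoc[symmetric])
  qed
  finally have "b \<le> 2 * (ennreal (K\<^sup>2 / 2) * a)" using bf by (rule ennreal_absorb_half)
  also have "\<dots> = ennreal (K\<^sup>2) * a"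
    using ennreal_mult[of 2 "K\<^sup>2 / 2"] by (simp add: mult.assoc[symmetric])
  finally show ?thesis unfolding K_def b_def a_def g_def k_def .
qed

text \<open>The \<open>p\<close>-th power of the quasi-norm, without the root.\<close>

definition Jnorm :: "real \<Rightarrow> (complex \<Rightarrow> complex) \<Rightarrow> ennreal" where
  "Jnorm p g = (\<integral>\<^sup>+t. ennreal (norm (g (cis t)) powr p) \<partial>circ)"

lemma poly_cis_measurable [measurable]:
  assumes [measurable]: "r \<in> borel_measurable M" "s \<in> borel_measurable M"
  shows "(\<lambda>t. poly P (of_real (r t) * cis (s t))) \<in> borel_measurable M"
proof -
  have [measurable]: "poly P \<in> borel_measurable borel"
    by (intro borel_measurable_continuous_onI continuous_intros)
  show ?thesis by measurable
qed

lemma poly_cis_measurable' [measurable]: "(\<lambda>t. poly P (cis t)) \<in> borel_measurable borel"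
  by (intro borel_measurable_continuous_onI continuous_intros)

lemma poly_bounded_disc:
  fixes P :: "complex poly"
  obtains B where "0 \<le> B" "\<And>z. norm z \<le> 1 \<Longrightarrow> norm (poly P z) \<le> B"
proof -
  have "compact (poly P ` cball 0 1)"
    by (intro compact_continuous_image continuous_intros) auto
  hence "bounded (poly P ` cball 0 1)" by (rule compact_imp_bounded)
  then obtain B where "\<And>z. z \<in> cball 0 1 \<Longrightarrow> norm (poly P z) \<le> B"
    unfolding bounded_iff by blast
  thus ?thesis by (intro that[of "max B 0"]) (auto simp: le_max_iff_disj)
qed

lemma Jnorm_poly_finite:
  assumes "0 < p"
  shows "Jnorm p (poly P) < top"
proof -
  obtain B where B: "0 \<le> B" "\<And>z. norm z \<le> 1 \<Longrightarrow> norm (poly P z) \<le> B" using poly_bounded_disc[of P] by blast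
  have "Jnorm p (poly P) \<le> ennreal (B powr p) * ennreal (2 * pi)"
    unfolding Jnorm_def
    by (intro nn_integral_circ_le_const ennreal_leI powr_mono2) (use B assms in auto)
  also have "\<dots> < top" by (simp add: ennreal_mult_less_top)
  finally show ?thesis .
qed

text \<open>The power |P|^(p/2) obeys the kernel inequality whatever p is, and squaring the L_2
  bound for it restores the power p. The constant is (9/pi)^2 (16 pi)^2; it does not involve r0, so
  the radii may approach 1.\<close>

lemma radial_maximal_selector:
  assumes p: "0 < p" and r [measurable]: "r \<in> borel_measurable borel"
    and r0: "\<And>t. 0 \<le> r t" "\<And>t. r t \<le> r0" "r0 < 1"
  shows "(\<integral>\<^sup>+t. ennreal (norm (poly P (of_real (r t) * cis t)) powr p) \<partial>circ) \<le>
    ennreal (144\<^sup>2) * Jnorm p (poly P)"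
proof -
  obtain B where B: "0 \<le> B" "\<And>z. norm z \<le> 1 \<Longrightarrow> norm (poly P z) \<le> B" using poly_bounded_disc[of P] by blast
  define f where "f = (\<lambda>t. ennreal (norm (poly P (cis t)) powr (p / 2)))"
  have [measurable]: "f \<in> borel_measurable borel" unfolding f_def by measurable
  have sq: "ennreal (x powr p) = (ennreal (x powr (p / 2)))\<^sup>2" if "0 \<le> x" for x :: real
    using that by (simp add: power2_eq_square ennreal_mult'[symmetric] powr_add[symmetric])
  have "(\<integral>\<^sup>+t. ennreal (norm (poly P (of_real (r t) * cis t)) powr p) \<partial>circ) \<le>
     (\<integral>\<^sup>+t. (ennreal (9 / pi) * (\<integral>\<^sup>+x. ennreal (kern (1 - r t) (cis t) (cis x)) * f x \<partial>circ))\<^sup>2 \<partial>circ)"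
  proof (intro nn_integral_mono)
    fix t
    have "ennreal (norm (poly P (of_real (r t) * cis t)) powr (p / 2)) \<le>
      ennreal (9 / pi) * (\<integral>\<^sup>+x. ennreal (kern (1 - r t) (cis t) (cis x) * norm (poly P (cis x)) powr (p / 2)) \<partial>circ)"
      using p r0(1)[of t] r0(2)[of t] r0(3) by (intro poly_kern_le) auto
    also have "\<dots> = ennreal (9 / pi) * (\<integral>\<^sup>+x. ennreal (kern (1 - r t) (cis t) (cis x)) * f x \<partial>circ)"
      unfolding f_def by (simp add: ennreal_mult'')
    finally show "ennreal (norm (poly P (of_real (r t) * cis t)) powr p) \<le>
       (ennreal (9 / pi) * (\<integral>\<^sup>+x. ennreal (kern (1 - r t) (cis t) (cis x)) * f x \<partial>circ))\<^sup>2"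
      by (subst sq) (auto intro: power_mono)
  qed
  also have "\<dots> = ennreal ((9 / pi)\<^sup>2) * (\<integral>\<^sup>+t. (\<integral>\<^sup>+x. ennreal (kern (1 - r t) (cis t) (cis x)) * f x \<partial>circ)\<^sup>2 \<partial>circ)"
    unfolding power_mult_distrib by (subst nn_integral_cmult) (auto simp: ennreal_power)
  also have "\<dots> \<le> ennreal ((9 / pi)\<^sup>2) * (ennreal ((16 * pi)\<^sup>2) * (\<integral>\<^sup>+x. (f x)\<^sup>2 \<partial>circ))"
    by (intro mult_left_mono linearized_maximal_L2[where B = "B powr (p / 2)" and ?e0.0 = "1 - r0"])
       (use r0 B p in \<open>auto simp: f_def intro!: ennreal_leI powr_mono2\<close>)
  also have "(\<integral>\<^sup>+x. (f x)\<^sup>2 \<partial>circ) = Jnorm p (poly P)"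
    unfolding Jnorm_def f_def by (simp add: sq)
  also have "ennreal ((9 / pi)\<^sup>2) * (ennreal ((16 * pi)\<^sup>2) * Jnorm p (poly P)) = ennreal (144\<^sup>2) * Jnorm p (poly P)"
  proof -
    have "ennreal ((9 / pi)\<^sup>2) * ennreal ((16 * pi)\<^sup>2) = ennreal (144\<^sup>2)"
      by (subst ennreal_mult[symmetric], simp, simp, subst power_mult_distrib[symmetric]) simp
    thus ?thesis by (simp add: mult.assoc[symmetric])
  qed
  finally show ?thesis .
qed

text \<open>Among finitely many candidates a maximizing one can be chosen measurably. This turns a
  maximum over radii into evaluation at one radius depending on the angle, the form that the
  linearized bound accepts.\<close>

lemma finite_max_selector:
  fixes F :: "real \<Rightarrow> real \<Rightarrow> real"
  assumes R: "finite R" "R \<noteq> {}" and F: "\<And>a. (\<lambda>t. F a t) \<in> borel_measurable borel"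
    and F': "\<And>r. r \<in> borel_measurable borel \<Longrightarrow> (\<lambda>t. F (r t) t) \<in> borel_measurable borel"
  shows "\<exists>r \<in> borel_measurable borel. (\<forall>t. r t \<in> R) \<and> (\<forall>t. \<forall>a\<in>R. F a t \<le> F (r t) t)"
  using R
proof (induction R rule: finite_ne_induct)
  case (singleton x)
  show ?case by (intro bexI[of _ "\<lambda>_. x"]) auto
next
  case (insert x R)
  then obtain r where r: "r \<in> borel_measurable borel" "\<And>t. r t \<in> R" "\<And>t a. a \<in> R \<Longrightarrow> F a t \<le> F (r t) t"
    by blast
  have [measurable]: "r \<in> borel_measurable borel" "(\<lambda>t. F x t) \<in> borel_measurable borel"
    "(\<lambda>t. F (r t) t) \<in> borel_measurable borel" using r(1) F F' by auto
  show ?case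
  proof (intro bexI[of _ "\<lambda>t. if F x t \<le> F (r t) t then r t else x"] conjI allI ballI)
    show "(\<lambda>t. if F x t \<le> F (r t) t then r t else x) \<in> borel_measurable borel" by measurable
    fix t a assume "a \<in> insert x R"
    thus "F a t \<le> F (if F x t \<le> F (r t) t then r t else x) t"
      using r(3)[of a t] by auto
  qed (use r in auto)
qed

text \<open>Maxima over finitely many rational radii are bounded independently of their number.
  Monotone convergence gives the supremum over all rational radii, and continuity in r extends the
  majorant to every r in [0, 1], at every angle and not merely almost everywhere.\<close>

theorem radial_maximal:
  assumes p: "0 < p"
  shows "\<exists>G \<in> borel_measurable borel. (\<forall>t. 0 \<le> G t) \<and>
     (\<forall>t r. 0 \<le> r \<longrightarrow> r \<le> 1 \<longrightarrow> norm (poly P (of_real r * cis t)) \<le> G t) \<and>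
     (\<integral>\<^sup>+t. ennreal (G t powr p) \<partial>circ) \<le> ennreal (144\<^sup>2) * Jnorm p (poly P)"
proof -
  obtain B where B: "0 \<le> B" "\<And>z. norm z \<le> 1 \<Longrightarrow> norm (poly P z) \<le> B" using poly_bounded_disc[of P] by blast
  define Q where "Q = \<rat> \<inter> {0..<1::real}"
  define u where "u = from_nat_into Q"
  have Q: "countable Q" "Q \<noteq> {}" unfolding Q_def by (auto intro: countable_rat countable_Int1 exI[of _ 0])
  have uQ: "u n \<in> Q" for n unfolding u_def using Q(2) by (rule from_nat_into)
  have uQ': "0 \<le> u n" "u n < 1" for n using uQ[of n] by (auto simp: Q_def)
  define F where "F = (\<lambda>r t. norm (poly P (of_real r * cis t)) powr p)"
  define H where "H = (\<lambda>n t. Max ((\<lambda>i. F (u i) t) ` {..n}))"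
  have Fm [measurable]: "(\<lambda>t. F (r t) t) \<in> borel_measurable borel" if [measurable]: "r \<in> borel_measurable borel" for r
    unfolding F_def by measurable
  have H_int: "(\<integral>\<^sup>+t. ennreal (H n t) \<partial>circ) \<le> ennreal (144\<^sup>2) * Jnorm p (poly P)"
    and Hm [measurable]: "H n \<in> borel_measurable borel" for n
  proof -
    obtain r where r: "r \<in> borel_measurable borel" "\<And>t. r t \<in> u ` {..n}"
      "\<And>t a. a \<in> u ` {..n} \<Longrightarrow> F a t \<le> F (r t) t"
      using finite_max_selector[of "u ` {..n}" F] by auto
    have Hr: "H n = (\<lambda>t. F (r t) t)"
    proof
      fix t
      show "H n t = F (r t) t" unfolding H_def
      proof (rule Max_eqI)
        fix y assume "y \<in> (\<lambda>i. F (u i) t) ` {..n}"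
        thus "y \<le> F (r t) t" using r(3) by auto
      next
        show "F (r t) t \<in> (\<lambda>i. F (u i) t) ` {..n}" using r(2)[of t] by auto
      qed auto
    qed
    show "H n \<in> borel_measurable borel" unfolding Hr using r(1) by measurable
    have "Max (u ` {..n}) < 1" using uQ' by (subst Max_less_iff) auto
    moreover have "0 \<le> r t" "r t \<le> Max (u ` {..n})" for t using r(2)[of t] uQ' by auto
    ultimately show "(\<integral>\<^sup>+t. ennreal (H n t) \<partial>circ) \<le> ennreal (144\<^sup>2) * Jnorm p (poly P)"
      unfolding Hr F_def by (intro radial_maximal_selector p r(1)) auto
  qed
  have F_le: "F r t \<le> B powr p" if "0 \<le> r" "r \<le> 1" for r t
    unfolding F_def using that p by (intro powr_mono2 B) (auto simp: norm_mult)
  have F_le_H: "F (u i) t \<le> H n t" if "i \<le> n" for i n t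
    unfolding H_def using that by (intro Max_ge) auto
  have H_le: "H n t \<le> B powr p" for n t
    unfolding H_def using F_le[OF uQ'(1) less_imp_le[OF uQ'(2)]] by (subst Max_le_iff) auto
  have F_nn: "0 \<le> F r t" for r t by (simp add: F_def)
  have H_nn: "0 \<le> H n t" for n t using F_le_H[of 0 n t] F_nn[of "u 0" t] by simp
  have Hmono: "H n t \<le> H m t" if "n \<le> m" for n m t
    unfolding H_def using that by (intro Max_mono) auto
  define S where "S = (\<lambda>t. SUP n. H n t)"
  have bdd: "bdd_above (range (\<lambda>n. H n t))" for t
    using H_le by (intro bdd_aboveI[of _ "B powr p"]) auto
  have S_ge: "H n t \<le> S t" for n t unfolding S_def by (intro cSUP_upper bdd) auto
  have S_nn: "0 \<le> S t" for t using S_ge[of 0 t] H_nn[of 0 t] by simp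
  have Sm [measurable]: "S \<in> borel_measurable borel"
    unfolding S_def using bdd by (intro borel_measurable_cSUP) auto
  have "(\<lambda>n. H n t) \<longlonglongrightarrow> S t" for t unfolding S_def
    by (intro LIMSEQ_incseq_SUP bdd) (auto simp: incseq_def intro: Hmono)
  hence eS: "ennreal (S t) = (SUP n. ennreal (H n t))" for t
    by (intro LIMSEQ_unique[OF tendsto_ennrealI LIMSEQ_SUP]) (auto simp: incseq_def intro!: ennreal_leI Hmono)
  have S_int: "(\<integral>\<^sup>+t. ennreal (S t) \<partial>circ) \<le> ennreal (144\<^sup>2) * Jnorm p (poly P)"
    unfolding eS
  proof (subst nn_integral_monotone_convergence_SUP)
    show "incseq (\<lambda>n t. ennreal (H n t))"
      by (auto simp: incseq_def le_fun_def intro!: ennreal_leI Hmono)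
    show "(SUP n. \<integral>\<^sup>+t. ennreal (H n t) \<partial>circ) \<le> ennreal (144\<^sup>2) * Jnorm p (poly P)"
      by (rule SUP_least) (rule H_int)
  qed measurable
  have F_le_S: "F r t \<le> S t" if r: "0 \<le> r" "r \<le> 1" for r t
  proof (rule ccontr)
    assume "\<not> F r t \<le> S t"
    moreover have "continuous_on UNIV (\<lambda>r. norm (poly P (of_real r * cis t)))"
      by (intro continuous_intros)
    hence "continuous_on UNIV (\<lambda>r. F r t)"
      unfolding F_def by (rule continuous_on_powr') (use p in auto)
    ultimately have "0 < F r t - S t" and "isCont (\<lambda>r. F r t) r"
      by (auto simp: continuous_on_eq_continuous_at)
    then obtain d where d: "0 < d" "\<And>x. dist x r < d \<Longrightarrow> dist (F x t) (F r t) < F r t - S t"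
      unfolding continuous_at_eps_delta by blast
    have d': "S t < F x t" if "\<bar>x - r\<bar> < d" for x
      using d(2)[of x] that by (simp add: dist_real_def abs_less_iff)
    have "max 0 (r - d) < min 1 (r + d)" using r d(1) by auto
    then obtain x where x: "x \<in> \<rat>" "max 0 (r - d) < x" "x < min 1 (r + d)"
      using Rats_dense_in_real by blast
    hence "x \<in> Q" by (auto simp: Q_def)
    then obtain n where "x = u n" unfolding u_def using Q(1)
      by (metis from_nat_into_to_nat_on)
    hence "F x t \<le> S t" using F_le_H[of n n t] S_ge[of n t] by simp
    moreover have "\<bar>x - r\<bar> < d" using x by auto
    ultimately show False using d'[of x] by simp
  qed
  show ?thesis
  proof (intro bexI[of _ "\<lambda>t. S t powr (1 / p)"] conjI allI impI)
    fix t r :: real assume r: "0 \<le> r" "r \<le> 1"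
    have "norm (poly P (of_real r * cis t)) = F r t powr (1 / p)"
      unfolding F_def using p by (simp add: powr_powr)
    also have "\<dots> \<le> S t powr (1 / p)"
      using F_le_S[OF r] F_nn p by (intro powr_mono2) auto
    finally show "norm (poly P (of_real r * cis t)) \<le> S t powr (1 / p)" .
  qed (use S_int S_nn p in \<open>auto simp: powr_powr\<close>)
qed

subsection \<open>De la Vallee-Poussin operators\<close>

definition pmul :: "(nat \<Rightarrow> complex) \<Rightarrow> complex poly \<Rightarrow> complex poly" where
  "pmul m P = (\<Sum>k\<le>degree P. monom (m k * coeff P k) k)"

lemma coeff_pmul [simp]: "coeff (pmul m P) k = m k * coeff P k"
proof -
  have "coeff (pmul m P) k = (\<Sum>i\<le>degree P. if i = k then m i * coeff P i else 0)"
    unfolding pmul_def by (simp add: coeff_sum)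
  also have "\<dots> = m k * coeff P k"
    by (auto simp: coeff_eq_0)
  finally show ?thesis .
qed

lemma poly_eq_sum_atMost:
  fixes P :: "complex poly"
  assumes "degree P \<le> n"
  shows "poly P z = (\<Sum>k\<le>n. coeff P k * z ^ k)"
  unfolding poly_altdef
  by (rule sum.mono_neutral_left) (use assms in \<open>auto simp: coeff_eq_0\<close>)

lemma degree_pmul_le: "degree (pmul m P) \<le> degree P"
  by (rule degree_le) (auto simp: coeff_eq_0)

lemma poly_pmul: "degree P \<le> n \<Longrightarrow> poly (pmul m P) z = (\<Sum>k\<le>n. m k * coeff P k * z ^ k)"
  using poly_eq_sum_atMost[of "pmul m P" n z] degree_pmul_le[of m P] by simp

lemma pmul_pmul: "pmul m (pmul m' P) = pmul (\<lambda>k. m k * m' k) P"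
  by (rule poly_eqI) (simp add: mult_ac)

lemma pmul_add_poly: "pmul m (P + Q) = pmul m P + pmul m Q"
  by (rule poly_eqI) (simp add: algebra_simps)

lemma pmul_diff_poly: "pmul m (P - Q) = pmul m P - pmul m Q"
  by (rule poly_eqI) (simp add: algebra_simps)

lemma pmul_cong: "(\<And>k. coeff P k \<noteq> 0 \<Longrightarrow> m k = m' k) \<Longrightarrow> pmul m P = pmul m' P"
  by (rule poly_eqI) auto

lemma pmul_id: "(\<And>k. coeff P k \<noteq> 0 \<Longrightarrow> m k = 1) \<Longrightarrow> pmul m P = P"
  by (rule poly_eqI) auto

lemma cis_int_has_integral:
  fixes m :: int
  shows "((\<lambda>t. cis (of_int m * t)) has_integral (if m = 0 then 2 * pi else 0)) {0..2 * pi}"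
proof (cases "m = 0")
  case True
  have "((\<lambda>t::real. 1::complex) has_integral (2 * pi) *\<^sub>R 1) {0..2 * pi}"
    using has_integral_const_real[of "1::complex" 0 "2 * pi"] by simp
  thus ?thesis using True by (simp add: scaleR_conv_of_real)
next
  case False
  define F where "F = (\<lambda>t. cis (of_int m * t) / (\<i> * of_int m))"
  have "((\<lambda>t. cis (of_int m * t)) has_integral (F (2 * pi) - F 0)) {0..2 * pi}"
  proof (rule fundamental_theorem_of_calculus)
    fix t assume "t \<in> {0..2 * pi}"
    show "(F has_vector_derivative cis (of_int m * t)) (at t within {0..2 * pi})"
      unfolding F_def cis_conv_exp using False
      by (auto intro!: derivative_eq_intros has_vector_derivative_real_field
            simp: field_simps)
  qed simp
  moreover have "F (2 * pi) = F 0"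
  proof -
    have "cis (of_int m * (2 * pi)) = 1" by (metis cis_multiple_2pi Ints_of_int mult.commute)
    thus ?thesis by (simp add: F_def)
  qed
  ultimately show ?thesis using False by simp
qed

text \<open>Integration keeps only the pairs of frequencies with j = k + s: the power with exponent
  s shifts the coefficients of Q down by s, and since P has no negative frequencies those below s
  meet nothing. The radius r is free; taken slightly below 1 it evaluates P inside the disc.\<close>

lemma coefficient_projection:
  fixes P Q :: "complex poly"
  assumes z: "z \<noteq> 0" and r: "r > 0"
  shows "((\<lambda>t. poly Q (z / (of_real r * cis t)) * (of_real r * cis t / z) ^ s * poly P (of_real r * cis t))
    has_integral 2 * pi * poly (pmul (\<lambda>k. coeff Q (k + s)) P) z) {0..2 * pi}"
proof -
  define a where "a = (\<lambda>j k. coeff Q j * coeff P k * (z / of_real r) ^ j * (of_real r / z) ^ s * of_real r ^ k)"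
  define I where "I = {..degree Q + degree P + s}"
  have expand: "poly Q (z / (of_real r * cis t)) * (of_real r * cis t / z) ^ s * poly P (of_real r * cis t) =
      (\<Sum>k\<le>degree P. \<Sum>j\<in>I. a j k * cis (of_int (int k + int s - int j) * t))" for t
  proof -
    have Q: "poly Q x = (\<Sum>j\<in>I. coeff Q j * x ^ j)" for x
      unfolding I_def by (rule poly_eq_sum_atMost) simp
    have c: "cis (of_int (int k + int s - int j) * t) = (1 / cis t) ^ j * cis t ^ s * cis t ^ k" for j k
    proof -
      have "of_int (int k + int s - int j) * t = - (real j * t) + (real s * t + real k * t)"
        by (simp add: algebra_simps)
      hence "cis (of_int (int k + int s - int j) * t) = cis (- (real j * t)) * (cis (real s * t) * cis (real k * t))"
        by (simp only: cis_mult)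
      also have "cis (- (real j * t)) = (1 / cis t) ^ j"
        by (simp add: Complex.DeMoivre power_one_over cis_inverse[symmetric] inverse_eq_divide)
      finally show ?thesis by (simp add: Complex.DeMoivre)
    qed
    have "poly Q (z / (of_real r * cis t)) * (of_real r * cis t / z) ^ s * poly P (of_real r * cis t) =
      (\<Sum>k\<le>degree P. \<Sum>j\<in>I. coeff Q j * (z / (of_real r * cis t)) ^ j * (of_real r * cis t / z) ^ s * (coeff P k * (of_real r * cis t) ^ k))"
      unfolding Q poly_altdef[of P] by (simp add: sum_distrib_left sum_distrib_right)
    also have "\<dots> = (\<Sum>k\<le>degree P. \<Sum>j\<in>I. a j k * cis (of_int (int k + int s - int j) * t))"
      unfolding c a_def by (intro sum.cong refl) (simp add: power_mult_distrib power_divide mult_ac)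
    finally show ?thesis .
  qed
  have "((\<lambda>t. \<Sum>k\<le>degree P. \<Sum>j\<in>I. a j k * cis (of_int (int k + int s - int j) * t)) has_integral
     (\<Sum>k\<le>degree P. \<Sum>j\<in>I. a j k * (if int k + int s - int j = 0 then 2 * pi else 0))) {0..2 * pi}"
    by (intro has_integral_sum has_integral_mult_right cis_int_has_integral) (auto simp: I_def)
  also have "(\<Sum>k\<le>degree P. \<Sum>j\<in>I. a j k * (if int k + int s - int j = 0 then 2 * pi else 0)) =
     (\<Sum>k\<le>degree P. 2 * pi * a (k + s) k)"
  proof (intro sum.cong refl)
    fix k assume "k \<in> {..degree P}"
    hence "k + s \<in> I" by (auto simp: I_def)
    have "(\<Sum>j\<in>I. a j k * (if int k + int s - int j = 0 then 2 * pi else 0)) = (\<Sum>j\<in>I. if j = k + s then 2 * pi * a j k else 0)"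
      by (intro sum.cong refl) auto
    also have "\<dots> = 2 * pi * a (k + s) k" using \<open>k + s \<in> I\<close> by (simp add: I_def)
    finally show "(\<Sum>j\<in>I. a j k * (if int k + int s - int j = 0 then 2 * pi else 0)) = 2 * pi * a (k + s) k" by simp
  qed
  also have "\<dots> = 2 * pi * poly (pmul (\<lambda>k. coeff Q (k + s)) P) z"
  proof -
    have "a (k + s) k = coeff Q (k + s) * coeff P k * z ^ k" for k
      using z r by (simp add: a_def power_add power_divide)
    thus ?thesis by (simp add: poly_pmul[OF order_refl] sum_distrib_left mult.assoc)
  qed
  finally show ?thesis unfolding expand .
qed

definition geom_poly :: "nat \<Rightarrow> complex poly" where
  "geom_poly n = (\<Sum>i<n. monom 1 i)"

text \<open>Shifted by \<open>N (n - 1)\<close>, the coefficients are the indicator of an interval averaged \<open>N\<close> times over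
  \<open>n\<close> consecutive indices. Hence the multiplier is \<open>1\<close> up to \<open>n\<close> and vanishes beyond \<open>(N + 1) n\<close>,
  while the product form makes the kernel decay to order \<open>N + 1\<close>.\<close>

definition vp_poly :: "nat \<Rightarrow> nat \<Rightarrow> nat \<Rightarrow> complex poly" where
  "vp_poly A n N = geom_poly (Suc A) * smult (1 / of_nat n) (geom_poly n) ^ N"

lemma coeff_mult_geom: "coeff (q * geom_poly n) j = (\<Sum>i<n. if i \<le> j then coeff q (j - i) else 0)"
  unfolding geom_poly_def sum_distrib_left
  by (simp add: coeff_sum mult.commute[of q] coeff_monom_mult not_less if_distrib cong: if_cong)
     (intro sum.cong, auto)

text \<open>Each further factor replaces a coefficient by the mean over the n consecutive indices
  ending there. The plateau of ones loses n - 1 indices on the left and the support gains n - 1 on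
  the right.\<close>

lemma coeff_vp_poly:
  assumes n: "1 \<le> n"
  shows "(N * (n - 1) \<le> j \<longrightarrow> j \<le> A \<longrightarrow> coeff (vp_poly A n N) j = 1) \<and>
     (A + N * (n - 1) < j \<longrightarrow> coeff (vp_poly A n N) j = 0)"
proof (induction N arbitrary: j)
  case 0
  show ?case by (simp add: vp_poly_def geom_poly_def coeff_sum)
next
  case (Suc N)
  have c: "coeff (vp_poly A n (Suc N)) j = 1 / of_nat n * (\<Sum>i<n. if i \<le> j then coeff (vp_poly A n N) (j - i) else 0)"
  proof -
    have "vp_poly A n (Suc N) = smult (1 / of_nat n) (vp_poly A n N * geom_poly n)"
      by (simp add: vp_poly_def mult_ac)
    thus ?thesis by (simp add: coeff_mult_geom)
  qed
  show ?case
  proof (intro conjI impI)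
    assume j: "Suc N * (n - 1) \<le> j" "j \<le> A"
    have "(\<Sum>i<n. if i \<le> j then coeff (vp_poly A n N) (j - i) else 0) = (\<Sum>i<n. 1)"
    proof (intro sum.cong refl)
      fix i assume "i \<in> {..<n}"
      hence "i \<le> n - 1" by auto
      hence "i \<le> j" "N * (n - 1) \<le> j - i" "j - i \<le> A" using j by auto
      thus "(if i \<le> j then coeff (vp_poly A n N) (j - i) else 0) = 1" using Suc[of "j - i"] by simp
    qed
    thus "coeff (vp_poly A n (Suc N)) j = 1" using n by (simp add: c)
  next
    assume j: "A + Suc N * (n - 1) < j"
    have "(\<Sum>i<n. if i \<le> j then coeff (vp_poly A n N) (j - i) else 0) = (\<Sum>i<n. 0)"
    proof (intro sum.cong refl)
      fix i assume "i \<in> {..<n}"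
      hence "i \<le> n - 1" by auto
      hence "A + N * (n - 1) < j - i" using j by auto
      thus "(if i \<le> j then coeff (vp_poly A n N) (j - i) else 0) = 0" using Suc[of "j - i"] by simp
    qed
    thus "coeff (vp_poly A n (Suc N)) j = 0" by (simp add: c)
  qed
qed

text \<open>For A = n + N (n - 1) the plateau of ones is [N (n - 1), A]. Shifting down by N (n - 1)
  moves it to [0, n], and the support then ends at n + N (n - 1), which is at most (N + 1)
  n.\<close>

definition vp :: "nat \<Rightarrow> nat \<Rightarrow> nat \<Rightarrow> complex" where
  "vp N n k = coeff (vp_poly (n + N * (n - 1)) n N) (k + N * (n - 1))"

lemma vp_eq_1: "1 \<le> n \<Longrightarrow> k \<le> n \<Longrightarrow> vp N n k = 1"
  unfolding vp_def using coeff_vp_poly[of n N "k + N * (n - 1)" "n + N * (n - 1)"] by simp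

lemma vp_eq_0:
  assumes "1 \<le> n" "(N + 1) * n < k"
  shows "vp N n k = 0"
proof -
  have "N * (n - 1) \<le> N * n" by simp
  hence "n + N * (n - 1) < k" using assms(2) by (simp add: algebra_simps)
  thus ?thesis unfolding vp_def
    using coeff_vp_poly[of n N "k + N * (n - 1)" "n + N * (n - 1)"] assms(1) by simp
qed

lemma poly_geom_poly: "poly (geom_poly n) z * (z - 1) = z ^ n - 1"
  unfolding geom_poly_def by (induction n) (simp_all add: poly_monom algebra_simps)

lemma norm_power_le_exp:
  fixes z :: complex
  assumes n: "1 \<le> n" and z: "1 \<le> norm z" "norm z \<le> 1 + 5 / real n" and k: "k \<le> m * n"
  shows "norm z ^ k \<le> exp (5 * real m)"
proof -
  have "norm z ^ k \<le> norm z ^ (m * n)" using z k by (intro power_increasing) auto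
  also have "\<dots> \<le> exp (5 / real n) ^ (m * n)"
    using order_trans[OF z(2) exp_ge_add_one_self] by (intro power_mono) auto
  also have "\<dots> = exp (5 * real m)" using n by (simp add: exp_of_nat_mult[symmetric])
  finally show ?thesis .
qed

text \<open>Each of the N + 1 geometric sums is (z^k - 1)/(z - 1) with k at most (N + 2) n, and |z|
  \<le> 1 + 5/n keeps |z|^k below a constant; N of the factors carry 1/n in addition.\<close>

lemma norm_vp_poly_le:
  fixes z :: complex
  assumes n: "1 \<le> n" and z: "1 < norm z" "norm z \<le> 1 + 5 / real n"
  shows "norm (poly (vp_poly (n + N * (n - 1)) n N) z) \<le>
    (2 * exp (5 * real (N + 2))) ^ (N + 1) * real n / (real n * norm (z - 1)) ^ (N + 1)"
proof -
  define E where "E = 2 * exp (5 * real (N + 2))"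
  define A where "A = n + N * (n - 1)"
  have A: "Suc A \<le> (N + 2) * n"
  proof -
    have "N * (n - 1) \<le> N * n" by simp
    thus ?thesis using n by (simp add: A_def algebra_simps)
  qed
  have d: "0 < norm (z - 1)" using z(1) by auto
  have g: "norm (poly (geom_poly k) z) \<le> E / norm (z - 1)" if k: "k \<le> (N + 2) * n" for k
  proof -
    have "norm (poly (geom_poly k) z) * norm (z - 1) = norm (z ^ k - 1)"
      by (simp add: norm_mult[symmetric] poly_geom_poly)
    also have "\<dots> \<le> norm z ^ k + 1" using norm_triangle_ineq4[of "z ^ k" 1] by (simp add: norm_power)
    also have "\<dots> \<le> 2 * norm z ^ k" using z(1) by (simp add: one_le_power)
    also have "\<dots> \<le> E" unfolding E_def
      using norm_power_le_exp[OF n less_imp_le[OF z(1)] z(2) k] by simp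
    finally show ?thesis using d by (simp add: field_simps)
  qed
  have "norm (poly (vp_poly A n N) z) = norm (poly (geom_poly (Suc A)) z) * (norm (poly (geom_poly n) z) / real n) ^ N"
    by (simp add: vp_poly_def norm_mult norm_power norm_divide)
  also have "\<dots> \<le> E / norm (z - 1) * (E / norm (z - 1) / real n) ^ N"
    by (intro mult_mono power_mono divide_right_mono g A) (auto simp: E_def)
  also have "\<dots> = E ^ (N + 1) * real n / (real n * norm (z - 1)) ^ (N + 1)"
    using n d by (simp add: field_simps power_mult_distrib)
  finally show ?thesis unfolding A_def E_def .
qed

lemma kern_comparable:
  assumes e: "0 < e" and e': "3 / 4 * e \<le> e'" "e' \<le> 3 * e"
  shows "kern e' z w \<le> 16 / 3 * kern e z w"
proof -
  define d where "d = norm (z - w)"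
  have d: "0 \<le> d" by (simp add: d_def)
  have pos: "0 < e + d" "0 < e' + d" using e e' d by auto
  have "(3 / 4 * (e + d))\<^sup>2 \<le> (e' + d)\<^sup>2" using e e' d by (intro power_mono) auto
  also have "(3 / 4 * (e + d))\<^sup>2 = 9 / 16 * (e + d)\<^sup>2" by (simp only: power_mult_distrib) (simp add: power_divide)
  finally have "9 / 16 * (e + d)\<^sup>2 \<le> (e' + d)\<^sup>2" .
  hence "e' / (e' + d)\<^sup>2 \<le> (3 * e) / (9 / 16 * (e + d)\<^sup>2)"
    using e e' pos by (intro frac_le) auto
  thus ?thesis using pos by (simp add: kern_def d_def field_simps)
qed

text \<open>The kernel estimate for the de la Vallee-Poussin operator on a circle of radius \<open>1 - O(1/n)\<close>
  controls a whole \<open>1/n\<close>-neighbourhood; the decay of the kernel absorbs the growth of the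
  Peetre maximal function, which makes the argument work for all \<open>p > 0\<close> at once.\<close>

lemma vp_local_bound:
  assumes p: "0 < p" and N: "2 / p + 1 \<le> real N"
  shows "\<exists>C>0. \<forall>n\<ge>1. \<forall>P z0 z. norm z0 = 1 \<longrightarrow> norm (z - z0) \<le> 1 / (2 * real n) \<longrightarrow>
    ennreal (norm (poly (pmul (vp N n) P) z) powr p) \<le>
    ennreal C * (\<integral>\<^sup>+t. ennreal (kern (1 / real n) z0 (cis t) * norm (poly P (cis t)) powr p) \<partial>circ)"
proof -
  define E where "E = (2 * exp (5 * real (N + 2))) ^ (N + 1)"
  define C1 where "C1 = E * 6 ^ (N + 1)"
  have E: "0 < E" by (simp add: E_def)
  have C1: "0 < C1" using E by (simp add: C1_def)
  define C where "C = C1 powr p * (384 / pi)"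
  have C: "0 < C" using C1 by (simp add: C_def)
  show ?thesis
  proof (intro exI[of _ C] conjI C allI impI)
    fix n :: nat and P :: "complex poly" and z0 z :: complex
    assume n: "1 \<le> n" and z0: "norm z0 = 1" and z: "norm (z - z0) \<le> 1 / (2 * real n)"
    define e where "e = 1 / real n"
    have e: "0 < e" "e \<le> 1" using n by (auto simp: e_def)
    define I where "I = (\<lambda>w. \<integral>\<^sup>+t. ennreal (kern e w (cis t) * norm (poly P (cis t)) powr p) \<partial>circ)"
    obtain B where B: "0 \<le> B" "\<And>z. norm z \<le> 1 \<Longrightarrow> norm (poly P z) \<le> B" using poly_bounded_disc[of P] by blast
    have "I z0 \<le> ennreal (1 / e * B powr p) * ennreal (2 * pi)"
      unfolding I_def
      by (intro nn_integral_circ_le_const ennreal_leI mult_mono kern_le powr_mono2) (use e B p in auto)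
    also have "\<dots> < top" by (simp add: ennreal_mult_less_top)
    finally obtain \<phi> where phi: "I z0 = ennreal \<phi>" "0 \<le> \<phi>" by (cases "I z0") auto
    \<comment> \<open>Here 1 - r = 3/(n + 3) lies between 3/(4n) and 3/n, so the kernels at scales 1
      - r and 1/n are comparable. When |z| differs from 1 by at most 1/(2n), the quotient |z|/r lies
      between 1 + 1/n and 1 + 5/n, the ring where the kernel polynomial is controlled.\<close>
    define r where "r = real n / (real n + 3)"
    have n3: "real n + 3 > 0" by simp
    have r: "0 < r" "r < 1" using n by (auto simp: r_def)
    have r1: "1 - r = 3 / (real n + 3)" using n by (simp add: r_def field_simps)
    have r1e: "3 / 4 * e \<le> 1 - r" "1 - r \<le> 3 * e" using n by (simp_all add: r1 e_def field_simps)
    define d where "d = (\<lambda>w. e + norm (z0 - w))"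
    have d_pos: "0 < d w" for w using e by (simp add: d_def add_pos_nonneg)
    have d_ge: "1 \<le> real n * d w" for w
      using n by (simp add: d_def e_def field_simps)
    \<comment> \<open>Moving the local mean from w to z0 costs (n d)^2, because e times the kernel
      at (z0, w) is (n d)^(-2). Taking the root of order p leaves the growth (n d)^(2/p). The
      constant is the product of 9/pi, 16/3 and 8.\<close>
    have Pbound: "norm (poly P (of_real r * w)) \<le> (384 / pi * \<phi>) powr (1 / p) * (real n * d w) powr (2 / p)"
      if w: "norm w = 1" for w
    proof -
      have "ennreal (norm (poly P (of_real r * w)) powr p) \<le>
        ennreal (9 / pi) * (\<integral>\<^sup>+t. ennreal (kern (1 - r) w (cis t) * norm (poly P (cis t)) powr p) \<partial>circ)"
        using r by (intro poly_kern_le p w) auto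
      also have "\<dots> \<le> ennreal (9 / pi) * (\<integral>\<^sup>+t. ennreal (16 / 3) * ennreal (kern e w (cis t) * norm (poly P (cis t)) powr p) \<partial>circ)"
      proof (intro mult_left_mono nn_integral_mono)
        fix t
        have "kern (1 - r) w (cis t) * norm (poly P (cis t)) powr p \<le> 16 / 3 * kern e w (cis t) * norm (poly P (cis t)) powr p"
          by (intro mult_right_mono kern_comparable e r1e) auto
        thus "ennreal (kern (1 - r) w (cis t) * norm (poly P (cis t)) powr p) \<le> ennreal (16 / 3) * ennreal (kern e w (cis t) * norm (poly P (cis t)) powr p)"
          by (simp add: ennreal_mult'[symmetric] ennreal_leI mult.assoc)
      qed auto
      also have "\<dots> = ennreal (9 / pi) * (ennreal (16 / 3) * I w)"
        unfolding I_def kern_def by (subst nn_integral_cmult) auto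
      finally have 1: "ennreal (norm (poly P (of_real r * w)) powr p) \<le> ennreal (9 / pi) * (ennreal (16 / 3) * I w)" .
      have 2: "ennreal (e * kern e z0 w) * I w \<le> ennreal 8 * I z0"
      proof -
        have "ennreal (e * kern e z0 w) * I w = (\<integral>\<^sup>+t. ennreal (e * kern e z0 w) * ennreal (kern e w (cis t) * norm (poly P (cis t)) powr p) \<partial>circ)"
          unfolding I_def kern_def by (subst nn_integral_cmult) auto
        also have "\<dots> \<le> (\<integral>\<^sup>+t. ennreal 8 * ennreal (kern e z0 (cis t) * norm (poly P (cis t)) powr p) \<partial>circ)"
        proof (intro nn_integral_mono)
          fix t
          have "kern e z0 w * kern e w (cis t) \<le> 4 * (kern e z0 (cis t) * kern e w (cis t) + kern e z0 w * kern e z0 (cis t))"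
            by (rule kern_mult_le[OF e(1) e(1)])
          also have "\<dots> \<le> 4 * (kern e z0 (cis t) * (1 / e) + (1 / e) * kern e z0 (cis t))"
            using e by (intro mult_left_mono add_mono mult_right_mono kern_le) auto
          finally have "e * kern e z0 w * kern e w (cis t) \<le> 8 * kern e z0 (cis t)"
            using e by (simp add: field_simps)
          hence "e * kern e z0 w * kern e w (cis t) * norm (poly P (cis t)) powr p \<le> 8 * kern e z0 (cis t) * norm (poly P (cis t)) powr p"
            by (rule mult_right_mono) auto
          thus "ennreal (e * kern e z0 w) * ennreal (kern e w (cis t) * norm (poly P (cis t)) powr p) \<le>
             ennreal 8 * ennreal (kern e z0 (cis t) * norm (poly P (cis t)) powr p)"
            using e by (simp only: ennreal_mult'[symmetric] mult.assoc mult_nonneg_nonneg kern_nonneg less_imp_le zero_le_numeral ennreal_leI)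
        qed
        also have "\<dots> = ennreal 8 * I z0"
          unfolding I_def kern_def by (subst nn_integral_cmult) auto
        finally show ?thesis .
      qed
      have k: "e * kern e z0 w = 1 / (real n * d w)\<^sup>2"
      proof -
        have "kern e z0 w = e / (d w)\<^sup>2" by (simp add: kern_def d_def)
        moreover have "real n = 1 / e" by (simp add: e_def)
        ultimately show ?thesis using e(1) d_pos[of w] by (simp add: power2_eq_square)
      qed
      have "ennreal (1 / (real n * d w)\<^sup>2 * norm (poly P (of_real r * w)) powr p) =
          ennreal (e * kern e z0 w) * ennreal (norm (poly P (of_real r * w)) powr p)"
        unfolding k by (rule ennreal_mult) auto
      also have "\<dots> \<le> ennreal (e * kern e z0 w) * (ennreal (9 / pi) * (ennreal (16 / 3) * I w))"
        by (intro mult_left_mono 1) auto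
      also have "\<dots> = ennreal (9 / pi) * ennreal (16 / 3) * (ennreal (e * kern e z0 w) * I w)"
        by (simp only: mult_ac)
      also have "\<dots> \<le> ennreal (9 / pi) * ennreal (16 / 3) * (ennreal 8 * I z0)"
        by (intro mult_left_mono 2) auto
      also have "\<dots> = ennreal (384 / pi * \<phi>)"
        unfolding phi(1) using phi(2) by (simp only: ennreal_mult''[symmetric] zero_le_numeral divide_nonneg_nonneg mult_nonneg_nonneg) simp
      finally have "1 / (real n * d w)\<^sup>2 * norm (poly P (of_real r * w)) powr p \<le> 384 / pi * \<phi>"
        using phi(2) by (subst (asm) ennreal_le_iff) auto
      moreover have "0 < (real n * d w)\<^sup>2" using d_ge[of w] by (intro zero_less_power) linarith
      ultimately have 3: "norm (poly P (of_real r * w)) powr p \<le> 384 / pi * \<phi> * (real n * d w)\<^sup>2"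
        by (simp only: times_divide_eq_left mult_1 pos_divide_le_eq)
      have "norm (poly P (of_real r * w)) = (norm (poly P (of_real r * w)) powr p) powr (1 / p)"
        using p by (simp add: powr_powr)
      also have "\<dots> \<le> (384 / pi * \<phi> * (real n * d w)\<^sup>2) powr (1 / p)"
        using 3 p by (intro powr_mono2) auto
      also have "\<dots> = (384 / pi * \<phi>) powr (1 / p) * ((real n * d w)\<^sup>2) powr (1 / p)"
        using phi(2) by (intro powr_mult) 
      also have "((real n * d w)\<^sup>2) powr (1 / p) = (real n * d w) powr (2 / p)"
      proof -
        have "(real n * d w)\<^sup>2 = (real n * d w) powr 2"
          using d_ge[of w] by (subst powr_numeral) auto
        thus ?thesis by (simp add: powr_powr)
      qed
      finally show ?thesis .
    qed
    have zn: "1 / 2 \<le> norm z" "1 - 1 / (2 * real n) \<le> norm z" "norm z \<le> 1 + 1 / (2 * real n)"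
    proof -
      have "norm z0 - norm (z - z0) \<le> norm z" using norm_triangle_ineq2[of z0 "z0 - z"] by (simp add: norm_minus_commute)
      moreover have "norm z \<le> norm z0 + norm (z - z0)" using norm_triangle_ineq[of z0 "z - z0"] by simp
      moreover have "1 / (2 * real n) \<le> 1 / 2" using n by (simp add: field_simps)
      ultimately show "1 / 2 \<le> norm z" "1 - 1 / (2 * real n) \<le> norm z" "norm z \<le> 1 + 1 / (2 * real n)"
        using z z0 by linarith+
    qed
    have zne: "z \<noteq> 0" using zn(1) by auto
    define s where "s = N * (n - 1)"
    define Q where "Q = vp_poly (n + s) n N"
    define F where "F = (\<lambda>t. poly Q (z / (of_real r * cis t)) * (of_real r * cis t / z) ^ s * poly P (of_real r * cis t))"
    define K where "K = C1 * (384 / pi * \<phi>) powr (1 / p)"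
    have K: "0 \<le> K" using C1 phi by (simp add: K_def)
    have F_le: "norm (F t) \<le> K * kern e z0 (cis t)" for t
    proof -
      define u where "u = z / (of_real r * cis t)"
      have un: "norm u = norm z / r" using r by (simp add: u_def norm_divide norm_mult)
      have u1: "1 + 1 / real n \<le> norm u"
      proof -
        have "1 / (2 * real n) \<le> 2 / (real n + 3)" using n by (simp add: field_simps)
        moreover have "(1 + 1 / real n) * r = 1 - 2 / (real n + 3)"
        proof -
          have "(1 + 1 / real n) * r = ((1 + 1 / real n) * real n) / (real n + 3)" by (simp add: r_def)
          also have "(1 + 1 / real n) * real n = real n + 1" using n by (simp add: distrib_right)
          also have "(real n + 1) / (real n + 3) = 1 - 2 / (real n + 3)"
            using n3 by (simp add: divide_simps)
          finally show ?thesis .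
        qed
        ultimately have "(1 + 1 / real n) * r \<le> 1 - 1 / (2 * real n)" by linarith
        hence "(1 + 1 / real n) * r \<le> norm z" using zn(2) by linarith
        thus ?thesis using r by (simp add: un field_simps)
      qed
      have u2: "norm u \<le> 1 + 5 / real n"
      proof -
        have "1 / (2 * real n) \<le> 2 / (real n + 3)" using n by (simp add: field_simps)
        moreover have "(1 + 5 / real n) * r = 1 + 2 / (real n + 3)"
        proof -
          have "(1 + 5 / real n) * r = ((1 + 5 / real n) * real n) / (real n + 3)" by (simp add: r_def)
          also have "(1 + 5 / real n) * real n = real n + 5" using n by (simp add: distrib_right)
          also have "(real n + 5) / (real n + 3) = 1 + 2 / (real n + 3)"
            using n3 by (simp add: divide_simps)
          finally show ?thesis .
        qed
        ultimately have "1 + 1 / (2 * real n) \<le> (1 + 5 / real n) * r" by linarith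
        hence "norm z \<le> (1 + 5 / real n) * r" using zn(3) by linarith
        thus ?thesis using r by (simp add: un field_simps)
      qed
      have u0: "1 < norm u" using u1 n by (smt (verit) divide_pos_pos of_nat_0_less_iff zero_less_one less_le_trans)
      have u_ge: "1 / real n \<le> norm (u - 1)" using norm_triangle_ineq2[of u 1] u1 by simp
      have du: "d (cis t) \<le> 6 * norm (u - 1)"
      proof -
        have "z0 - cis t = (z0 - z) + of_real r * cis t * (u - 1) + of_real (r - 1) * cis t"
          using r by (simp add: u_def algebra_simps)
        also have "norm \<dots> \<le> norm (z0 - z) + norm (of_real r * cis t * (u - 1)) + norm (of_real (r - 1) * cis t)"
          by (intro norm_triangle_le add_mono norm_triangle_ineq order_refl)
        also have "norm (of_real r * cis t * (u - 1)) = r * norm (u - 1)" using r by (simp add: norm_mult)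
        also have "norm (of_real (r - 1) * cis t) = 1 - r" using r by (simp add: norm_mult del: of_real_diff)
        also have "r * norm (u - 1) \<le> norm (u - 1)" using r by (simp add: mult_left_le_one_le)
        finally have "norm (z0 - cis t) \<le> 1 / (2 * real n) + norm (u - 1) + 3 * e"
          using z r1e(2) by (simp add: norm_minus_commute)
        hence "d (cis t) \<le> norm (u - 1) + 9 / 2 * e" by (simp add: d_def e_def)
        also have "\<dots> \<le> 6 * norm (u - 1)" using u_ge norm_ge_zero[of "u - 1"] unfolding e_def by linarith
        finally show ?thesis .
      qed
      define x where "x = real n * d (cis t)"
      have x: "1 \<le> x" using d_ge by (simp add: x_def)
      have Qn: "norm (poly Q u) \<le> C1 * real n / x ^ (N + 1)"
      proof -
        have "norm (poly Q u) \<le> E * real n / (real n * norm (u - 1)) ^ (N + 1)"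
          unfolding Q_def s_def E_def by (rule norm_vp_poly_le[OF n u0 u2])
        also have "\<dots> \<le> E * real n / (x / 6) ^ (N + 1)"
        proof (intro divide_left_mono power_mono mult_pos_pos zero_less_power)
          show "x / 6 \<le> real n * norm (u - 1)" using du n by (simp add: x_def mult_left_mono)
        qed (use E x u0 n in auto)
        also have "\<dots> = C1 * real n / x ^ (N + 1)" by (simp add: C1_def power_divide)
        finally show ?thesis .
      qed
      have Sn: "norm ((of_real r * cis t / z) ^ s) \<le> 1"
      proof -
        have "norm (of_real r * cis t / z) = 1 / norm u" using r zne by (simp add: un norm_mult norm_divide)
        moreover have "(1 / norm u) ^ s \<le> 1" using u0 by (intro power_le_one) (auto simp: divide_le_eq_1)
        ultimately show ?thesis by (simp only: norm_power)
      qed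
      have "norm (F t) \<le> C1 * real n / x ^ (N + 1) * 1 * ((384 / pi * \<phi>) powr (1 / p) * x powr (2 / p))"
        unfolding F_def norm_mult u_def[symmetric]
      proof (intro mult_mono Qn Sn)
        show "norm (poly P (of_real r * cis t)) \<le> (384 / pi * \<phi>) powr (1 / p) * x powr (2 / p)"
          unfolding x_def by (rule Pbound) simp
      qed (use C1 x in auto)
      also have "\<dots> = K * (real n * (x powr (2 / p) / x ^ (N + 1)))" by (simp add: K_def)
      \<comment> \<open>Here N \<ge> 2/p + 1 is spent: after the growth x^(2/p) the decay x^(-N-1)
        still leaves x^(-2), and n x^(-2) is the kernel at scale 1/n.\<close>
      also have "x powr (2 / p) / x ^ (N + 1) \<le> 1 / x\<^sup>2"
      proof -
        have "x powr (2 / p) / x ^ (N + 1) = x powr (2 / p - real (N + 1))"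
          using x by (simp add: powr_diff powr_realpow del: of_nat_add of_nat_Suc)
        also have "\<dots> \<le> x powr (- 2)" using x N by (intro powr_mono) auto
        also have "\<dots> = 1 / x\<^sup>2" using x by (simp add: powr_minus_divide)
        finally show ?thesis .
      qed
      hence "K * (real n * (x powr (2 / p) / x ^ (N + 1))) \<le> K * (real n * (1 / x\<^sup>2))"
        using K by (intro mult_left_mono) auto
      also have "real n * (1 / x\<^sup>2) = kern e z0 (cis t)"
      proof -
        have "kern e z0 (cis t) = e / (d (cis t))\<^sup>2" by (simp add: kern_def d_def)
        moreover have "real n = 1 / e" by (simp add: e_def)
        ultimately show ?thesis using e(1) d_pos[of "cis t"] by (simp add: x_def power2_eq_square)
      qed
      finally show ?thesis by simp
    qed
    have "ennreal (norm (2 * pi * poly (pmul (vp N n) P) z)) \<le> (\<integral>\<^sup>+t. ennreal (norm (F t)) \<partial>circ)"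
    proof (rule norm_integral_le_circ)
      show "continuous_on UNIV F" unfolding F_def using r zne by (intro continuous_intros) auto
      show "(F has_integral complex_of_real (2 * pi) * poly (pmul (vp N n) P) z) {0..2 * pi}"
        unfolding F_def using coefficient_projection[OF zne r(1), of Q s P]
        by (simp add: vp_def[abs_def] Q_def s_def)
    qed
    also have "\<dots> \<le> (\<integral>\<^sup>+t. ennreal K * ennreal (kern e z0 (cis t)) \<partial>circ)"
      by (intro nn_integral_mono) (use F_le K in \<open>simp add: ennreal_mult'[symmetric] ennreal_leI\<close>)
    also have "\<dots> = ennreal K * (\<integral>\<^sup>+t. ennreal (kern e z0 (cis t)) \<partial>circ)"
      unfolding kern_def by (subst nn_integral_cmult) auto
    also have "\<dots> \<le> ennreal K * ennreal (2 * pi)"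
      by (intro mult_left_mono nn_integral_kern_le e z0) auto
    also have "\<dots> = ennreal (K * (2 * pi))" using K by (simp add: ennreal_mult)
    finally have "norm (2 * pi * poly (pmul (vp N n) P) z) \<le> K * (2 * pi)"
      using K by (subst (asm) ennreal_le_iff) auto
    hence Vn: "norm (poly (pmul (vp N n) P) z) \<le> K" by (simp add: norm_mult)
    have "norm (poly (pmul (vp N n) P) z) powr p \<le> K powr p"
      using Vn p by (intro powr_mono2) auto
    also have "\<dots> = C * \<phi>"
      unfolding K_def C_def using C1 phi(2) p by (simp add: powr_mult powr_powr)
    finally have "ennreal (norm (poly (pmul (vp N n) P) z) powr p) \<le> ennreal (C * \<phi>)" by (rule ennreal_leI)
    also have "\<dots> = ennreal C * I z0" using C phi by (simp add: ennreal_mult)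
    finally show "ennreal (norm (poly (pmul (vp N n) P) z) powr p) \<le> ennreal C *
       (\<integral>\<^sup>+t. ennreal (kern (1 / real n) z0 (cis t) * norm (poly P (cis t)) powr p) \<partial>circ)"
      by (simp only: I_def e_def)
  qed
qed

section \<open>The operators for a fixed exponent, local maximal functions and Nikolskii's
  inequality\<close>

definition vpN :: "real \<Rightarrow> nat" where "vpN p = nat \<lceil>2 / p + 1\<rceil>"

lemma vpN: "2 / p + 1 \<le> real (vpN p)"
  unfolding vpN_def by linarith

definition vpop :: "real \<Rightarrow> nat \<Rightarrow> complex poly \<Rightarrow> complex poly" where
  "vpop p n = pmul (vp (vpN p) n)"

lemma vpop_id: "1 \<le> n \<Longrightarrow> degree P \<le> n \<Longrightarrow> vpop p n P = P"
  unfolding vpop_def by (rule pmul_id) (metis le_degree le_trans vp_eq_1)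

lemma Jnorm_cong: "(\<And>t. norm (f (cis t)) = norm (g (cis t))) \<Longrightarrow> Jnorm p f = Jnorm p g"
  unfolding Jnorm_def by simp

lemma Jnorm_le_majorant:
  assumes f: "\<And>t. norm (f (cis t)) \<le> c * G t" and p: "0 < p" and c: "0 \<le> c"
    and G: "G \<in> borel_measurable borel" "\<And>t. 0 \<le> G t"
  shows "Jnorm p f \<le> ennreal (c powr p) * (\<integral>\<^sup>+t. ennreal (G t powr p) \<partial>circ)"
proof -
  have [measurable]: "G \<in> borel_measurable borel" by fact
  have "Jnorm p f \<le> (\<integral>\<^sup>+t. ennreal (c powr p) * ennreal (G t powr p) \<partial>circ)"
    unfolding Jnorm_def
  proof (rule nn_integral_mono)
    fix t
    have "norm (f (cis t)) powr p \<le> (c * G t) powr p" using f p by (intro powr_mono2) auto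
    also have "\<dots> = c powr p * G t powr p" using c G by (simp add: powr_mult)
    finally show "ennreal (norm (f (cis t)) powr p) \<le> ennreal (c powr p) * ennreal (G t powr p)"
      by (simp add: ennreal_mult'[symmetric] ennreal_leI)
  qed
  also have "\<dots> = ennreal (c powr p) * (\<integral>\<^sup>+t. ennreal (G t powr p) \<partial>circ)"
    by (rule nn_integral_cmult) measurable
  finally show ?thesis .
qed

lemma powr_add_le:
  fixes a b :: real
  assumes "0 \<le> a" "0 \<le> b" "0 < p"
  shows "(a + b) powr p \<le> 2 powr p * (a powr p + b powr p)"
proof -
  have "(a + b) powr p \<le> (2 * max a b) powr p" using assms by (intro powr_mono2) auto
  also have "\<dots> = 2 powr p * max a b powr p" using assms by (simp add: powr_mult)
  also have "max a b powr p \<le> a powr p + b powr p" by (cases "a \<le> b") (auto simp: max_def)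
  finally show ?thesis by simp
qed

lemma nn_integral_powr_add_le:
  assumes [measurable]: "F \<in> borel_measurable borel" "G \<in> borel_measurable borel"
    and nn: "\<And>t. 0 \<le> F t" "\<And>t. 0 \<le> G t" and p: "0 < p"
  shows "(\<integral>\<^sup>+t. ennreal ((F t + G t) powr p) \<partial>circ) \<le>
     ennreal (2 powr p) * ((\<integral>\<^sup>+t. ennreal (F t powr p) \<partial>circ) + (\<integral>\<^sup>+t. ennreal (G t powr p) \<partial>circ))"
proof -
  have "(\<integral>\<^sup>+t. ennreal ((F t + G t) powr p) \<partial>circ) \<le>
     (\<integral>\<^sup>+t. ennreal (2 powr p) * (ennreal (F t powr p) + ennreal (G t powr p)) \<partial>circ)"
    by (intro nn_integral_mono)
       (use powr_add_le[OF nn p] in \<open>simp add: ennreal_plus[symmetric] ennreal_mult'[symmetric] ennreal_leI del: ennreal_plus\<close>)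
  also have "\<dots> = ennreal (2 powr p) * ((\<integral>\<^sup>+t. ennreal (F t powr p) \<partial>circ) + (\<integral>\<^sup>+t. ennreal (G t powr p) \<partial>circ))"
    by (subst nn_integral_cmult, measurable) (subst nn_integral_add, auto)
  finally show ?thesis .
qed

lemma Jnorm_triangle_le:
  assumes b: "\<And>t. norm (f (cis t)) \<le> norm (g (cis t)) + norm (h (cis t))" and p: "0 < p"
    and m: "(\<lambda>t. norm (g (cis t))) \<in> borel_measurable borel" "(\<lambda>t. norm (h (cis t))) \<in> borel_measurable borel"
  shows "Jnorm p f \<le> ennreal (2 powr p) * (Jnorm p g + Jnorm p h)"
proof -
  have "Jnorm p f \<le> (\<integral>\<^sup>+t. ennreal ((norm (g (cis t)) + norm (h (cis t))) powr p) \<partial>circ)"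
    unfolding Jnorm_def using b p by (intro nn_integral_mono ennreal_leI powr_mono2) auto
  also have "\<dots> \<le> ennreal (2 powr p) * (Jnorm p g + Jnorm p h)"
    unfolding Jnorm_def by (rule nn_integral_powr_add_le[OF m]) (use p in auto)
  finally show ?thesis .
qed

lemma norm_poly_cis_measurable [measurable]: "(\<lambda>t. norm (poly P (cis t))) \<in> borel_measurable borel"
  by measurable

text \<open>G^p is C times the mean of |P|^p against the kernel at scale 1/n; Fubini and the mass 2
  pi of the kernel bound its integral. The discs around cis t reach beyond the unit disc, so that
  derivatives can be estimated at boundary points.\<close>

theorem vpop_local_maximal:
  assumes p: "0 < p"
  shows "\<exists>C>0. \<forall>n\<ge>1. \<forall>P. \<exists>G\<in>borel_measurable borel. (\<forall>t. 0 \<le> G t) \<and>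
     (\<forall>t z. norm (z - cis t) \<le> 1 / (2 * real n) \<longrightarrow> norm (poly (vpop p n P) z) \<le> G t) \<and>
     (\<integral>\<^sup>+t. ennreal (G t powr p) \<partial>circ) \<le> ennreal C * Jnorm p (poly P)"
proof -
  from vp_local_bound[OF p vpN] obtain C where C: "C > 0"
    and b: "\<And>n P z0 z. 1 \<le> n \<Longrightarrow> norm z0 = 1 \<Longrightarrow> norm (z - z0) \<le> 1 / (2 * real n) \<Longrightarrow>
    ennreal (norm (poly (pmul (vp (vpN p) n) P) z) powr p) \<le>
    ennreal C * (\<integral>\<^sup>+t. ennreal (kern (1 / real n) z0 (cis t) * norm (poly P (cis t)) powr p) \<partial>circ)"
    by blast
  show ?thesis
  proof (intro exI[of _ "C * (2 * pi)"] conjI allI impI)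
    show "0 < C * (2 * pi)" using C by simp
    fix n :: nat and P :: "complex poly"
    assume n: "1 \<le> n"
    define e where "e = 1 / real n"
    have e: "0 < e" "e \<le> 1" using n by (auto simp: e_def)
    define I where "I = (\<lambda>t. \<integral>\<^sup>+x. ennreal (kern e (cis t) (cis x) * norm (poly P (cis x)) powr p) \<partial>circ)"
    have I_eq: "I t = (\<integral>\<^sup>+x. ennreal (kern e (cis t) (cis x)) * ennreal (norm (poly P (cis x)) powr p) \<partial>circ)" for t
      unfolding I_def by (simp add: ennreal_mult'')
    have Im [measurable]: "I \<in> borel_measurable borel"
    proof -
      have "I \<in> borel_measurable circ" unfolding I_def by measurable
      thus ?thesis by simp
    qed
    obtain B where B: "0 \<le> B" "\<And>z. norm z \<le> 1 \<Longrightarrow> norm (poly P z) \<le> B" using poly_bounded_disc[of P] by blast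
    have If: "I t < top" for t
    proof -
      have "I t \<le> ennreal (1 / e * B powr p) * ennreal (2 * pi)"
        unfolding I_def
        by (intro nn_integral_circ_le_const ennreal_leI mult_mono kern_le powr_mono2) (use e B p in auto)
      also have "\<dots> < top" by (simp add: ennreal_mult_less_top)
      finally show ?thesis .
    qed
    define G where "G = (\<lambda>t. (C * enn2real (I t)) powr (1 / p))"
    have Gp: "ennreal (G t powr p) = ennreal C * I t" for t
      unfolding G_def using p C If[of t] by (simp add: powr_powr ennreal_mult ennreal_enn2real)
    have int: "(\<integral>\<^sup>+t. I t \<partial>circ) \<le> ennreal (2 * pi) * Jnorm p (poly P)"
    proof -
      have "(\<integral>\<^sup>+t. I t \<partial>circ) = (\<integral>\<^sup>+x. \<integral>\<^sup>+t. ennreal (kern e (cis t) (cis x)) * ennreal (norm (poly P (cis x)) powr p) \<partial>circ \<partial>circ)"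
        unfolding I_eq by (rule circ2.Fubini') measurable
      also have "\<dots> = (\<integral>\<^sup>+x. (\<integral>\<^sup>+t. ennreal (kern e (cis x) (cis t)) \<partial>circ) * ennreal (norm (poly P (cis x)) powr p) \<partial>circ)"
        by (subst kern_commute, subst nn_integral_multc) auto
      also have "\<dots> \<le> (\<integral>\<^sup>+x. ennreal (2 * pi) * ennreal (norm (poly P (cis x)) powr p) \<partial>circ)"
        by (intro nn_integral_mono mult_right_mono nn_integral_kern_le e) auto
      also have "\<dots> = ennreal (2 * pi) * Jnorm p (poly P)"
        unfolding Jnorm_def by (subst nn_integral_cmult) auto
      finally show ?thesis .
    qed
    show "\<exists>G\<in>borel_measurable borel. (\<forall>t. 0 \<le> G t) \<and>
     (\<forall>t z. norm (z - cis t) \<le> 1 / (2 * real n) \<longrightarrow> norm (poly (vpop p n P) z) \<le> G t) \<and>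
     (\<integral>\<^sup>+t. ennreal (G t powr p) \<partial>circ) \<le> ennreal (C * (2 * pi)) * Jnorm p (poly P)"
    proof (intro bexI[of _ G] conjI allI impI)
      show "G \<in> borel_measurable borel" unfolding G_def by measurable
      fix t z assume z: "norm (z - cis t) \<le> 1 / (2 * real n)"
      have "ennreal (norm (poly (vpop p n P) z) powr p) \<le> ennreal C * I t"
        unfolding vpop_def I_def e_def by (rule b[OF n _ z]) simp
      hence "norm (poly (vpop p n P) z) powr p \<le> C * enn2real (I t)"
        using If[of t] C
        by (metis Gp ennreal_le_iff powr_ge_zero G_def p powr_powr divide_self less_irrefl nonzero_eq_divide_eq powr_one enn2real_nonneg mult_nonneg_nonneg less_imp_le)
      hence "(norm (poly (vpop p n P) z) powr p) powr (1 / p) \<le> G t"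
        unfolding G_def using p by (intro powr_mono2) auto
      thus "norm (poly (vpop p n P) z) \<le> G t" using p by (simp add: powr_powr)
    next
      have "(\<integral>\<^sup>+t. ennreal (G t powr p) \<partial>circ) = ennreal C * (\<integral>\<^sup>+t. I t \<partial>circ)"
        unfolding Gp by (subst nn_integral_cmult) auto
      also have "\<dots> \<le> ennreal C * (ennreal (2 * pi) * Jnorm p (poly P))" by (intro mult_left_mono int) auto
      also have "\<dots> = ennreal (C * (2 * pi)) * Jnorm p (poly P)" using C by (simp add: ennreal_mult mult.assoc)
      finally show "(\<integral>\<^sup>+t. ennreal (G t powr p) \<partial>circ) \<le> ennreal (C * (2 * pi)) * Jnorm p (poly P)" .
    qed (auto simp: G_def)
  qed
qed

lemma vpop_bounded:
  assumes p: "0 < p"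
  shows "\<exists>C>0. \<forall>n\<ge>1. \<forall>P. Jnorm p (poly (vpop p n P)) \<le> ennreal C * Jnorm p (poly P)"
proof -
  from vpop_local_maximal[OF p] obtain C where C: "C > 0" and
    b: "\<And>n P. 1 \<le> n \<Longrightarrow> \<exists>G\<in>borel_measurable borel. (\<forall>t. 0 \<le> G t) \<and>
     (\<forall>t z. norm (z - cis t) \<le> 1 / (2 * real n) \<longrightarrow> norm (poly (vpop p n P) z) \<le> G t) \<and>
     (\<integral>\<^sup>+t. ennreal (G t powr p) \<partial>circ) \<le> ennreal C * Jnorm p (poly P)" by blast
  show ?thesis
  proof (intro exI[of _ C] conjI C allI impI)
    fix n :: nat and P assume n: "1 \<le> n"
    from b[OF n, of P] obtain G where G: "G \<in> borel_measurable borel" "\<And>t. 0 \<le> G t"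
      "\<And>t z. norm (z - cis t) \<le> 1 / (2 * real n) \<Longrightarrow> norm (poly (vpop p n P) z) \<le> G t"
      "(\<integral>\<^sup>+t. ennreal (G t powr p) \<partial>circ) \<le> ennreal C * Jnorm p (poly P)" by blast
    have "Jnorm p (poly (vpop p n P)) \<le> ennreal (1 powr p) * (\<integral>\<^sup>+t. ennreal (G t powr p) \<partial>circ)"
      by (rule Jnorm_le_majorant) (use G p in auto)
    thus "Jnorm p (poly (vpop p n P)) \<le> ennreal C * Jnorm p (poly P)" using G(4) by simp
  qed
qed

text \<open>The operator fixes polynomials of degree at most n. Halving the radius leaves room for
  Cauchy's inequality on circles of radius 1/(4n), hence the factor 4n for the derivative under the
  same majorant.\<close>

lemma poly_local_maximal:
  assumes p: "0 < p"
  shows "\<exists>C>0. \<forall>n\<ge>1. \<forall>P. degree P \<le> n \<longrightarrow> (\<exists>G\<in>borel_measurable borel. (\<forall>t. 0 \<le> G t) \<and>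
     (\<forall>t z. norm (z - cis t) \<le> 1 / (4 * real n) \<longrightarrow>
        norm (poly P z) \<le> G t \<and> norm (poly (pderiv P) z) \<le> 4 * real n * G t) \<and>
     (\<integral>\<^sup>+t. ennreal (G t powr p) \<partial>circ) \<le> ennreal C * Jnorm p (poly P))"
proof -
  from vpop_local_maximal[OF p] obtain C where C: "C > 0" and
    b: "\<And>n P. 1 \<le> n \<Longrightarrow> \<exists>G\<in>borel_measurable borel. (\<forall>t. 0 \<le> G t) \<and>
     (\<forall>t z. norm (z - cis t) \<le> 1 / (2 * real n) \<longrightarrow> norm (poly (vpop p n P) z) \<le> G t) \<and>
     (\<integral>\<^sup>+t. ennreal (G t powr p) \<partial>circ) \<le> ennreal C * Jnorm p (poly P)" by blast
  show ?thesis
  proof (intro exI[of _ C] conjI C allI impI)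
    fix n :: nat and P :: "complex poly" assume n: "1 \<le> n" and deg: "degree P \<le> n"
    from b[OF n, of P] obtain G where G: "G \<in> borel_measurable borel" "\<And>t. 0 \<le> G t"
      "\<And>t z. norm (z - cis t) \<le> 1 / (2 * real n) \<Longrightarrow> norm (poly P z) \<le> G t"
      "(\<integral>\<^sup>+t. ennreal (G t powr p) \<partial>circ) \<le> ennreal C * Jnorm p (poly P)"
      unfolding vpop_id[OF n deg] by blast
    show "\<exists>G\<in>borel_measurable borel. (\<forall>t. 0 \<le> G t) \<and>
     (\<forall>t z. norm (z - cis t) \<le> 1 / (4 * real n) \<longrightarrow>
        norm (poly P z) \<le> G t \<and> norm (poly (pderiv P) z) \<le> 4 * real n * G t) \<and>
     (\<integral>\<^sup>+t. ennreal (G t powr p) \<partial>circ) \<le> ennreal C * Jnorm p (poly P)"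
    proof (intro bexI[of _ G] conjI allI impI)
      fix t z assume z: "norm (z - cis t) \<le> 1 / (4 * real n)"
      have half: "1 / (4 * real n) + 1 / (4 * real n) = 1 / (2 * real n)" by simp
      have q: "0 < 1 / (4 * real n)" using n by simp
      show "norm (poly P z) \<le> G t"
        using z half q by (intro G(3)) linarith
      have "norm ((deriv ^^ 1) (poly P) z) \<le> fact 1 * G t / (1 / (4 * real n)) ^ 1"
      proof (rule Cauchy_inequality)
        fix x assume "norm (z - x) = 1 / (4 * real n)"
        hence "norm (x - cis t) \<le> 1 / (2 * real n)"
          using norm_triangle_ineq[of "x - z" "z - cis t"] z half by (simp add: norm_minus_commute)
        thus "norm (poly P x) \<le> G t" by (rule G(3))
      qed (use q in \<open>auto intro!: continuous_intros holomorphic_intros\<close>)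
      thus "norm (poly (pderiv P) z) \<le> 4 * real n * G t"
        by (simp add: DERIV_imp_deriv[OF poly_DERIV] mult.commute)
    qed (use G in auto)
  qed
qed

text \<open>The local bound at its centre, with the kernel replaced by its peak value n: passing
  from the integral to the supremum costs one factor n in the p-th power.\<close>

lemma nikolskii:
  assumes p: "0 < p"
  shows "\<exists>C>0. \<forall>n\<ge>1. \<forall>P z. degree P \<le> n \<longrightarrow> norm z = 1 \<longrightarrow>
     ennreal (norm (poly P z) powr p) \<le> ennreal (C * real n) * Jnorm p (poly P)"
proof -
  from vp_local_bound[OF p vpN] obtain C where C: "C > 0"
    and b: "\<And>n P z0 z. 1 \<le> n \<Longrightarrow> norm z0 = 1 \<Longrightarrow> norm (z - z0) \<le> 1 / (2 * real n) \<Longrightarrow>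
    ennreal (norm (poly (pmul (vp (vpN p) n) P) z) powr p) \<le>
    ennreal C * (\<integral>\<^sup>+t. ennreal (kern (1 / real n) z0 (cis t) * norm (poly P (cis t)) powr p) \<partial>circ)"
    by blast
  show ?thesis
  proof (intro exI[of _ C] conjI C allI impI)
    fix n :: nat and P :: "complex poly" and z :: complex
    assume n: "1 \<le> n" and deg: "degree P \<le> n" and z: "norm z = 1"
    have "ennreal (norm (poly P z) powr p) \<le>
      ennreal C * (\<integral>\<^sup>+t. ennreal (kern (1 / real n) z (cis t) * norm (poly P (cis t)) powr p) \<partial>circ)"
      using b[OF n z, of z P] vpop_id[OF n deg, of p] by (simp add: vpop_def)
    also have "\<dots> \<le> ennreal C * (\<integral>\<^sup>+t. ennreal (real n) * ennreal (norm (poly P (cis t)) powr p) \<partial>circ)"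
    proof (intro mult_left_mono nn_integral_mono)
      fix t
      have "kern (1 / real n) z (cis t) \<le> real n" using kern_le[of "1 / real n" z "cis t"] n by simp
      thus "ennreal (kern (1 / real n) z (cis t) * norm (poly P (cis t)) powr p) \<le> ennreal (real n) * ennreal (norm (poly P (cis t)) powr p)"
        by (subst ennreal_mult'[symmetric]) (auto intro!: ennreal_leI mult_right_mono)
    qed auto
    also have "\<dots> = ennreal C * (ennreal (real n) * Jnorm p (poly P))"
      unfolding Jnorm_def by (subst nn_integral_cmult) auto
    also have "\<dots> = ennreal (C * real n) * Jnorm p (poly P)" using C by (simp add: ennreal_mult mult.assoc)
    finally show "ennreal (norm (poly P z) powr p) \<le> ennreal (C * real n) * Jnorm p (poly P)" .
  qed
qed

subsection \<open>Bernstein inequalities and dyadic blocks\<close>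

text \<open>The Euler operator z d/dz. Unlike the plain derivative it is a coefficient multiplier,
  by k, and on the circle it is -i d/dt.\<close>

definition Dpoly :: "complex poly \<Rightarrow> complex poly" where
  "Dpoly P = pCons 0 (pderiv P)"

lemma poly_Dpoly: "poly (Dpoly P) z = z * poly (pderiv P) z"
  by (simp add: Dpoly_def)

lemma coeff_Dpoly: "coeff (Dpoly P) k = of_nat k * coeff P k"
  unfolding Dpoly_def by (cases k) (auto simp: coeff_pderiv)

lemma degree_Dpoly_le: "degree (Dpoly P) \<le> degree P"
  by (rule degree_le) (auto simp: coeff_Dpoly coeff_eq_0)

definition shift_diff :: "real \<Rightarrow> complex poly \<Rightarrow> complex poly" where
  "shift_diff h = pmul (\<lambda>k. cis (real k * h) - 1)"

lemma poly_shift_diff: "poly (shift_diff h P) z = poly P (cis h * z) - poly P z"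
  by (simp only: shift_diff_def poly_pmul[OF order_refl])
     (simp add: poly_altdef[of P] sum_subtractf[symmetric] algebra_simps power_mult_distrib Complex.DeMoivre)

lemma degree_shift_diff_le: "degree (shift_diff h P) \<le> degree P"
  unfolding shift_diff_def by (rule degree_pmul_le)

lemma norm_cis_minus_one_le: "norm (cis s - 1) \<le> \<bar>s\<bar>"
proof -
  have "norm (cis s - 1) = norm (exp (\<i> * of_real s) - 1)" by (simp add: cis_conv_exp)
  also have "\<dots> = 2 * \<bar>sin (s / 2)\<bar>" using dist_exp_i_1[of s] by simp
  also have "\<dots> \<le> 2 * \<bar>s / 2\<bar>" by (intro mult_left_mono abs_sin_x_le_abs_x) auto
  finally show ?thesis by simp
qed

lemma bernstein:
  assumes p: "0 < p"
  shows "\<exists>C>0. \<forall>n\<ge>1. \<forall>P. degree P \<le> n \<longrightarrow>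
    Jnorm p (poly (Dpoly P)) \<le> ennreal ((C * real n) powr p) * Jnorm p (poly P)"
proof -
  from poly_local_maximal[OF p] obtain C where C: "C > 0" and
    b: "\<And>n P. 1 \<le> n \<Longrightarrow> degree P \<le> n \<Longrightarrow> (\<exists>G\<in>borel_measurable borel. (\<forall>t. 0 \<le> G t) \<and>
     (\<forall>t z. norm (z - cis t) \<le> 1 / (4 * real n) \<longrightarrow>
        norm (poly P z) \<le> G t \<and> norm (poly (pderiv P) z) \<le> 4 * real n * G t) \<and>
     (\<integral>\<^sup>+t. ennreal (G t powr p) \<partial>circ) \<le> ennreal C * Jnorm p (poly P))" by blast
  show ?thesis
  proof (intro exI[of _ "4 * C powr (1 / p)"] conjI allI impI)
    fix n :: nat and P :: "complex poly" assume n: "1 \<le> n" and deg: "degree P \<le> n"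
    from b[OF this] obtain G where G: "G \<in> borel_measurable borel" "\<And>t. 0 \<le> G t"
      "\<And>t z. norm (z - cis t) \<le> 1 / (4 * real n) \<Longrightarrow> norm (poly (pderiv P) z) \<le> 4 * real n * G t"
      "(\<integral>\<^sup>+t. ennreal (G t powr p) \<partial>circ) \<le> ennreal C * Jnorm p (poly P)" by blast
    have "Jnorm p (poly (Dpoly P)) \<le> ennreal ((4 * real n) powr p) * (\<integral>\<^sup>+t. ennreal (G t powr p) \<partial>circ)"
      by (rule Jnorm_le_majorant) (use G p in \<open>auto simp: poly_Dpoly norm_mult\<close>)
    also have "\<dots> \<le> ennreal ((4 * real n) powr p) * (ennreal C * Jnorm p (poly P))"
      by (intro mult_left_mono G) auto
    also have "\<dots> = ennreal ((4 * real n) powr p * C) * Jnorm p (poly P)"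
      using C by (simp add: ennreal_mult mult.assoc)
    also have "(4 * real n) powr p * C = (4 * C powr (1 / p) * real n) powr p"
      using C p by (simp add: powr_mult powr_powr)
    finally show "Jnorm p (poly (Dpoly P)) \<le> ennreal ((4 * C powr (1 / p) * real n) powr p) * Jnorm p (poly P)" .
  qed (use C in auto)
qed

lemma poly_cis_has_vector_derivative:
  "((\<lambda>s. poly P (cis s * z)) has_vector_derivative \<i> * poly (Dpoly P) (cis s * z)) (at s within S)"
proof -
  have "((\<lambda>s. cis s * z) has_vector_derivative (\<i> * cis s) * z) (at s within S)"
    unfolding cis_conv_exp
    by (auto intro!: derivative_eq_intros has_vector_derivative_real_field)
  moreover have "(poly P has_field_derivative poly (pderiv P) (cis s * z)) (at (cis s * z))"
    by (rule poly_DERIV)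
  ultimately have "((poly P \<circ> (\<lambda>s. cis s * z)) has_vector_derivative (\<i> * cis s * z) * poly (pderiv P) (cis s * z)) (at s within S)"
    by (rule field_vector_diff_chain_within[OF _ DERIV_subset]) auto
  thus ?thesis by (simp add: o_def poly_Dpoly mult_ac)
qed

lemma poly_exp_has_vector_derivative:
  "((\<lambda>s. poly P (of_real (exp (- s)) * z)) has_vector_derivative - poly (Dpoly P) (of_real (exp (- s)) * z)) (at s within S)"
proof -
  have "((\<lambda>s. of_real (exp (- s)) * z) has_vector_derivative (- of_real (exp (- s))) * z) (at s within S)"
    unfolding exp_of_real of_real_minus
    by (auto intro!: derivative_eq_intros has_vector_derivative_real_field simp: exp_of_real[symmetric])
  moreover have "(poly P has_field_derivative poly (pderiv P) (of_real (exp (- s)) * z)) (at (of_real (exp (- s)) * z))"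
    by (rule poly_DERIV)
  ultimately have "((poly P \<circ> (\<lambda>s. of_real (exp (- s)) * z)) has_vector_derivative (- of_real (exp (- s)) * z) * poly (pderiv P) (of_real (exp (- s)) * z)) (at s within S)"
    by (rule field_vector_diff_chain_within[OF _ DERIV_subset]) auto
  thus ?thesis by (simp add: o_def poly_Dpoly mult_ac)
qed

lemma vector_mean_value:
  fixes f :: "real \<Rightarrow> complex"
  assumes ab: "a \<le> b" and d: "\<And>x. (f has_vector_derivative f' x) (at x within {a..b})"
    and B: "\<And>x. a \<le> x \<Longrightarrow> x \<le> b \<Longrightarrow> norm (f' x) \<le> B"
  shows "norm (f b - f a) \<le> B * (b - a)"
proof -
  have "norm (f b - f a) \<le> B * norm (b - a)"
  proof (rule differentiable_bound[where S = "{a..b}" and f' = "\<lambda>x y. y *\<^sub>R f' x"])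
    show "onorm (\<lambda>y. y *\<^sub>R f' x) \<le> B" if "x \<in> {a..b}" for x
      by (rule onorm_le) (use B[of x] that in \<open>auto simp: mult.commute[of B] intro!: mult_left_mono\<close>)
  qed (use ab d in \<open>auto simp: has_vector_derivative_def\<close>)
  thus ?thesis using ab by simp
qed

text \<open>By Taylor's formula the difference is i h \<open>Dpoly P\<close> up to 4 n h^2 G, with G
  the local maximal function of \<open>Dpoly P\<close> at scale 1/n. Once h n is small the error is
  at most half of the main term and is absorbed.\<close>

lemma shift_diff_lower:
  assumes p: "0 < p"
  shows "\<exists>c>0. \<exists>C>0. \<forall>n\<ge>1. \<forall>P h. degree P \<le> n \<longrightarrow> 0 < h \<longrightarrow> h * real n \<le> c \<longrightarrow>
    ennreal (h powr p) * Jnorm p (poly (Dpoly P)) \<le> ennreal C * Jnorm p (poly (shift_diff h P))"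
proof -
  from poly_local_maximal[OF p] obtain C where C: "C > 0" and
    b: "\<And>n P. 1 \<le> n \<Longrightarrow> degree P \<le> n \<Longrightarrow> (\<exists>G\<in>borel_measurable borel. (\<forall>t. 0 \<le> G t) \<and>
     (\<forall>t z. norm (z - cis t) \<le> 1 / (4 * real n) \<longrightarrow>
        norm (poly P z) \<le> G t \<and> norm (poly (pderiv P) z) \<le> 4 * real n * G t) \<and>
     (\<integral>\<^sup>+t. ennreal (G t powr p) \<partial>circ) \<le> ennreal C * Jnorm p (poly P))" by blast
  \<comment> \<open>\<open>2 powr p\<close> is the quasi-triangle factor, \<open>4 powr p\<close>
    comes from 4 n h^2, C from the maximal function, and the last 2 turns the error into one half.
    The bound c \<le> 1/4 below keeps the arc of length h inside the disc of radius 1/(4n).\<close>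
  define K where "K = 2 powr p * 4 powr p * C * 2"
  have K: "K > 0" using C by (simp add: K_def)
  define c where "c = min (1 / 4) ((1 / K) powr (1 / p))"
  have c: "0 < c" "c \<le> 1 / 4" using K by (auto simp: c_def)
  have cK: "c powr p * K \<le> 1"
  proof -
    have "c powr p \<le> ((1 / K) powr (1 / p)) powr p" using c p by (intro powr_mono2) (auto simp: c_def)
    also have "\<dots> = 1 / K" using p K by (simp add: powr_powr)
    finally show ?thesis using K by (simp add: field_simps)
  qed
  show ?thesis
  proof (rule exI[of _ c], intro conjI c, rule exI[of _ "2 * 2 powr p"], intro conjI allI impI)
    fix n :: nat and P :: "complex poly" and h :: real
    assume n: "1 \<le> n" and deg: "degree P \<le> n" and h: "0 < h" and hn: "h * real n \<le> c"
    from b[OF n order_trans[OF degree_Dpoly_le deg]] obtain G where G: "G \<in> borel_measurable borel" "\<And>t. 0 \<le> G t"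
      "\<And>t z. norm (z - cis t) \<le> 1 / (4 * real n) \<Longrightarrow> norm (poly (pderiv (Dpoly P)) z) \<le> 4 * real n * G t"
      "(\<integral>\<^sup>+t. ennreal (G t powr p) \<partial>circ) \<le> ennreal C * Jnorm p (poly (Dpoly P))" by blast
    have [measurable]: "G \<in> borel_measurable borel" by fact
    have h4: "h \<le> 1 / (4 * real n)" using hn c(2) n by (simp add: field_simps)
    have key: "h * norm (poly (Dpoly P) (cis t)) \<le> norm (poly (shift_diff h P) (cis t)) + 4 * real n * h\<^sup>2 * G t" for t
    proof -
      have near: "norm (cis s * cis t - cis t) \<le> s" if "0 \<le> s" for s
      proof -
        have "cis s * cis t - cis t = (cis s - 1) * cis t" by (simp add: algebra_simps)
        thus ?thesis using norm_cis_minus_one_le[of s] that by (simp only: norm_mult norm_cis)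
      qed
      have D: "norm (poly (Dpoly P) (cis s * cis t) - poly (Dpoly P) (cis t)) \<le> 4 * real n * h * G t"
        if s: "0 \<le> s" "s \<le> h" for s
      proof -
        have "norm (poly (Dpoly P) (cis s * cis t) - poly (Dpoly P) (cis 0 * cis t)) \<le> 4 * real n * G t * (s - 0)"
        proof (rule vector_mean_value[OF s(1) poly_cis_has_vector_derivative])
          fix x assume x: "0 \<le> x" "x \<le> s"
          have "norm (cis x * cis t - cis t) \<le> 1 / (4 * real n)" using near[OF x(1)] x s h4 by linarith
          from G(3)[OF this] show "norm (\<i> * poly (Dpoly (Dpoly P)) (cis x * cis t)) \<le> 4 * real n * G t"
            by (simp add: poly_Dpoly[of "Dpoly P"] norm_mult)
        qed
        also have "\<dots> \<le> 4 * real n * G t * h" using s G(2) by (intro mult_left_mono) auto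
        finally show ?thesis by (simp add: mult_ac)
      qed
      define w where "w = (\<lambda>s. poly P (cis s * cis t) - of_real s * (\<i> * poly (Dpoly P) (cis t)))"
      have "norm (w h - w 0) \<le> 4 * real n * h * G t * (h - 0)"
      proof (rule vector_mean_value)
        fix x show "(w has_vector_derivative (\<i> * poly (Dpoly P) (cis x * cis t) - \<i> * poly (Dpoly P) (cis t))) (at x within {0..h})"
          unfolding w_def
          by (auto intro!: derivative_eq_intros poly_cis_has_vector_derivative simp: has_vector_derivative_of_real)
      next
        fix x assume x: "0 \<le> x" "x \<le> h"
        have "norm (\<i> * poly (Dpoly P) (cis x * cis t) - \<i> * poly (Dpoly P) (cis t)) =
           norm (\<i> * (poly (Dpoly P) (cis x * cis t) - poly (Dpoly P) (cis t)))" by (simp add: algebra_simps)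
        also have "\<dots> \<le> 4 * real n * h * G t" using D[OF x] by (simp add: norm_mult)
        finally show "norm (\<i> * poly (Dpoly P) (cis x * cis t) - \<i> * poly (Dpoly P) (cis t)) \<le> 4 * real n * h * G t" .
      qed (use h in auto)
      also have "w h - w 0 = poly (shift_diff h P) (cis t) - of_real h * (\<i> * poly (Dpoly P) (cis t))"
        by (simp add: w_def poly_shift_diff)
      finally have 1: "norm (poly (shift_diff h P) (cis t) - of_real h * (\<i> * poly (Dpoly P) (cis t))) \<le> 4 * real n * h\<^sup>2 * G t"
        by (simp add: power2_eq_square mult_ac)
      have "h * norm (poly (Dpoly P) (cis t)) = norm (of_real h * (\<i> * poly (Dpoly P) (cis t)))"
        using h by (simp add: norm_mult)
      also have "\<dots> \<le> norm (poly (shift_diff h P) (cis t)) + 4 * real n * h\<^sup>2 * G t"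
        using 1 norm_triangle_ineq2[of "of_real h * (\<i> * poly (Dpoly P) (cis t))" "poly (shift_diff h P) (cis t)"]
        by (simp add: norm_minus_commute)
      finally show ?thesis .
    qed
    define X where "X = ennreal (h powr p) * Jnorm p (poly (Dpoly P))"
    have Xf: "X < top" unfolding X_def using Jnorm_poly_finite[OF p] by (simp add: ennreal_mult_less_top)
    have "X = (\<integral>\<^sup>+t. ennreal ((h * norm (poly (Dpoly P) (cis t))) powr p) \<partial>circ)"
      unfolding X_def Jnorm_def
      by (subst nn_integral_cmult[symmetric]) (use h in \<open>auto simp: powr_mult ennreal_mult''\<close>)
    also have "\<dots> \<le> (\<integral>\<^sup>+t. ennreal ((norm (poly (shift_diff h P) (cis t)) + 4 * real n * h\<^sup>2 * G t) powr p) \<partial>circ)"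
      using key h p by (intro nn_integral_mono ennreal_leI powr_mono2) auto
    also have "\<dots> \<le> ennreal (2 powr p) * ((\<integral>\<^sup>+t. ennreal (norm (poly (shift_diff h P) (cis t)) powr p) \<partial>circ)
        + (\<integral>\<^sup>+t. ennreal ((4 * real n * h\<^sup>2 * G t) powr p) \<partial>circ))"
      by (rule nn_integral_powr_add_le) (use G(2) p in auto)
    also have "(\<integral>\<^sup>+t. ennreal (norm (poly (shift_diff h P) (cis t)) powr p) \<partial>circ) = Jnorm p (poly (shift_diff h P))"
      by (simp add: Jnorm_def)
    also have "(\<integral>\<^sup>+t. ennreal ((4 * real n * h\<^sup>2 * G t) powr p) \<partial>circ) =
        ennreal ((4 * real n * h\<^sup>2) powr p) * (\<integral>\<^sup>+t. ennreal (G t powr p) \<partial>circ)"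
      by (subst nn_integral_cmult[symmetric]) (use G(2) in \<open>auto simp: powr_mult ennreal_mult''\<close>)
    also have "\<dots> \<le> ennreal ((4 * real n * h\<^sup>2) powr p) * (ennreal C * Jnorm p (poly (Dpoly P)))"
      by (intro mult_left_mono G) auto
    also have "\<dots> \<le> ennreal (1 / (2 * 2 powr p)) * X"
    proof -
      have "(4 * real n * h\<^sup>2) powr p * C = (4 powr p * C) * (h * real n) powr p * h powr p"
        using h by (simp add: powr_mult power2_eq_square mult_ac)
      also have "\<dots> \<le> (4 powr p * C) * c powr p * h powr p"
        using hn h p C by (intro mult_left_mono mult_right_mono powr_mono2) auto
      also have "\<dots> = (c powr p * K) * (h powr p / (2 * 2 powr p))" by (simp add: K_def field_simps)
      also have "\<dots> \<le> 1 * (h powr p / (2 * 2 powr p))" by (intro mult_right_mono cK) auto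
      finally have "(4 * real n * h\<^sup>2) powr p * C \<le> 1 / (2 * 2 powr p) * h powr p" by simp
      hence "ennreal ((4 * real n * h\<^sup>2) powr p * C) \<le> ennreal (1 / (2 * 2 powr p) * h powr p)" by (rule ennreal_leI)
      hence "ennreal ((4 * real n * h\<^sup>2) powr p * C) * Jnorm p (poly (Dpoly P)) \<le>
         ennreal (1 / (2 * 2 powr p) * h powr p) * Jnorm p (poly (Dpoly P))" by (rule mult_right_mono) auto
      thus ?thesis unfolding X_def using C by (simp only: ennreal_mult'' ennreal_mult' powr_ge_zero less_imp_le mult.assoc)
    qed
    finally have "X \<le> ennreal (2 powr p) * (Jnorm p (poly (shift_diff h P)) + ennreal (1 / (2 * 2 powr p)) * X)"
      by (simp add: mult_left_mono add_mono)
    also have "\<dots> = ennreal (2 powr p) * Jnorm p (poly (shift_diff h P)) + ennreal (1 / 2) * X"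
    proof -
      have "ennreal (2 powr p) * ennreal (1 / (2 * 2 powr p)) = ennreal (1 / 2)"
        by (subst ennreal_mult[symmetric]) auto
      thus ?thesis by (simp add: distrib_left mult.assoc[symmetric])
    qed
    finally have "X \<le> 2 * (ennreal (2 powr p) * Jnorm p (poly (shift_diff h P)))" using Xf by (rule ennreal_absorb_half)
    thus "ennreal (h powr p) * Jnorm p (poly (Dpoly P)) \<le> ennreal (2 * 2 powr p) * Jnorm p (poly (shift_diff h P))"
      unfolding X_def using ennreal_mult[of 2 "2 powr p"] by (simp add: mult.assoc)
  qed (use c in auto)
qed

text \<open>Write P = z^m U, so that |U| = |P| on the circle. At radius exp(-a/m) the factor z^m has
  modulus exp(-a), against the radial maximal function of U; returning to the circle costs a/m times
  the maximal function of \<open>Dpoly P\<close>. For large a the first part is absorbed.\<close>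

lemma reverse_bernstein:
  assumes p: "0 < p"
  shows "\<exists>C>0. \<forall>m\<ge>1. \<forall>P. (\<forall>k<m. coeff P k = 0) \<longrightarrow>
    ennreal (real m powr p) * Jnorm p (poly P) \<le> ennreal C * Jnorm p (poly (Dpoly P))"
proof -
  define L where "L = (144\<^sup>2 :: real)"
  have L: "L > 0" by (simp add: L_def)
  \<comment> \<open>The solution of 2^p exp(-a p) L = 1/2, where L is the constant of the radial
    maximal theorem.\<close>
  define a where "a = ln (2 * 2 powr p * L) / p"
  have "2 * 2 powr p * L > 1"
  proof -
    have "(1::real) \<le> 2 powr p" using p by (simp add: ge_one_powr_ge_zero)
    thus ?thesis by (simp add: L_def)
  qed
  hence a: "a > 0" unfolding a_def using p by (intro divide_pos_pos ln_gt_zero) auto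
  have ea: "exp (- a) powr p = 1 / (2 * 2 powr p * L)"
  proof -
    have "exp (- a) powr p = exp (- ln (2 * 2 powr p * L))" using p by (simp add: powr_def a_def)
    thus ?thesis using L by (simp add: exp_minus inverse_eq_divide)
  qed
  define C where "C = 2 * 2 powr p * a powr p * L"
  have C: "C > 0" using a L by (simp add: C_def)
  show ?thesis
  proof (intro exI[of _ C] conjI C allI impI)
    fix m :: nat and P :: "complex poly"
    assume m: "1 \<le> m" and low: "\<forall>k<m. coeff P k = 0"
    define U where "U = poly_shift m P"
    have PU: "P = monom 1 m * U"
      by (rule poly_eqI) (use low in \<open>auto simp: coeff_monom_mult U_def coeff_poly_shift\<close>)
    have Pz: "poly P z = z ^ m * poly U z" for z by (simp add: PU poly_monom)
    have JU: "Jnorm p (poly U) = Jnorm p (poly P)"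
      by (rule Jnorm_cong) (simp add: Pz norm_mult norm_power)
    define r where "r = exp (- (a / real m))"
    have r: "0 \<le> r" "r \<le> 1" using a m by (auto simp: r_def)
    have rm: "r ^ m = exp (- a)" using m by (simp add: r_def exp_of_nat_mult[symmetric])
    from radial_maximal[OF p, of U] obtain G where G: "G \<in> borel_measurable borel" "\<And>t. 0 \<le> G t"
      "\<And>t r. 0 \<le> r \<Longrightarrow> r \<le> 1 \<Longrightarrow> norm (poly U (of_real r * cis t)) \<le> G t"
      "(\<integral>\<^sup>+t. ennreal (G t powr p) \<partial>circ) \<le> ennreal L * Jnorm p (poly P)"
      unfolding L_def JU by blast
    from radial_maximal[OF p, of "Dpoly P"] obtain H where H: "H \<in> borel_measurable borel" "\<And>t. 0 \<le> H t"
      "\<And>t r. 0 \<le> r \<Longrightarrow> r \<le> 1 \<Longrightarrow> norm (poly (Dpoly P) (of_real r * cis t)) \<le> H t"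
      "(\<integral>\<^sup>+t. ennreal (H t powr p) \<partial>circ) \<le> ennreal L * Jnorm p (poly (Dpoly P))"
      unfolding L_def by blast
    have [measurable]: "G \<in> borel_measurable borel" "H \<in> borel_measurable borel" by fact+
    have key: "norm (poly P (cis t)) \<le> a / real m * H t + exp (- a) * G t" for t
    proof -
      have "norm (poly P (of_real (exp (- (a / real m))) * cis t) - poly P (of_real (exp (- 0)) * cis t)) \<le> H t * (a / real m - 0)"
        by (rule vector_mean_value[OF _ poly_exp_has_vector_derivative]) (use a H(3) in auto)
      moreover have "norm (poly P (of_real r * cis t)) \<le> exp (- a) * G t"
        unfolding Pz rm[symmetric] using G(3)[OF r, of t] r
        by (simp add: norm_mult norm_power power_mult_distrib mult_left_mono)
      ultimately show ?thesis
        using norm_triangle_ineq2[of "poly P (cis t)" "poly P (of_real r * cis t)"]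
        by (simp add: norm_minus_commute r_def mult.commute)
    qed
    define X where "X = Jnorm p (poly P)"
    have Xf: "X < top" unfolding X_def using Jnorm_poly_finite[OF p] by simp
    have "X \<le> (\<integral>\<^sup>+t. ennreal ((a / real m * H t + exp (- a) * G t) powr p) \<partial>circ)"
      unfolding X_def Jnorm_def using key p by (intro nn_integral_mono ennreal_leI powr_mono2) auto
    also have "\<dots> \<le> ennreal (2 powr p) * ((\<integral>\<^sup>+t. ennreal ((a / real m * H t) powr p) \<partial>circ)
        + (\<integral>\<^sup>+t. ennreal ((exp (- a) * G t) powr p) \<partial>circ))"
      by (rule nn_integral_powr_add_le) (use G(2) H(2) p a in auto)
    also have "(\<integral>\<^sup>+t. ennreal ((a / real m * H t) powr p) \<partial>circ) =
        ennreal ((a / real m) powr p) * (\<integral>\<^sup>+t. ennreal (H t powr p) \<partial>circ)"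
      by (subst nn_integral_cmult[symmetric]) (use H(2) a in \<open>auto simp: powr_mult[symmetric] ennreal_mult''[symmetric]\<close>)
    also have "(\<integral>\<^sup>+t. ennreal ((exp (- a) * G t) powr p) \<partial>circ) =
        ennreal (exp (- a) powr p) * (\<integral>\<^sup>+t. ennreal (G t powr p) \<partial>circ)"
      by (subst nn_integral_cmult[symmetric]) (use G(2) in \<open>auto simp: powr_mult[symmetric] ennreal_mult''[symmetric]\<close>)
    also have "ennreal (2 powr p) * (ennreal ((a / real m) powr p) * (\<integral>\<^sup>+t. ennreal (H t powr p) \<partial>circ) +
        ennreal (exp (- a) powr p) * (\<integral>\<^sup>+t. ennreal (G t powr p) \<partial>circ)) \<le>
      ennreal (2 powr p) * (ennreal ((a / real m) powr p) * (ennreal L * Jnorm p (poly (Dpoly P))) +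
        ennreal (exp (- a) powr p) * (ennreal L * X))"
      unfolding X_def by (intro mult_left_mono add_mono G H) auto
    also have "\<dots> = ennreal (2 powr p * (a / real m) powr p * L) * Jnorm p (poly (Dpoly P)) + ennreal (1 / 2) * X"
    proof -
      have "2 powr p * exp (- a) powr p * L = 1 / 2" using L by (simp add: ea)
      hence "ennreal (2 powr p) * (ennreal (exp (- a) powr p) * ennreal L) = ennreal (1 / 2)"
        using L by (simp only: ennreal_mult''[symmetric] powr_ge_zero less_imp_le mult_nonneg_nonneg mult.assoc)
      moreover have "ennreal (2 powr p) * (ennreal ((a / real m) powr p) * ennreal L) = ennreal (2 powr p * (a / real m) powr p * L)"
        using L by (simp only: ennreal_mult''[symmetric] powr_ge_zero less_imp_le mult_nonneg_nonneg mult.assoc)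
      ultimately show ?thesis by (simp only: distrib_left mult.assoc[symmetric])
    qed
    finally have "X \<le> 2 * (ennreal (2 powr p * (a / real m) powr p * L) * Jnorm p (poly (Dpoly P)))"
      using Xf by (rule ennreal_absorb_half)
    hence "ennreal (real m powr p) * X \<le> ennreal (real m powr p) * (2 * (ennreal (2 powr p * (a / real m) powr p * L) * Jnorm p (poly (Dpoly P))))"
      by (rule mult_left_mono) auto
    also have "\<dots> = ennreal C * Jnorm p (poly (Dpoly P))"
    proof -
      have "real m powr p * (2 * (2 powr p * (a / real m) powr p * L)) = C"
        using m a by (simp add: C_def powr_divide)
      hence "ennreal (real m powr p) * (ennreal 2 * ennreal (2 powr p * (a / real m) powr p * L)) = ennreal C"
        using L by (simp only: ennreal_mult''[symmetric] powr_ge_zero less_imp_le mult_nonneg_nonneg zero_le_numeral)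
      thus ?thesis by (simp add: mult.assoc[symmetric])
    qed
    finally show "ennreal (real m powr p) * Jnorm p (poly P) \<le> ennreal C * Jnorm p (poly (Dpoly P))"
      unfolding X_def .
  qed
qed

lemma block_shift_diff:
  assumes p: "0 < p"
  shows "\<exists>c>0. \<exists>C>0. \<forall>m\<ge>1. \<forall>n\<ge>1. \<forall>P h. degree P \<le> n \<longrightarrow> (\<forall>k<m. coeff P k = 0) \<longrightarrow> 0 < h \<longrightarrow> h * real n \<le> c \<longrightarrow>
    ennreal ((h * real m) powr p) * Jnorm p (poly P) \<le> ennreal C * Jnorm p (poly (shift_diff h P))"
proof -
  from shift_diff_lower[OF p] obtain c C1 where c: "c > 0" and C1: "C1 > 0" and
    1: "\<And>n P h. 1 \<le> n \<Longrightarrow> degree P \<le> n \<Longrightarrow> 0 < h \<Longrightarrow> h * real n \<le> c \<Longrightarrow>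
    ennreal (h powr p) * Jnorm p (poly (Dpoly P)) \<le> ennreal C1 * Jnorm p (poly (shift_diff h P))" by blast
  from reverse_bernstein[OF p] obtain C2 where C2: "C2 > 0" and
    2: "\<And>m P. 1 \<le> m \<Longrightarrow> (\<forall>k<m. coeff P k = 0) \<Longrightarrow>
    ennreal (real m powr p) * Jnorm p (poly P) \<le> ennreal C2 * Jnorm p (poly (Dpoly P))" by blast
  show ?thesis
  proof (rule exI[of _ c], intro conjI c, rule exI[of _ "C2 * C1"], intro conjI allI impI)
    fix m n :: nat and P :: "complex poly" and h :: real
    assume a: "1 \<le> m" "1 \<le> n" "degree P \<le> n" "\<forall>k<m. coeff P k = 0" "0 < h" "h * real n \<le> c"
    have "ennreal ((h * real m) powr p) * Jnorm p (poly P) = ennreal (h powr p) * (ennreal (real m powr p) * Jnorm p (poly P))"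
      by (simp only: powr_mult ennreal_mult'[OF powr_ge_zero] mult.assoc)
    also have "\<dots> \<le> ennreal (h powr p) * (ennreal C2 * Jnorm p (poly (Dpoly P)))"
      by (intro mult_left_mono 2 a) auto
    also have "\<dots> = ennreal C2 * (ennreal (h powr p) * Jnorm p (poly (Dpoly P)))" by (simp only: mult_ac)
    also have "\<dots> \<le> ennreal C2 * (ennreal C1 * Jnorm p (poly (shift_diff h P)))"
      by (intro mult_left_mono 1[OF a(2,3,5,6)]) auto
    also have "\<dots> = ennreal (C2 * C1) * Jnorm p (poly (shift_diff h P))" using C1 C2 by (simp add: ennreal_mult mult.assoc)
    finally show "ennreal ((h * real m) powr p) * Jnorm p (poly P) \<le> ennreal (C2 * C1) * Jnorm p (poly (shift_diff h P))" .
  qed (use c C1 C2 in auto)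
qed

text \<open>A difference keeps both the degree bound and the vanishing low coefficients, so the
  one-step estimate can be iterated with the same threshold c; only C depends on the order
  M.\<close>

lemma block_shift_diff_power:
  assumes p: "0 < p"
  shows "\<exists>c>0. \<forall>M. \<exists>C>0. \<forall>m\<ge>1. \<forall>n\<ge>1. \<forall>P h. degree P \<le> n \<longrightarrow> (\<forall>k<m. coeff P k = 0) \<longrightarrow> 0 < h \<longrightarrow> h * real n \<le> c \<longrightarrow>
    ennreal ((h * real m) powr (p * real M)) * Jnorm p (poly P) \<le> ennreal C * Jnorm p (poly ((shift_diff h ^^ M) P))"
proof -
  obtain c C1 where c: "c > 0" and C1: "C1 > 0" and
    all: "\<forall>m\<ge>1. \<forall>n\<ge>1. \<forall>P h. degree P \<le> n \<longrightarrow> (\<forall>k<m. coeff P k = 0) \<longrightarrow> 0 < h \<longrightarrow> h * real n \<le> c \<longrightarrow>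
    ennreal ((h * real m) powr p) * Jnorm p (poly P) \<le> ennreal C1 * Jnorm p (poly (shift_diff h P))"
    using block_shift_diff[OF p] by (elim exE conjE)
  have 1: "ennreal ((h * real m) powr p) * Jnorm p (poly P) \<le> ennreal C1 * Jnorm p (poly (shift_diff h P))"
    if "1 \<le> m" "1 \<le> n" "degree P \<le> n" "\<forall>k<m. coeff P k = 0" "0 < h" "h * real n \<le> c" for m n P h
    using all that by simp
  show ?thesis
  proof (rule exI[of _ c], intro conjI c allI)
    fix M
    show "\<exists>C>0. \<forall>m\<ge>1. \<forall>n\<ge>1. \<forall>P h. degree P \<le> n \<longrightarrow> (\<forall>k<m. coeff P k = 0) \<longrightarrow> 0 < h \<longrightarrow> h * real n \<le> c \<longrightarrow>
      ennreal ((h * real m) powr (p * real M)) * Jnorm p (poly P) \<le> ennreal C * Jnorm p (poly ((shift_diff h ^^ M) P))"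
    proof (induction M)
      case 0
      show ?case by (intro exI[of _ 1]) auto
    next
      case (Suc M)
      obtain C where C: "C > 0" and
        all: "\<forall>m\<ge>1. \<forall>n\<ge>1. \<forall>P h. degree P \<le> n \<longrightarrow> (\<forall>k<m. coeff P k = 0) \<longrightarrow> 0 < h \<longrightarrow> h * real n \<le> c \<longrightarrow>
      ennreal ((h * real m) powr (p * real M)) * Jnorm p (poly P) \<le> ennreal C * Jnorm p (poly ((shift_diff h ^^ M) P))"
        using Suc by (elim exE conjE)
      have 2: "ennreal ((h * real m) powr (p * real M)) * Jnorm p (poly P) \<le> ennreal C * Jnorm p (poly ((shift_diff h ^^ M) P))"
        if "1 \<le> m" "1 \<le> n" "degree P \<le> n" "\<forall>k<m. coeff P k = 0" "0 < h" "h * real n \<le> c" for m n P h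
        using all that by simp
      show ?case
      proof (intro exI[of _ "C1 * C"] conjI allI impI)
        fix m n :: nat and P :: "complex poly" and h :: real
        assume a: "1 \<le> m" "1 \<le> n" "degree P \<le> n" "\<forall>k<m. coeff P k = 0" "0 < h" "h * real n \<le> c"
        have a': "degree (shift_diff h P) \<le> n" "\<forall>k<m. coeff (shift_diff h P) k = 0"
          using a order_trans[OF degree_shift_diff_le] by (auto simp: shift_diff_def)
        have "ennreal ((h * real m) powr (p * real (Suc M))) * Jnorm p (poly P) =
          ennreal ((h * real m) powr (p * real M)) * (ennreal ((h * real m) powr p) * Jnorm p (poly P))"
        proof -
          have "p * real (Suc M) = p * real M + p" by (simp add: algebra_simps)
          thus ?thesis by (simp only: powr_add ennreal_mult'[OF powr_ge_zero] mult.assoc)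
        qed
        also have "\<dots> \<le> ennreal ((h * real m) powr (p * real M)) * (ennreal C1 * Jnorm p (poly (shift_diff h P)))"
          by (intro mult_left_mono 1[OF a]) auto
        also have "\<dots> = ennreal C1 * (ennreal ((h * real m) powr (p * real M)) * Jnorm p (poly (shift_diff h P)))"
          by (simp only: mult_ac)
        also have "\<dots> \<le> ennreal C1 * (ennreal C * Jnorm p (poly ((shift_diff h ^^ M) (shift_diff h P))))"
          by (intro mult_left_mono 2[OF a(1,2) a' a(5,6)]) auto
        also have "\<dots> = ennreal (C1 * C) * Jnorm p (poly ((shift_diff h ^^ Suc M) P))"
          using C C1 by (simp add: ennreal_mult mult.assoc funpow_swap1)
        finally show "ennreal ((h * real m) powr (p * real (Suc M))) * Jnorm p (poly P) \<le> ennreal (C1 * C) * Jnorm p (poly ((shift_diff h ^^ Suc M) P))" .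
      qed (use C C1 in auto)
    qed
  qed
qed

subsection \<open>Fractional differences of polynomials\<close>

lemma gbinomial_of_real: "(complex_of_real a) gchoose k = of_real (a gchoose k)"
  by (simp add: gbinomial_prod_rev)

text \<open>The coefficients are of order n^(-\<gamma>-1) at most, so their s-th powers are summable
  as soon as s (\<gamma> + 1) > 1, which is the second alternative. For natural \<gamma> only
  finitely many are nonzero.\<close>

lemma summable_gbinomial_powr:
  fixes \<gamma> s :: real
  assumes s: "0 < s" and \<gamma>: "\<gamma> \<in> \<nat> \<or> 1 / s - 1 < \<gamma>"
  shows "summable (\<lambda>n. \<bar>\<gamma> gchoose n\<bar> powr s)"
  using \<gamma>
proof
  assume "\<gamma> \<in> \<nat>"
  then obtain m where "\<gamma> = real m" by (auto elim: Nats_cases)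
  hence "\<bar>\<gamma> gchoose n\<bar> powr s = 0" if "n \<notin> {..m}" for n
    using that by (simp add: binomial_gbinomial[symmetric])
  thus ?thesis by (rule summable_finite[OF finite_atMost])
next
  assume g: "1 / s - 1 < \<gamma>"
  have "convergent (\<lambda>n. (\<gamma> gchoose n) / ((-1)^n / exp ((\<gamma>+1) * of_real (ln (real n)))))"
    using gbinomial_asymptotic[of \<gamma>] by (auto simp: convergent_def)
  from Bseq_def[THEN iffD1, OF convergent_imp_Bseq[OF this]] obtain K where
    K: "K > 0" "\<And>n. norm ((\<gamma> gchoose n) / ((-1)^n / exp ((\<gamma>+1) * of_real (ln (real n))))) \<le> K" by blast
  have "summable (\<lambda>n. K powr s * real n powr (- s * (\<gamma> + 1)))"
  proof (intro summable_mult)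
    have "s * (1 / s) < s * (\<gamma> + 1)" using g s by (intro mult_strict_left_mono) auto
    hence "- s * (\<gamma> + 1) < -1" using s by simp
    thus "summable (\<lambda>n. real n powr (- s * (\<gamma> + 1)))" by (simp add: summable_real_powr_iff)
  qed
  moreover have "norm (\<bar>\<gamma> gchoose n\<bar> powr s) \<le> K powr s * real n powr (- s * (\<gamma> + 1))"
    if n: "1 \<le> n" for n :: nat
  proof -
    have "\<bar>\<gamma> gchoose n\<bar> * exp ((\<gamma>+1) * ln (real n)) \<le> K"
      using K(2)[of n] by (simp add: abs_mult abs_divide power_abs)
    hence "\<bar>\<gamma> gchoose n\<bar> * real n powr (\<gamma> + 1) \<le> K" using n by (simp add: powr_def)
    hence "\<bar>\<gamma> gchoose n\<bar> \<le> K * real n powr (- (\<gamma> + 1))"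
      using n by (simp only: powr_minus_divide) (simp add: pos_le_divide_eq)
    hence "\<bar>\<gamma> gchoose n\<bar> powr s \<le> (K * real n powr (- (\<gamma> + 1))) powr s"
      using s by (intro powr_mono2) auto
    also have "\<dots> = K powr s * real n powr (- s * (\<gamma> + 1))"
      using K(1) by (simp add: powr_mult powr_powr algebra_simps)
    finally show "norm (\<bar>\<gamma> gchoose n\<bar> powr s) \<le> K powr s * real n powr (- s * (\<gamma> + 1))" by simp
  qed
  ultimately show ?thesis by (rule summable_comparison_test'[where N = 1])
qed

lemma summable_gbinomial:
  fixes \<gamma> :: real
  assumes "0 < \<gamma>"
  shows "summable (\<lambda>n. \<bar>\<gamma> gchoose n\<bar>)"
  using summable_gbinomial_powr[of 1 \<gamma>] assms by simp

definition binc :: "real \<Rightarrow> nat \<Rightarrow> complex" where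
  "binc \<gamma> n = (-1) ^ n * complex_of_real (\<gamma> gchoose n)"

lemma norm_binc [simp]: "norm (binc \<gamma> n) = \<bar>\<gamma> gchoose n\<bar>"
  by (simp add: binc_def norm_mult norm_power)

lemma summable_binc_mult:
  fixes y :: complex
  assumes "0 < \<gamma>" "norm y \<le> 1"
  shows "summable (\<lambda>n. norm (binc \<gamma> n * y ^ n))"
proof (rule summable_comparison_test[OF _ summable_gbinomial[OF assms(1)]], intro exI allI impI)
  fix n
  have "norm y ^ n \<le> 1" using assms by (simp add: power_le_one)
  thus "norm (norm (binc \<gamma> n * y ^ n)) \<le> \<bar>\<gamma> gchoose n\<bar>"
    by (simp add: norm_mult norm_power mult_left_le)
qed

text \<open>Inside the disc this is the binomial theorem. Absolute summability makes the series
  continuous on the closed disc, the principal power is continuous there because 1 - y has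
  nonnegative real part, and radial limits carry the equality to |y| = 1, where the differences need
  it.\<close>

lemma binomial_series_closed_disc:
  assumes g: "0 < \<gamma>" and y: "norm y \<le> 1"
  shows "(\<Sum>n. binc \<gamma> n * y ^ n) = (1 - y) powr (complex_of_real \<gamma>)"
proof -
  define S where "S = (\<lambda>y. \<Sum>n. binc \<gamma> n * y ^ n)"
  define f where "f = (\<lambda>y::complex. (1 - y) powr (complex_of_real \<gamma>))"
  have inner: "S y = f y" if "norm y < 1" for y
  proof -
    have "(\<lambda>n. (complex_of_real \<gamma> gchoose n) * (- y) ^ n) sums (1 + - y) powr (complex_of_real \<gamma>)"
      using that by (intro gen_binomial_complex) auto
    moreover have "(complex_of_real \<gamma> gchoose n) * (- y) ^ n = binc \<gamma> n * y ^ n" for n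
      unfolding binc_def by (subst power_minus) (simp add: gbinomial_of_real mult_ac)
    ultimately show ?thesis unfolding S_def f_def by (simp add: sums_iff)
  qed
  have "uniform_limit (cball 0 1) (\<lambda>n y. \<Sum>i<n. binc \<gamma> i * y ^ i) S sequentially"
    unfolding S_def
  proof (rule Weierstrass_m_test[OF _ summable_gbinomial[OF g]])
    fix n and y :: complex assume "y \<in> cball 0 1"
    hence "norm y ^ n \<le> 1" by (simp add: power_le_one)
    thus "norm (binc \<gamma> n * y ^ n) \<le> \<bar>\<gamma> gchoose n\<bar>" by (simp add: norm_mult norm_power mult_left_le)
  qed
  hence cS: "continuous_on (cball 0 1) S"
    by (rule uniform_limit_theorem[rotated]) (auto intro!: always_eventually continuous_intros)
  have cf: "continuous_on (cball 0 1) f"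
    unfolding f_def
  proof (intro continuous_intros)
    show "cball 0 1 \<subseteq> {z::complex. 0 \<le> Re (1 - z) \<or> Im (1 - z) \<noteq> 0}"
      using complex_Re_le_cmod order_trans by fastforce
  qed (use g in auto)
  define u where "u = (\<lambda>n. of_real (1 - 1 / real (Suc n)) * y)"
  have u: "norm (u n) < 1" for n
  proof -
    have "norm (u n) = (1 - 1 / real (Suc n)) * norm y"
      unfolding u_def norm_mult norm_of_real by simp
    also have "\<dots> \<le> (1 - 1 / real (Suc n)) * 1" using y by (intro mult_left_mono) auto
    also have "\<dots> < 1" by simp
    finally show ?thesis .
  qed
  have "(\<lambda>n. 1 - 1 / real (Suc n)) \<longlonglongrightarrow> 1 - 0"
    by (intro tendsto_intros LIMSEQ_Suc[OF lim_1_over_n])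
  hence "(\<lambda>n. complex_of_real (1 - 1 / real (Suc n))) \<longlonglongrightarrow> of_real (1 - 0)"
    by (rule tendsto_of_real)
  hence lim: "u \<longlonglongrightarrow> y" unfolding u_def by (auto dest: tendsto_mult_right[where c = y])
  have "(\<lambda>n. S (u n)) \<longlonglongrightarrow> S y"
    by (rule continuous_on_tendsto_compose[OF cS lim]) (use y u in \<open>auto intro!: always_eventually less_imp_le\<close>)
  moreover have "(\<lambda>n. f (u n)) \<longlonglongrightarrow> f y"
    by (rule continuous_on_tendsto_compose[OF cf lim]) (use y u in \<open>auto intro!: always_eventually less_imp_le\<close>)
  ultimately have "S y = f y" using inner[OF u] by (simp add: LIMSEQ_unique)
  thus ?thesis by (simp add: S_def f_def)
qed

text \<open>The factor by which a difference of order \<gamma> and step h multiplies z^k, at x = k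
  h. It is a power of e^(ix) - 1, written through 1 - e^(-ix) because this stays in the closed right
  half plane, away from the branch cut except at 0.\<close>

definition fsym :: "real \<Rightarrow> real \<Rightarrow> complex" where
  "fsym \<gamma> x = cis (\<gamma> * x) * (1 - cis (- x)) powr (complex_of_real \<gamma>)"

lemma fsym_series:
  assumes g: "0 < \<gamma>"
  shows "(\<lambda>n. binc \<gamma> n * cis ((\<gamma> - real n) * x)) sums fsym \<gamma> x"
proof -
  have s: "summable (\<lambda>n. binc \<gamma> n * cis (- x) ^ n)"
    using summable_binc_mult[OF g, of "cis (- x)"] summable_norm_cancel by auto
  have "(\<lambda>n. cis (\<gamma> * x) * (binc \<gamma> n * cis (- x) ^ n)) sums (cis (\<gamma> * x) * (\<Sum>n. binc \<gamma> n * cis (- x) ^ n))"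
    by (intro sums_mult summable_sums s)
  moreover have "cis (\<gamma> * x) * (binc \<gamma> n * cis (- x) ^ n) = binc \<gamma> n * cis ((\<gamma> - real n) * x)" for n
  proof -
    have "cis (\<gamma> * x) * cis (- x) ^ n = cis (\<gamma> * x + real n * (- x))"
      by (simp only: Complex.DeMoivre cis_mult)
    also have "\<gamma> * x + real n * (- x) = (\<gamma> - real n) * x" by (simp add: algebra_simps)
    finally show ?thesis by (simp add: mult_ac)
  qed
  ultimately show ?thesis using binomial_series_closed_disc[OF g, of "cis (- x)"] by (simp add: fsym_def)
qed

lemma fsym_0 [simp]: "0 < \<gamma> \<Longrightarrow> fsym \<gamma> 0 = 0"
  by (simp add: fsym_def)

lemma fsym_add: "fsym (a + b) x = fsym a x * fsym b x"
proof -
  have "cis ((a + b) * x) = cis (a * x) * cis (b * x)" by (simp add: cis_mult distrib_right)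
  thus ?thesis unfolding fsym_def by (simp add: powr_add mult_ac)
qed

text \<open>M = 0 is excluded because \<open>0 powr 0 = 0\<close>, whereas the zeroth power on the
  right is 1 at x = 0.\<close>

lemma fsym_nat: "1 \<le> M \<Longrightarrow> fsym (real M) x = (cis x - 1) ^ M"
proof -
  assume M: "1 \<le> M"
  have "(1 - cis (- x)) powr (complex_of_real (real M)) = (1 - cis (- x)) ^ M"
    using M by (cases "1 - cis (- x) = 0") (auto simp: powr_nat' power_0_left)
  moreover have "cis (real M * x) = cis x ^ M" by (simp add: Complex.DeMoivre)
  moreover have "cis x * (1 - cis (- x)) = cis x - 1" by (simp add: algebra_simps cis_mult)
  ultimately show ?thesis by (simp add: fsym_def power_mult_distrib[symmetric])
qed

definition fdiff :: "real \<Rightarrow> real \<Rightarrow> complex poly \<Rightarrow> complex poly" where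
  "fdiff \<gamma> h = pmul (\<lambda>k. fsym \<gamma> (real k * h))"

lemma fdiff_sums:
  assumes g: "0 < \<gamma>"
  shows "(\<lambda>n. binc \<gamma> n * poly P (cis ((\<gamma> - real n) * h) * z)) sums poly (fdiff \<gamma> h P) z"
proof -
  have "(\<lambda>n. \<Sum>k\<le>degree P. coeff P k * z ^ k * (binc \<gamma> n * cis ((\<gamma> - real n) * (real k * h)))) sums
    (\<Sum>k\<le>degree P. coeff P k * z ^ k * fsym \<gamma> (real k * h))"
    by (intro sums_sum sums_mult fsym_series g)
  moreover have "(\<Sum>k\<le>degree P. coeff P k * z ^ k * (binc \<gamma> n * cis ((\<gamma> - real n) * (real k * h)))) =
      binc \<gamma> n * poly P (cis ((\<gamma> - real n) * h) * z)" for n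
  proof -
    have "cis ((\<gamma> - real n) * (real k * h)) = cis ((\<gamma> - real n) * h) ^ k" for k
      by (simp add: Complex.DeMoivre mult_ac)
    thus ?thesis unfolding poly_altdef
      by (simp add: sum_distrib_left power_mult_distrib mult_ac)
  qed
  moreover have "(\<Sum>k\<le>degree P. coeff P k * z ^ k * fsym \<gamma> (real k * h)) = poly (fdiff \<gamma> h P) z"
    unfolding fdiff_def poly_pmul[OF order_refl] by (simp add: mult_ac)
  ultimately show ?thesis by simp
qed

text \<open>\<open>circ\<close> lives on the fixed period [0, 2 pi]; the rotated interval
  [b, b + 2 pi] is cut at 2 pi and the overhang is moved back by periodicity.\<close>

lemma Jnorm_rotate_le:
  "Jnorm p (\<lambda>z. poly P (cis a * z)) \<le> Jnorm p (poly P)"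
proof -
  define f where "f = (\<lambda>t. ennreal (norm (poly P (cis t)) powr p))"
  have [measurable]: "f \<in> borel_measurable borel" unfolding f_def by measurable
  have per: "f (t + 2 * pi) = f t" for t
    unfolding f_def by (simp add: cis_mult[symmetric])
  obtain b where b: "0 \<le> b" "b < 2 * pi" "cis a = cis b"
  proof -
    have "is_Arg (cis a) (Arg2pi (cis a))" using Arg2pi by blast
    hence "cis a = cis (Arg2pi (cis a))" by (simp add: is_Arg_def cis_conv_exp)
    thus thesis using that[of "Arg2pi (cis a)"] Arg2pi[of "cis a"] by blast
  qed
  have "Jnorm p (\<lambda>z. poly P (cis a * z)) = (\<integral>\<^sup>+t. f (b + t) \<partial>circ)"
    unfolding Jnorm_def f_def b(3) cis_mult ..
  also have "\<dots> = (\<integral>\<^sup>+t. f (b + t) * indicator {b..b + 2 * pi} (b + t) \<partial>lborel)"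
    by (subst nn_integral_circ) (auto intro!: nn_integral_cong simp: indicator_def)
  also have "\<dots> = (\<integral>\<^sup>+t. f t * indicator {b..b + 2 * pi} t \<partial>lborel)"
    using nn_integral_real_affine[of "\<lambda>t. f t * indicator {b..b + 2 * pi} t" 1 b] by simp
  also have "\<dots> \<le> (\<integral>\<^sup>+t. f t * indicator {b..2 * pi} t + f t * indicator {2 * pi<..b + 2 * pi} t \<partial>lborel)"
    by (intro nn_integral_mono) (auto simp: indicator_def)
  also have "\<dots> = (\<integral>\<^sup>+t. f t * indicator {b..2 * pi} t \<partial>lborel) + (\<integral>\<^sup>+t. f t * indicator {2 * pi<..b + 2 * pi} t \<partial>lborel)"
    by (rule nn_integral_add) measurable
  also have "(\<integral>\<^sup>+t. f t * indicator {2 * pi<..b + 2 * pi} t \<partial>lborel) =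
      (\<integral>\<^sup>+t. f (2 * pi + t) * indicator {2 * pi<..b + 2 * pi} (2 * pi + t) \<partial>lborel)"
    using nn_integral_real_affine[of "\<lambda>t. f t * indicator {2 * pi<..b + 2 * pi} t" 1 "2 * pi"] by simp
  also have "\<dots> = (\<integral>\<^sup>+t. f t * indicator {0<..b} t \<partial>lborel)"
    by (intro nn_integral_cong) (auto simp: indicator_def per add.commute[of "2 * pi"])
  also have "(\<integral>\<^sup>+t. f t * indicator {b..2 * pi} t \<partial>lborel) + (\<integral>\<^sup>+t. f t * indicator {0<..b} t \<partial>lborel) =
     (\<integral>\<^sup>+t. f t * indicator {b..2 * pi} t + f t * indicator {0<..b} t \<partial>lborel)"
    by (rule nn_integral_add[symmetric]) measurable
  also have "\<dots> \<le> (\<integral>\<^sup>+t. f t * indicator {0..2 * pi} t \<partial>lborel)"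
  proof (rule nn_integral_mono_AE)
    \<comment> \<open>The two pieces overlap only at the point b.\<close>
    have "AE t in lborel. t \<noteq> b" by (rule AE_lborel_singleton)
    thus "AE t in lborel. f t * indicator {b..2 * pi} t + f t * indicator {0<..b} t \<le> f t * indicator {0..2 * pi} t"
      by eventually_elim (use b in \<open>auto simp: indicator_def\<close>)
  qed
  also have "\<dots> = Jnorm p (poly P)"
    unfolding Jnorm_def f_def by (subst nn_integral_circ) auto
  finally show ?thesis .
qed

lemma Jnorm_limit_le:
  assumes lim: "\<And>t. (\<lambda>n. norm (f n (cis t))) \<longlonglongrightarrow> norm (g (cis t))" and p: "0 < p"
    and m: "\<And>n. (\<lambda>t. norm (f n (cis t))) \<in> borel_measurable borel"
    and A: "\<And>n. n \<ge> n0 \<Longrightarrow> Jnorm p (f n) \<le> A"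
  shows "Jnorm p g \<le> A"
proof -
  have [measurable]: "(\<lambda>t. norm (f n (cis t))) \<in> borel_measurable borel" for n by (rule m)
  have "(\<lambda>n. ennreal (norm (f n (cis t)) powr p)) \<longlonglongrightarrow> ennreal (norm (g (cis t)) powr p)" for t
    using p by (intro tendsto_ennrealI tendsto_powr' lim tendsto_const) auto
  hence "Jnorm p g = (\<integral>\<^sup>+t. liminf (\<lambda>n. ennreal (norm (f n (cis t)) powr p)) \<partial>circ)"
    unfolding Jnorm_def by (intro nn_integral_cong lim_imp_Liminf[symmetric]) auto
  also have "\<dots> \<le> liminf (\<lambda>n. Jnorm p (f n))"
    unfolding Jnorm_def by (rule nn_integral_liminf) measurable
  also have "\<dots> \<le> liminf (\<lambda>n. A)"
    by (rule Liminf_mono) (use A in \<open>auto simp: eventually_sequentially\<close>)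
  also have "\<dots> = A" by (simp add: Liminf_const)
  finally show ?thesis .
qed

section \<open>Powers of sums, for exponents on both sides of 1, and boundedness of fractional
  differences\<close>

lemma powr_subadd:
  fixes a b :: real
  assumes "0 \<le> a" "0 \<le> b" "0 < p" "p \<le> 1"
  shows "(a + b) powr p \<le> a powr p + b powr p"
proof (cases "a + b = 0")
  case False
  define s where "s = a + b"
  have s: "0 < s" using assms False by (simp add: s_def)
  have u: "x / s \<le> (x / s) powr p" if "0 \<le> x" "x \<le> s" for x
  proof (cases "x = 0")
    case False
    thus ?thesis using powr_mono'[of p 1 "x / s"] that assms s by simp
  qed (use s in auto)
  have "1 = a / s + b / s" using s by (simp add: s_def add_divide_distrib[symmetric])
  also have "\<dots> \<le> (a / s) powr p + (b / s) powr p" using assms by (intro add_mono u) (auto simp: s_def)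
  also have "\<dots> = (a powr p + b powr p) / s powr p" using assms s by (simp add: powr_divide add_divide_distrib)
  finally show ?thesis using s by (simp add: s_def field_simps)
qed (use assms in auto)

lemma powr_sum_subadd:
  assumes "finite I" "\<And>i. i \<in> I \<Longrightarrow> 0 \<le> x i" "0 < p" "p \<le> 1"
  shows "(\<Sum>i\<in>I. x i :: real) powr p \<le> (\<Sum>i\<in>I. x i powr p)"
  using assms(1,2)
proof (induction rule: finite_induct)
  case (insert i I)
  have "(x i + sum x I) powr p \<le> x i powr p + sum x I powr p"
    using insert assms by (intro powr_subadd sum_nonneg) auto
  also have "\<dots> \<le> x i powr p + (\<Sum>i\<in>I. x i powr p)" using insert by simp
  finally show ?case using insert by simp
qed (use assms in auto)

text \<open>Jensen's inequality for the normalized weights b i / S. Undoing the normalization leaves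
  S^(p-1), which increases to B^(p-1) since p \<ge> 1.\<close>

lemma powr_sum_jensen_pos:
  assumes I: "finite I" and b: "\<And>i. i \<in> I \<Longrightarrow> 0 \<le> b i" and x: "\<And>i. i \<in> I \<Longrightarrow> 0 < x i" and p: "1 \<le> p"
    and B: "(\<Sum>i\<in>I. b i) \<le> B"
  shows "(\<Sum>i\<in>I. b i * x i :: real) powr p \<le> B powr (p - 1) * (\<Sum>i\<in>I. b i * x i powr p)"
proof (cases "sum b I = 0")
  case True
  hence "\<forall>i\<in>I. b i = 0" using sum_nonneg_eq_0_iff[OF I b] by simp
  thus ?thesis by simp
next
  case False
  define S where "S = sum b I"
  have S: "0 < S" using False b by (simp add: S_def sum_nonneg less_le)
  have "(\<Sum>i\<in>I. (b i / S) *\<^sub>R x i) powr p \<le> (\<Sum>i\<in>I. b i / S * x i powr p)"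
  proof (rule convex_on_sum[OF I _ powr_convex[OF p]])
    show "I \<noteq> {}" using False by auto
    show "(\<Sum>i\<in>I. b i / S) = 1" using S by (simp add: S_def sum_divide_distrib[symmetric])
  qed (use b x S in auto)
  hence "((\<Sum>i\<in>I. b i * x i) / S) powr p \<le> (\<Sum>i\<in>I. b i * x i powr p) / S"
    by (simp add: sum_divide_distrib)
  hence "(\<Sum>i\<in>I. b i * x i) powr p \<le> S powr p * ((\<Sum>i\<in>I. b i * x i powr p) / S)"
    using S b less_imp_le[OF x] by (simp add: powr_divide sum_nonneg field_simps)
  also have "\<dots> = S powr (p - 1) * (\<Sum>i\<in>I. b i * x i powr p)"
    using S by (simp add: powr_diff)
  also have "\<dots> \<le> B powr (p - 1) * (\<Sum>i\<in>I. b i * x i powr p)"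
    using S B p b less_imp_le[OF x] by (intro mult_right_mono powr_mono2 sum_nonneg) (auto simp: S_def)
  finally show ?thesis .
qed

lemma powr_sum_jensen:
  assumes I: "finite I" and b: "\<And>i. i \<in> I \<Longrightarrow> 0 \<le> b i" and x: "\<And>i. i \<in> I \<Longrightarrow> 0 \<le> x i" and p: "1 \<le> p"
    and B: "(\<Sum>i\<in>I. b i) \<le> B"
  shows "(\<Sum>i\<in>I. b i * x i :: real) powr p \<le> B powr (p - 1) * (\<Sum>i\<in>I. b i * x i powr p)"
proof -
  define K where "K = {i \<in> I. 0 < x i}"
  have "(\<Sum>i\<in>I. b i * x i) = (\<Sum>i\<in>K. b i * x i)" "(\<Sum>i\<in>I. b i * x i powr p) = (\<Sum>i\<in>K. b i * x i powr p)"
    by (rule sum.mono_neutral_right; use I x in \<open>force simp: K_def\<close>)+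
  moreover have "(\<Sum>i\<in>K. b i) \<le> B"
    using sum_mono2[OF I, of K b] b B by (force simp: K_def)
  hence "(\<Sum>i\<in>K. b i * x i) powr p \<le> B powr (p - 1) * (\<Sum>i\<in>K. b i * x i powr p)"
    by (intro powr_sum_jensen_pos) (use I b p in \<open>auto simp: K_def\<close>)
  ultimately show ?thesis by simp
qed

text \<open>Subadditivity of \<open>x \<mapsto> x\<^sup>p\<close> for \<open>p \<le> 1\<close> and convexity for \<open>p \<ge> 1\<close> both give a bound of this shape,
  with \<open>d\<close> summable exactly under the hypothesis on \<open>\<gamma>\<close>.\<close>

lemma gbinomial_powr_sum_le:
  fixes \<gamma> p :: real
  assumes p: "0 < p" and g: "0 < \<gamma>" "\<gamma> \<in> \<nat> \<or> 1 / p - 1 < \<gamma>"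
  shows "\<exists>d. summable d \<and> (\<forall>n. 0 \<le> d n) \<and>
    (\<forall>N x. (\<forall>n. 0 \<le> x n) \<longrightarrow> (\<Sum>n<N. \<bar>\<gamma> gchoose n\<bar> * x n) powr p \<le> (\<Sum>n<N. d n * x n powr p))"
proof (cases "p \<le> 1")
  case True
  show ?thesis
  proof (intro exI[of _ "\<lambda>n. \<bar>\<gamma> gchoose n\<bar> powr p"] conjI allI impI summable_gbinomial_powr p g(2))
    fix N and x :: "nat \<Rightarrow> real" assume x: "\<forall>n. 0 \<le> x n"
    have "(\<Sum>n<N. \<bar>\<gamma> gchoose n\<bar> * x n) powr p \<le> (\<Sum>n<N. (\<bar>\<gamma> gchoose n\<bar> * x n) powr p)"
      by (rule powr_sum_subadd) (use x p True in auto)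
    thus "(\<Sum>n<N. \<bar>\<gamma> gchoose n\<bar> * x n) powr p \<le> (\<Sum>n<N. \<bar>\<gamma> gchoose n\<bar> powr p * x n powr p)"
      using x by (simp add: powr_mult)
  qed auto
next
  case False
  define B where "B = (\<Sum>n. \<bar>\<gamma> gchoose n\<bar>)"
  note s = summable_gbinomial[OF g(1)]
  show ?thesis
  proof (intro exI[of _ "\<lambda>n. B powr (p - 1) * \<bar>\<gamma> gchoose n\<bar>"] conjI allI impI summable_mult s)
    fix N and x :: "nat \<Rightarrow> real" assume x: "\<forall>n. 0 \<le> x n"
    have "(\<Sum>n<N. \<bar>\<gamma> gchoose n\<bar> * x n) powr p \<le> B powr (p - 1) * (\<Sum>n<N. \<bar>\<gamma> gchoose n\<bar> * x n powr p)"
      unfolding B_def by (rule powr_sum_jensen) (use x False s in \<open>auto intro!: sum_le_suminf\<close>)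
    thus "(\<Sum>n<N. \<bar>\<gamma> gchoose n\<bar> * x n) powr p \<le> (\<Sum>n<N. B powr (p - 1) * \<bar>\<gamma> gchoose n\<bar> * x n powr p)"
      by (simp add: sum_distrib_left mult.assoc)
  qed auto
qed

text \<open>The partial sums are combinations of rotations of P, each with norm at most that of P,
  and the weights d are summable; Fatou passes to the full series.\<close>

lemma fdiff_bounded:
  fixes \<gamma> p :: real
  assumes p: "0 < p" and g: "0 < \<gamma>" "\<gamma> \<in> \<nat> \<or> 1 / p - 1 < \<gamma>"
  shows "\<exists>C>0. \<forall>h P. Jnorm p (poly (fdiff \<gamma> h P)) \<le> ennreal C * Jnorm p (poly P)"
proof -
  from gbinomial_powr_sum_le[OF p g] obtain d where d: "summable d" "\<And>n. 0 \<le> d n"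
    "\<And>N x. (\<forall>n. 0 \<le> x n) \<Longrightarrow> (\<Sum>n<N. \<bar>\<gamma> gchoose n\<bar> * x n) powr p \<le> (\<Sum>n<N. d n * x n powr p)" by blast
  define C where "C = suminf d + 1"
  have C: "C > 0" using suminf_nonneg[OF d(1,2)] by (simp add: C_def)
  have dC: "(\<Sum>n<N. d n) \<le> C" for N using sum_le_suminf[OF d(1), of "{..<N}"] d(2) by (simp add: C_def)
  show ?thesis
  proof (intro exI[of _ C] conjI C allI)
    fix h P
    define Q where "Q = (\<lambda>n z. poly P (cis ((\<gamma> - real n) * h) * z))"
    define F where "F = (\<lambda>N z. \<Sum>n<N. binc \<gamma> n * Q n z)"
    have Qm [measurable]: "(\<lambda>t. norm (Q n (cis t))) \<in> borel_measurable borel" for n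
      unfolding Q_def by (intro borel_measurable_continuous_onI continuous_intros)
    have Fm: "(\<lambda>t. norm (F N (cis t))) \<in> borel_measurable borel" for N
      unfolding F_def Q_def by (intro borel_measurable_continuous_onI continuous_intros)
    have A: "Jnorm p (F N) \<le> ennreal C * Jnorm p (poly P)" for N
    proof -
      have "Jnorm p (F N) \<le> (\<integral>\<^sup>+t. (\<Sum>n<N. ennreal (d n) * ennreal (norm (Q n (cis t)) powr p)) \<partial>circ)"
        unfolding Jnorm_def
      proof (rule nn_integral_mono)
        fix t
        have "norm (F N (cis t)) \<le> (\<Sum>n<N. \<bar>\<gamma> gchoose n\<bar> * norm (Q n (cis t)))"
          unfolding F_def by (rule order_trans[OF norm_sum]) (simp add: norm_mult)
        hence "norm (F N (cis t)) powr p \<le> (\<Sum>n<N. \<bar>\<gamma> gchoose n\<bar> * norm (Q n (cis t))) powr p"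
          using p by (intro powr_mono2) auto
        also have "\<dots> \<le> (\<Sum>n<N. d n * norm (Q n (cis t)) powr p)" by (rule d(3)) auto
        finally have "ennreal (norm (F N (cis t)) powr p) \<le> ennreal (\<Sum>n<N. d n * norm (Q n (cis t)) powr p)"
          by (rule ennreal_leI)
        also have "\<dots> = (\<Sum>n<N. ennreal (d n) * ennreal (norm (Q n (cis t)) powr p))"
          using d(2) by (simp add: sum_ennreal[symmetric] ennreal_mult)
        finally show "ennreal (norm (F N (cis t)) powr p) \<le> (\<Sum>n<N. ennreal (d n) * ennreal (norm (Q n (cis t)) powr p))" .
      qed
      also have "\<dots> = (\<Sum>n<N. ennreal (d n) * Jnorm p (Q n))"
        unfolding Jnorm_def by (subst nn_integral_sum) (auto simp: nn_integral_cmult)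
      also have "\<dots> \<le> (\<Sum>n<N. ennreal (d n) * Jnorm p (poly P))"
        unfolding Q_def by (intro sum_mono mult_left_mono Jnorm_rotate_le) auto
      also have "\<dots> = ennreal (\<Sum>n<N. d n) * Jnorm p (poly P)"
        using d(2) by (simp add: sum_distrib_right[symmetric] sum_ennreal)
      also have "\<dots> \<le> ennreal C * Jnorm p (poly P)" by (intro mult_right_mono ennreal_leI dC) auto
      finally show ?thesis .
    qed
    have L: "(\<lambda>N. norm (F N (cis t))) \<longlonglongrightarrow> norm (poly (fdiff \<gamma> h P) (cis t))" for t
      using fdiff_sums[OF g(1), of P h "cis t"] unfolding F_def Q_def sums_def by (rule tendsto_norm)
    show "Jnorm p (poly (fdiff \<gamma> h P)) \<le> ennreal C * Jnorm p (poly P)"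
      by (rule Jnorm_limit_le[where f = F and ?n0.0 = 0, OF L p Fm A])
  qed
qed

subsection \<open>Fractional integration\<close>

lemma Gamma_integral_scaled:
  fixes \<theta> c :: real
  assumes th: "0 < \<theta>" and c: "0 < c"
  shows "has_bochner_integral lborel (\<lambda>s. indicator {0..} s * s powr (\<theta> - 1) * exp (- c * s)) (Gamma \<theta> * c powr (- \<theta>))"
proof (rule has_bochner_integral_nn_integral)
  define g where "g = (\<lambda>s::real. indicator {0..} s * s powr (\<theta> - 1) * exp (- c * s))"
  have [measurable]: "g \<in> borel_measurable borel" unfolding g_def by measurable
  have gn: "0 \<le> g s" for s by (simp add: g_def)
  have Gp: "0 < Gamma \<theta>" using th by (rule Gamma_real_pos)
  have "ennreal (Gamma \<theta>) = (\<integral>\<^sup>+t. ennreal (indicator {0..} t * t powr (\<theta> - 1) / exp t) \<partial>lborel)"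
    by (rule Gamma_conv_nn_integral_real[OF th])
  also have "\<dots> = ennreal \<bar>c\<bar> * (\<integral>\<^sup>+t. ennreal (indicator {0..} (0 + c * t) * (0 + c * t) powr (\<theta> - 1) / exp (0 + c * t)) \<partial>lborel)"
    using c by (intro nn_integral_real_affine) auto
  also have "(\<integral>\<^sup>+t. ennreal (indicator {0..} (0 + c * t) * (0 + c * t) powr (\<theta> - 1) / exp (0 + c * t)) \<partial>lborel) =
      (\<integral>\<^sup>+t. ennreal (c powr (\<theta> - 1)) * ennreal (g t) \<partial>lborel)"
  proof (intro nn_integral_cong)
    fix t
    have "indicator {0..} (0 + c * t) * (0 + c * t) powr (\<theta> - 1) / exp (0 + c * t) = c powr (\<theta> - 1) * g t"
      using c by (auto simp: g_def indicator_def zero_le_mult_iff powr_mult exp_minus divide_inverse)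
    thus "ennreal (indicator {0..} (0 + c * t) * (0 + c * t) powr (\<theta> - 1) / exp (0 + c * t)) = ennreal (c powr (\<theta> - 1)) * ennreal (g t)"
      by (simp add: ennreal_mult'[symmetric])
  qed
  also have "\<dots> = ennreal (c powr (\<theta> - 1)) * (\<integral>\<^sup>+t. ennreal (g t) \<partial>lborel)"
    by (rule nn_integral_cmult) measurable
  finally have e: "ennreal (Gamma \<theta>) = ennreal c * (ennreal (c powr (\<theta> - 1)) * (\<integral>\<^sup>+t. ennreal (g t) \<partial>lborel))"
    using c by simp
  have "ennreal (Gamma \<theta> * c powr (- \<theta>)) = ennreal (c powr (- \<theta>)) * ennreal (Gamma \<theta>)"
    by (simp add: ennreal_mult'' mult.commute)
  also have "\<dots> = (ennreal (c powr (- \<theta>)) * (ennreal c * ennreal (c powr (\<theta> - 1)))) * (\<integral>\<^sup>+t. ennreal (g t) \<partial>lborel)"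
    unfolding e by (simp only: mult.assoc)
  also have "ennreal (c powr (- \<theta>)) * (ennreal c * ennreal (c powr (\<theta> - 1))) = ennreal 1"
  proof -
    have "c powr (- \<theta>) * (c * c powr (\<theta> - 1)) = 1"
      using c by (simp add: powr_diff powr_minus field_simps)
    thus ?thesis using c by (simp add: ennreal_mult'[symmetric])
  qed
  finally show "(\<integral>\<^sup>+s. ennreal (indicator {0..} s * s powr (\<theta> - 1) * exp (- c * s)) \<partial>lborel) = ennreal (Gamma \<theta> * c powr (- \<theta>))"
    by (simp add: g_def)
  show "0 \<le> Gamma \<theta> * c powr (- \<theta>)" using Gp by simp
qed auto

text \<open>Fractional integration of order \<theta>. The factor at k = 0 is 0 because
  \<open>0 powr a = 0\<close>, so a constant term is removed.\<close>

definition fracint :: "real \<Rightarrow> complex poly \<Rightarrow> complex poly" where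
  "fracint \<theta> = pmul (\<lambda>k. complex_of_real (real k powr (- \<theta>)))"

text \<open>Gamma(\<theta>) k^(-\<theta>) is the integral of s^(\<theta>-1) e^(-ks) over s > 0, so
  the fractional integral at z is a weighted integral of T along the radius to z, with r = e^(-s).
  The representation requires the constant term to vanish.\<close>

lemma norm_fracint_le:
  assumes th: "0 < \<theta>" and T0: "coeff T 0 = 0"
  shows "ennreal (Gamma \<theta> * norm (poly (fracint \<theta> T) z)) \<le>
    (\<integral>\<^sup>+s. ennreal (indicator {0..} s * s powr (\<theta> - 1) * norm (poly T (of_real (exp (- s)) * z))) \<partial>lborel)"
proof -
  define g where "g = (\<lambda>k s::real. indicator {0..} s * s powr (\<theta> - 1) * exp (- real k * s))"
  have Gp: "0 < Gamma \<theta>" using th by (rule Gamma_real_pos)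
  have "has_bochner_integral lborel (\<lambda>s. \<Sum>k\<in>{1..degree T}. of_real (g k s) * (coeff T k * z ^ k))
     (\<Sum>k\<in>{1..degree T}. of_real (Gamma \<theta> * real k powr (- \<theta>)) * (coeff T k * z ^ k))"
    unfolding g_def
    by (intro has_bochner_integral_sum has_bochner_integral_mult_left has_bochner_integral_of_real Gamma_integral_scaled th) auto
  moreover have "(\<Sum>k\<in>{1..degree T}. of_real (Gamma \<theta> * real k powr (- \<theta>)) * (coeff T k * z ^ k)) = of_real (Gamma \<theta>) * poly (fracint \<theta> T) z"
  proof -
    have "poly (fracint \<theta> T) z = (\<Sum>k\<in>{1..degree T}. of_real (real k powr (- \<theta>)) * coeff T k * z ^ k)"
      unfolding fracint_def poly_pmul[OF order_refl]
      by (rule sum.mono_neutral_right) (use T0 in \<open>auto simp: not_less_eq_eq\<close>)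
    thus ?thesis by (simp add: sum_distrib_left mult_ac)
  qed
  moreover have "(\<Sum>k\<in>{1..degree T}. of_real (g k s) * (coeff T k * z ^ k)) =
    of_real (indicator {0..} s * s powr (\<theta> - 1)) * poly T (of_real (exp (- s)) * z)" for s
  proof -
    have "poly T (of_real (exp (- s)) * z) = (\<Sum>k\<in>{1..degree T}. coeff T k * (of_real (exp (- s)) * z) ^ k)"
      unfolding poly_altdef
      by (rule sum.mono_neutral_right) (use T0 in \<open>auto simp: not_less_eq_eq\<close>)
    also have "\<dots> = (\<Sum>k\<in>{1..degree T}. coeff T k * (of_real (exp (- real k * s)) * z ^ k))"
      by (simp add: power_mult_distrib of_real_power[symmetric] exp_of_nat_mult[symmetric] del: of_real_power)
    finally show ?thesis by (simp add: g_def sum_distrib_left mult_ac)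
  qed
  ultimately have "has_bochner_integral lborel (\<lambda>s. of_real (indicator {0..} s * s powr (\<theta> - 1)) * poly T (of_real (exp (- s)) * z))
     (of_real (Gamma \<theta>) * poly (fracint \<theta> T) z)" by simp
  hence "integrable lborel (\<lambda>s. of_real (indicator {0..} s * s powr (\<theta> - 1)) * poly T (of_real (exp (- s)) * z))"
    and "integral\<^sup>L lborel (\<lambda>s. of_real (indicator {0..} s * s powr (\<theta> - 1)) * poly T (of_real (exp (- s)) * z)) = of_real (Gamma \<theta>) * poly (fracint \<theta> T) z"
    unfolding has_bochner_integral_iff by blast+
  from integral_norm_bound_ennreal[OF this(1)] this(2)
  have "ennreal (norm (of_real (Gamma \<theta>) * poly (fracint \<theta> T) z)) \<le>
     (\<integral>\<^sup>+s. ennreal (norm (of_real (indicator {0..} s * s powr (\<theta> - 1)) * poly T (of_real (exp (- s)) * z))) \<partial>lborel)"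
    by (simp only:)
  thus ?thesis using Gp by (simp add: norm_mult abs_mult)
qed

text \<open>For s \<le> b the bound G gives G b^\<theta> / \<theta>, for s \<ge> b the decay gives q
  K b^(-1/q). With b chosen so that G = K b^(-1/p), both are K^(p \<theta>) G^(p/q) up to the
  factors 1/\<theta> and q.\<close>

lemma hedberg_pointwise:
  fixes p q \<theta> :: real
  assumes p: "0 < p" "p < q" and th: "\<theta> = 1 / p - 1 / q" and T0: "coeff T 0 = 0"
    and G: "\<And>s. 0 \<le> s \<Longrightarrow> norm (poly T (of_real (exp (- s)) * z)) \<le> G"
    and K: "\<And>s. 0 < s \<Longrightarrow> norm (poly T (of_real (exp (- s)) * z)) \<le> K * s powr (- 1 / p)"
  shows "Gamma \<theta> * norm (poly (fracint \<theta> T) z) \<le> (1 / \<theta> + q) * K powr (p * \<theta>) * G powr (p / q)"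
proof -
  have thp: "0 < \<theta>" unfolding th using p by (simp add: frac_less2)
  have G0: "0 \<le> G" using order_trans[OF norm_ge_zero G[of 0]] by simp
  have K0: "0 \<le> K" using order_trans[OF norm_ge_zero K[of 1]] by simp
  note main = norm_fracint_le[OF thp T0, of z]
  show ?thesis
  proof (cases "G = 0 \<or> K = 0")
    \<comment> \<open>Then T vanishes for all s > 0, and s = 0 contributes nothing because a power
      of 0 is 0.\<close>
    case True
    have z: "indicator {0..} s * s powr (\<theta> - 1) * norm (poly T (of_real (exp (- s)) * z)) = 0" for s :: real
    proof (cases "s > 0")
      case True
      hence "norm (poly T (of_real (exp (- s)) * z)) \<le> 0" using G[of s] K[of s] \<open>G = 0 \<or> K = 0\<close> by auto
      thus ?thesis by simp
    qed (auto simp: indicator_def)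
    have "ennreal (Gamma \<theta> * norm (poly (fracint \<theta> T) z)) \<le> 0" using main unfolding z by simp
    hence "Gamma \<theta> * norm (poly (fracint \<theta> T) z) \<le> 0" by (simp add: ennreal_eq_0_iff)
    also have "0 \<le> (1 / \<theta> + q) * K powr (p * \<theta>) * G powr (p / q)" using thp p by simp
    finally show ?thesis .
  next
    case False
    hence GK: "0 < G" "0 < K" using G0 K0 by auto
    define b where "b = (K / G) powr p"
    have b: "0 < b" using GK by (simp add: b_def)
    have e: "1 / p - \<theta> = 1 / q" by (simp add: th)
    have i1: "((\<lambda>s. s powr (\<theta> - 1)) has_integral b powr \<theta> / \<theta>) {0..b}"
      using has_integral_powr_from_0[of "\<theta> - 1" b] thp b by simp
    have i2: "((\<lambda>s. s powr (- 1 / q - 1)) has_integral q * b powr (- 1 / q)) {b..}"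
      using has_integral_powr_to_inf[of "- 1 / q - 1" b] b p by (simp add: mult.commute)
    have "(\<integral>\<^sup>+s. ennreal (indicator {0..} s * s powr (\<theta> - 1) * norm (poly T (of_real (exp (- s)) * z))) \<partial>lborel) \<le>
      (\<integral>\<^sup>+s. ennreal G * (ennreal (s powr (\<theta> - 1)) * indicator {0..b} s) + ennreal K * (ennreal (s powr (- 1 / q - 1)) * indicator {b..} s) \<partial>lborel)"
    proof (rule nn_integral_mono)
      fix s :: real
      consider "s < 0" | "0 \<le> s" "s \<le> b" | "b < s" by linarith
      thus "ennreal (indicator {0..} s * s powr (\<theta> - 1) * norm (poly T (of_real (exp (- s)) * z))) \<le>
         ennreal G * (ennreal (s powr (\<theta> - 1)) * indicator {0..b} s) + ennreal K * (ennreal (s powr (- 1 / q - 1)) * indicator {b..} s)"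
      proof cases
        case 2
        have "s powr (\<theta> - 1) * norm (poly T (of_real (exp (- s)) * z)) \<le> G * s powr (\<theta> - 1)"
          using G[OF 2(1)] by (subst mult.commute) (intro mult_right_mono, auto)
        hence "ennreal (s powr (\<theta> - 1) * norm (poly T (of_real (exp (- s)) * z))) \<le> ennreal G * ennreal (s powr (\<theta> - 1))"
          using GK by (simp add: ennreal_mult'[symmetric] ennreal_leI)
        thus ?thesis using 2 by (simp add: add_increasing2)
      next
        case 3
        hence s: "0 < s" using b by simp
        have "s powr (\<theta> - 1) * norm (poly T (of_real (exp (- s)) * z)) \<le> s powr (\<theta> - 1) * (K * s powr (- 1 / p))"
          using K[OF s] by (intro mult_left_mono) auto
        also have "\<dots> = K * s powr (\<theta> - 1 + - 1 / p)" by (simp only: powr_add mult_ac)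
        also have "\<theta> - 1 + - 1 / p = - 1 / q - 1" using e by simp
        finally have "ennreal (s powr (\<theta> - 1) * norm (poly T (of_real (exp (- s)) * z))) \<le> ennreal K * ennreal (s powr (- 1 / q - 1))"
          using GK by (simp add: ennreal_mult'[symmetric] ennreal_leI)
        thus ?thesis using 3 s by (simp add: add_increasing)
      qed auto
    qed
    also have "\<dots> = ennreal G * ennreal (b powr \<theta> / \<theta>) + ennreal K * ennreal (q * b powr (- 1 / q))"
      by (subst nn_integral_add, measurable, subst nn_integral_cmult, measurable, subst nn_integral_cmult, measurable)
         (simp only: nn_integral_has_integral_lebesgue'[OF powr_ge_zero i1] nn_integral_has_integral_lebesgue'[OF powr_ge_zero i2])
    also have "\<dots> = ennreal (G * (b powr \<theta> / \<theta>) + K * (q * b powr (- 1 / q)))"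
      using GK thp p by (simp add: ennreal_mult'[symmetric] ennreal_plus[symmetric] del: ennreal_plus)
    also have "G * (b powr \<theta> / \<theta>) + K * (q * b powr (- 1 / q)) = (1 / \<theta> + q) * K powr (p * \<theta>) * G powr (p / q)"
    proof -
      have e1: "1 - p * \<theta> = p / q" using p by (simp add: th field_simps)
      have 1: "G * b powr \<theta> = K powr (p * \<theta>) * G powr (p / q)"
      proof -
        have "G * b powr \<theta> = K powr (p * \<theta>) * (G powr 1 * G powr (- (p * \<theta>)))"
          using GK by (simp add: b_def powr_powr powr_divide powr_minus_divide)
        also have "G powr 1 * G powr (- (p * \<theta>)) = G powr (p / q)"
          by (simp only: powr_add[symmetric] e1[symmetric]) simp
        finally show ?thesis .
      qed
      have 2: "K * b powr (- 1 / q) = K powr (p * \<theta>) * G powr (p / q)"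
      proof -
        have "K * b powr (- 1 / q) = (K powr 1 * K powr (- (p / q))) * G powr (p / q)"
          using GK by (simp add: b_def powr_powr powr_divide powr_minus_divide)
        also have "K powr 1 * K powr (- (p / q)) = K powr (p * \<theta>)"
        proof -
          have "1 + - (p / q) = p * \<theta>" using e1 by simp
          thus ?thesis by (simp only: powr_add[symmetric])
        qed
        finally show ?thesis .
      qed
      have "G * (b powr \<theta> / \<theta>) + K * (q * b powr (- 1 / q)) = (G * b powr \<theta>) * (1 / \<theta>) + q * (K * b powr (- 1 / q))"
        by simp
      thus ?thesis unfolding 1 2 by (simp add: algebra_simps)
    qed
    finally have "ennreal (Gamma \<theta> * norm (poly (fracint \<theta> T) z)) \<le> ennreal ((1 / \<theta> + q) * K powr (p * \<theta>) * G powr (p / q))"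
      using main order_trans by blast
    thus ?thesis using thp p by (subst (asm) ennreal_le_iff) auto
  qed
qed

text \<open>The kernel peak bounds |U|^p by a multiple of 1/(1 - r), which behaves like 1/s for
  small s but does not decay for large s. The factor r^p gained from T = z U supplies the decay:
  r^p/(1 - r) \<le> max(1, 1/p)/s for all s > 0.\<close>

lemma radial_decay:
  assumes p: "0 < p" and T0: "coeff T 0 = 0" and A: "0 \<le> A" "Jnorm p (poly T) \<le> ennreal (A powr p)"
    and z: "norm z = 1" and s: "0 < s"
  shows "norm (poly T (of_real (exp (- s)) * z)) \<le> (9 / pi * max 1 (1 / p)) powr (1 / p) * A * s powr (- 1 / p)"
proof -
  define U where "U = poly_shift 1 T"
  have TU: "T = monom 1 1 * U"
  proof (rule poly_eqI)
    fix n show "coeff T n = coeff (monom 1 1 * U) n"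
      using T0 by (cases n) (auto simp: coeff_monom_mult U_def coeff_poly_shift)
  qed
  have Tz: "poly T w = w * poly U w" for w by (subst TU) (simp add: poly_monom)
  have JU: "Jnorm p (poly U) = Jnorm p (poly T)" by (rule Jnorm_cong) (simp add: Tz norm_mult)
  define r where "r = exp (- s)"
  have r: "0 \<le> r" "r < 1" using s by (auto simp: r_def)
  have "ennreal (norm (poly U (of_real r * z)) powr p) \<le>
     ennreal (9 / pi) * (\<integral>\<^sup>+t. ennreal (kern (1 - r) z (cis t) * norm (poly U (cis t)) powr p) \<partial>circ)"
    by (rule poly_kern_le[OF p r z])
  also have "\<dots> \<le> ennreal (9 / pi) * (\<integral>\<^sup>+t. ennreal (1 / (1 - r)) * ennreal (norm (poly U (cis t)) powr p) \<partial>circ)"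
  proof (intro mult_left_mono nn_integral_mono)
    fix t
    have "kern (1 - r) z (cis t) * norm (poly U (cis t)) powr p \<le> 1 / (1 - r) * norm (poly U (cis t)) powr p"
      using r by (intro mult_right_mono kern_le) auto
    thus "ennreal (kern (1 - r) z (cis t) * norm (poly U (cis t)) powr p) \<le> ennreal (1 / (1 - r)) * ennreal (norm (poly U (cis t)) powr p)"
      using r by (subst ennreal_mult'[symmetric]) (auto intro!: ennreal_leI)
  qed auto
  also have "\<dots> = ennreal (9 / pi) * (ennreal (1 / (1 - r)) * Jnorm p (poly T))"
    unfolding JU[symmetric] unfolding Jnorm_def by (subst nn_integral_cmult) auto
  also have "\<dots> \<le> ennreal (9 / pi) * (ennreal (1 / (1 - r)) * ennreal (A powr p))"
    by (intro mult_left_mono A) auto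
  also have "\<dots> = ennreal (9 / pi * (1 / (1 - r) * A powr p))"
    using r by (simp only: ennreal_mult''[symmetric] powr_ge_zero mult_nonneg_nonneg zero_le_divide_1_iff diff_ge_0_iff_ge less_imp_le)
  finally have 1: "norm (poly U (of_real r * z)) powr p \<le> 9 / pi * (1 / (1 - r) * A powr p)"
    using r by (subst (asm) ennreal_le_iff) auto
  have 2: "r powr p * (1 / (1 - r)) \<le> max 1 (1 / p) / s"
  proof -
    have "1 + s \<le> exp s" by (rule exp_ge_add_one_self)
    hence "r * (1 + s) \<le> r * exp s" using r by (intro mult_left_mono) auto
    hence "r * (1 + s) \<le> 1" by (simp add: r_def exp_minus)
    hence a: "s \<le> (1 + s) * (1 - r)" by (simp add: algebra_simps)
    have "1 + s \<le> max 1 (1 / p) * (1 + p * s)"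
    proof (cases "p \<le> 1")
      case True
      hence "max 1 (1 / p) = 1 / p" using p by (simp add: max_def field_simps)
      moreover have "1 \<le> 1 / p" using True p by simp
      ultimately show ?thesis using p by (simp add: distrib_left)
    next
      case False
      hence "max 1 (1 / p) = 1" using p by (simp add: max_def field_simps)
      thus ?thesis using False s by simp
    qed
    also have "\<dots> \<le> max 1 (1 / p) * exp (p * s)" by (intro mult_left_mono exp_ge_add_one_self) auto
    finally have b: "1 + s \<le> max 1 (1 / p) * exp (p * s)" .
    have "s \<le> (1 + s) * (1 - r)" by (rule a)
    also have "\<dots> \<le> (max 1 (1 / p) * exp (p * s)) * (1 - r)" using r b by (intro mult_right_mono) auto
    finally have "s * exp (- (p * s)) \<le> (max 1 (1 / p) * exp (p * s)) * (1 - r) * exp (- (p * s))"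
      by (intro mult_right_mono) auto
    also have "\<dots> = max 1 (1 / p) * (1 - r)" by (simp add: exp_minus)
    also have "exp (- (p * s)) = r powr p" by (simp add: r_def powr_def)
    finally have "s * r powr p \<le> max 1 (1 / p) * (1 - r)" .
    thus ?thesis using r s by (simp add: field_simps)
  qed
  have "norm (poly T (of_real r * z)) powr p = r powr p * norm (poly U (of_real r * z)) powr p"
    using r z by (simp add: Tz norm_mult powr_mult)
  also have "\<dots> \<le> r powr p * (9 / pi * (1 / (1 - r) * A powr p))" by (intro mult_left_mono 1) auto
  also have "\<dots> = 9 / pi * A powr p * (r powr p * (1 / (1 - r)))" by simp
  also have "\<dots> \<le> 9 / pi * A powr p * (max 1 (1 / p) / s)" by (intro mult_left_mono 2) auto
  finally have 3: "norm (poly T (of_real r * z)) powr p \<le> 9 / pi * max 1 (1 / p) * A powr p / s" by (simp add: mult_ac)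
  have "norm (poly T (of_real r * z)) = (norm (poly T (of_real r * z)) powr p) powr (1 / p)" using p by (simp add: powr_powr)
  also have "\<dots> \<le> (9 / pi * max 1 (1 / p) * A powr p / s) powr (1 / p)" using 3 p by (intro powr_mono2) auto
  also have "\<dots> = ((9 / pi * max 1 (1 / p)) * A powr p * s powr (- 1)) powr (1 / p)"
    using s by (simp add: powr_minus divide_inverse)
  also have "\<dots> = (9 / pi * max 1 (1 / p)) powr (1 / p) * A * s powr (- 1 / p)"
    using A p by (simp only: powr_mult powr_powr) simp
  finally show ?thesis by (simp add: r_def)
qed

text \<open>Raised to the power q, the pointwise bound contains G^p, whose integral the maximal
  theorem controls by A^p. The other factor is A^(p \<theta> q), and p \<theta> q + p = q restores
  homogeneity.\<close>

theorem hardy_littlewood: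
  fixes p q \<theta> :: real
  assumes p: "0 < p" "p < q" and th: "\<theta> = 1 / p - 1 / q"
  shows "\<exists>C>0. \<forall>T A. coeff T 0 = 0 \<longrightarrow> 0 \<le> A \<longrightarrow> Jnorm p (poly T) \<le> ennreal (A powr p) \<longrightarrow>
     Jnorm q (poly (fracint \<theta> T)) \<le> ennreal ((C * A) powr q)"
proof -
  have thp: "0 < \<theta>" unfolding th using p by (simp add: frac_less2)
  have q: "0 < q" using p by simp
  have Gp: "0 < Gamma \<theta>" using thp by (rule Gamma_real_pos)
  define \<kappa> where "\<kappa> = (9 / pi * max 1 (1 / p)) powr (1 / p)"
  have kp: "0 < \<kappa>" by (simp add: \<kappa>_def)
  define D where "D = (1 / \<theta> + q) / Gamma \<theta> * \<kappa> powr (p * \<theta>)"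
  have D: "0 < D" using thp q Gp kp by (simp add: D_def add_pos_pos)
  define C where "C = D * (144\<^sup>2) powr (1 / q)"
  have C: "0 < C" using D by (simp add: C_def)
  show ?thesis
  proof (intro exI[of _ C] conjI C allI impI)
    fix T :: "complex poly" and A :: real
    assume T0: "coeff T 0 = 0" and A: "0 \<le> A" "Jnorm p (poly T) \<le> ennreal (A powr p)"
    from radial_maximal[OF p(1), of T] obtain G where G: "G \<in> borel_measurable borel" "\<And>t. 0 \<le> G t"
      "\<And>t r. 0 \<le> r \<Longrightarrow> r \<le> 1 \<Longrightarrow> norm (poly T (of_real r * cis t)) \<le> G t"
      "(\<integral>\<^sup>+t. ennreal (G t powr p) \<partial>circ) \<le> ennreal (144\<^sup>2) * Jnorm p (poly T)" by blast
    have [measurable]: "G \<in> borel_measurable borel" by fact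
    have ptw: "norm (poly (fracint \<theta> T) (cis t)) \<le> (D * A powr (p * \<theta>)) * G t powr (p / q)" for t
    proof -
      have "Gamma \<theta> * norm (poly (fracint \<theta> T) (cis t)) \<le> (1 / \<theta> + q) * (\<kappa> * A) powr (p * \<theta>) * G t powr (p / q)"
      proof (rule hedberg_pointwise[OF p th T0])
        fix s :: real assume "0 < s"
        thus "norm (poly T (of_real (exp (- s)) * cis t)) \<le> \<kappa> * A * s powr (- 1 / p)"
          unfolding \<kappa>_def by (intro radial_decay p T0 A) auto
      qed (use G(3) in auto)
      thus ?thesis using Gp kp A by (simp add: D_def powr_mult field_simps)
    qed
    have "Jnorm q (poly (fracint \<theta> T)) \<le> ennreal ((D * A powr (p * \<theta>)) powr q) * (\<integral>\<^sup>+t. ennreal ((G t powr (p / q)) powr q) \<partial>circ)"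
      by (rule Jnorm_le_majorant[where G = "\<lambda>t. G t powr (p / q)"]) (use ptw q D in auto)
    also have "(\<integral>\<^sup>+t. ennreal ((G t powr (p / q)) powr q) \<partial>circ) = (\<integral>\<^sup>+t. ennreal (G t powr p) \<partial>circ)"
      using q by (simp add: powr_powr)
    also have "\<dots> \<le> ennreal (144\<^sup>2) * ennreal (A powr p)"
      by (rule order_trans[OF G(4)]) (intro mult_left_mono A, auto)
    finally have "Jnorm q (poly (fracint \<theta> T)) \<le> ennreal ((D * A powr (p * \<theta>)) powr q) * (ennreal (144\<^sup>2) * ennreal (A powr p))"
      by (simp add: mult_left_mono)
    also have "\<dots> = ennreal ((D * A powr (p * \<theta>)) powr q * (144\<^sup>2 * A powr p))"
      by (simp only: ennreal_mult''[symmetric] powr_ge_zero mult_nonneg_nonneg zero_le_power2)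
    also have "(D * A powr (p * \<theta>)) powr q * (144\<^sup>2 * A powr p) = (C * A) powr q"
    proof -
      have e: "p * \<theta> * q + p = q" using p by (simp add: th field_simps)
      have "(D * A powr (p * \<theta>)) powr q * (144\<^sup>2 * A powr p) = D powr q * 144\<^sup>2 * (A powr (p * \<theta> * q) * A powr p)"
        using D by (simp add: powr_mult powr_powr)
      also have "A powr (p * \<theta> * q) * A powr p = A powr q" by (simp only: powr_add[symmetric] e)
      also have "D powr q * 144\<^sup>2 * A powr q = (C * A) powr q"
        using D q by (simp add: C_def powr_mult powr_powr)
      finally show ?thesis .
    qed
    finally show "Jnorm q (poly (fracint \<theta> T)) \<le> ennreal ((C * A) powr q)" .
  qed
qed

subsection \<open>Multipliers at low frequencies\<close>

text \<open>If M is the largest of the numbers 2^(j+1) x_j, then x_j \<le> M 2^(-j-1) and the whole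
  sum is at most M. A single term dominates, so p < 1 and p \<ge> 1 need no distinction; the weights
  are harmless for terms decaying faster than 2^(-j).\<close>

lemma powr_sum_dyadic_le:
  fixes x :: "nat \<Rightarrow> real"
  assumes x: "\<And>j. 0 \<le> x j" and p: "0 < p"
  shows "(\<Sum>j<N. x j) powr p \<le> (\<Sum>j<N. (2 ^ (j + 1) * x j) powr p)"
proof (cases "N = 0")
  case False
  define M where "M = Max ((\<lambda>j. 2 ^ (j + 1) * x j) ` {..<N})"
  have M: "2 ^ (j + 1) * x j \<le> M" if "j < N" for j unfolding M_def using that by (intro Max_ge) auto
  have "M \<in> (\<lambda>j. 2 ^ (j + 1) * x j) ` {..<N}" unfolding M_def using False by (intro Max_in) auto
  then obtain i where i: "i < N" "M = 2 ^ (i + 1) * x i" by auto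
  have M0: "0 \<le> M" using i x by simp
  have geo: "(\<Sum>j<N. (1 / 2) ^ (j + 1)) \<le> (1::real)"
  proof -
    have "(\<Sum>j<N. (1 / 2) ^ (j + 1)) = (1::real) - (1 / 2) ^ N" by (induction N) auto
    thus ?thesis by simp
  qed
  have "(\<Sum>j<N. x j) \<le> (\<Sum>j<N. M * (1 / 2) ^ (j + 1))"
    by (intro sum_mono) (use M in \<open>auto simp: power_one_over field_simps\<close>)
  also have "\<dots> = M * (\<Sum>j<N. (1 / 2) ^ (j + 1))" by (simp add: sum_distrib_left)
  also have "\<dots> \<le> M * 1" by (intro mult_left_mono geo M0)
  finally have "(\<Sum>j<N. x j) powr p \<le> M powr p" using x p by (intro powr_mono2 sum_nonneg) auto
  also have "\<dots> \<le> (\<Sum>j<N. (2 ^ (j + 1) * x j) powr p)"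
    unfolding i(2) by (rule member_le_sum) (use i in auto)
  finally show ?thesis .
qed auto

lemma abs_nat_mult_le:
  fixes h :: real
  assumes "k \<le> n"
  shows "\<bar>real k * h\<bar> \<le> \<bar>h\<bar> * real n"
proof -
  have "\<bar>real k * h\<bar> = \<bar>h\<bar> * real k" by (simp add: abs_mult)
  also have "\<dots> \<le> \<bar>h\<bar> * real n" using assms by (intro mult_left_mono) auto
  finally show ?thesis .
qed

lemma power_powr_commute: "(x ^ j) powr p = (x powr p :: real) ^ j"
  by (induction j) (auto simp: powr_mult)

lemma coeff_Dpoly_funpow: "coeff ((Dpoly ^^ j) P) k = of_nat k ^ j * coeff P k"
  by (induction j arbitrary: P) (auto simp: coeff_Dpoly mult_ac)

lemma degree_Dpoly_funpow_le: "degree ((Dpoly ^^ j) P) \<le> degree P"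
  by (rule degree_le) (auto simp: coeff_Dpoly_funpow coeff_eq_0)

lemma Jnorm_smult:
  assumes "0 < p"
  shows "Jnorm p (poly (smult c P)) = ennreal (norm c powr p) * Jnorm p (poly P)"
  unfolding Jnorm_def
  by (subst nn_integral_cmult[symmetric]) (auto simp: norm_mult powr_mult ennreal_mult)

text \<open>The multiplier (k h)^j is h^j times the j-th iterate of \<open>Dpoly\<close>, which
  Bernstein's inequality bounds by a constant multiple of |h| n to the power j. For small |h| n the
  series converges geometrically in the p-th power, even with dyadic weights.\<close>

lemma power_series_multiplier:
  fixes c :: "nat \<Rightarrow> complex"
  assumes p: "0 < p" and c: "\<And>j. norm (c j) \<le> K * R ^ j" and R: "0 < R"
  shows "\<exists>c0>0. \<exists>C>0. \<forall>n\<ge>1. \<forall>T h. degree T \<le> n \<longrightarrow> \<bar>h\<bar> * real n \<le> c0 \<longrightarrow>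
    Jnorm p (poly (pmul (\<lambda>k. \<Sum>j. c j * of_real (real k * h) ^ j) T)) \<le> ennreal C * Jnorm p (poly T)"
proof -
  have K: "0 \<le> K" using order_trans[OF norm_ge_zero c[of 0]] by simp
  from bernstein[OF p] obtain CB where CB: "CB > 0" and
    b: "\<And>n P. 1 \<le> n \<Longrightarrow> degree P \<le> n \<Longrightarrow> Jnorm p (poly (Dpoly P)) \<le> ennreal ((CB * real n) powr p) * Jnorm p (poly P)" by blast
  have bj: "Jnorm p (poly ((Dpoly ^^ j) P)) \<le> ennreal (((CB * real n) powr p) ^ j) * Jnorm p (poly P)"
    if n: "1 \<le> n" "degree P \<le> n" for n j P
  proof (induction j)
    case (Suc j)
    have "Jnorm p (poly ((Dpoly ^^ Suc j) P)) \<le> ennreal ((CB * real n) powr p) * Jnorm p (poly ((Dpoly ^^ j) P))"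
      using b[OF n(1) order_trans[OF degree_Dpoly_funpow_le n(2)]] by simp
    also have "\<dots> \<le> ennreal ((CB * real n) powr p) * (ennreal (((CB * real n) powr p) ^ j) * Jnorm p (poly P))"
      by (intro mult_left_mono Suc) auto
    finally show ?case by (simp add: ennreal_mult mult.assoc)
  qed simp
  \<comment> \<open>c0 R \<le> 1/4 makes the power series converge at every k h; c0 R CB \<le> 1/4
    leaves, after the weights 2^(j+1), the ratio 1/2 whose p-th power is
    \<open>\<rho>\<close>.\<close>
  define c0 where "c0 = 1 / (4 * R * max CB 1)"
  have c0: "0 < c0" using R by (simp add: c0_def)
  have c0a: "c0 * R \<le> 1 / 4" and c0b: "c0 * R * CB \<le> 1 / 4"
    using R CB by (auto simp: c0_def field_simps)
  define \<rho> where "\<rho> = (1 / 2 :: real) powr p"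
  have rho: "0 < \<rho>" "\<rho> < 1" using p powr_less_mono2[of p "1 / 2" 1] by (auto simp: \<rho>_def)
  define C where "C = (2 * K) powr p / (1 - \<rho>) + 1"
  have C: "0 < C" using rho by (simp add: C_def add_nonneg_pos)
  show ?thesis
  proof (rule exI[of _ c0], intro conjI c0, rule exI[of _ C], intro conjI C allI impI)
    fix n :: nat and T :: "complex poly" and h :: real
    assume n: "1 \<le> n" and deg: "degree T \<le> n" and h: "\<bar>h\<bar> * real n \<le> c0"
    define F where "F = (\<lambda>N z. \<Sum>j<N. c j * of_real h ^ j * poly ((Dpoly ^^ j) T) z)"
    have Fm: "(\<lambda>t. norm (F N (cis t))) \<in> borel_measurable borel" for N
      unfolding F_def by (intro borel_measurable_continuous_onI continuous_intros)
    have small: "(2 * (R * \<bar>h\<bar>)) powr p * (CB * real n) powr p \<le> \<rho>"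
    proof -
      have "2 * (R * \<bar>h\<bar>) * (CB * real n) = 2 * (R * CB) * (\<bar>h\<bar> * real n)" by simp
      also have "\<dots> \<le> 2 * (R * CB) * c0" using R CB h by (intro mult_left_mono) auto
      also have "\<dots> \<le> 1 / 2" using c0b by (simp add: mult_ac)
      finally have "(2 * (R * \<bar>h\<bar>) * (CB * real n)) powr p \<le> \<rho>" unfolding \<rho>_def
        using R CB p by (intro powr_mono2) auto
      thus ?thesis by (simp only: powr_mult)
    qed
    have bound: "Jnorm p (F N) \<le> ennreal C * Jnorm p (poly T)" for N
    proof -
      define a where "a = (\<lambda>j. (2 ^ (j + 1) * (K * R ^ j * \<bar>h\<bar> ^ j)) powr p)"
      have "Jnorm p (F N) \<le> (\<integral>\<^sup>+t. (\<Sum>j<N. ennreal (a j) * ennreal (norm (poly ((Dpoly ^^ j) T) (cis t)) powr p)) \<partial>circ)"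
        unfolding Jnorm_def
      proof (rule nn_integral_mono)
        fix t
        define x where "x = (\<lambda>j. K * R ^ j * \<bar>h\<bar> ^ j * norm (poly ((Dpoly ^^ j) T) (cis t)))"
        have x0: "0 \<le> x j" for j using K R by (simp add: x_def)
        have "norm (F N (cis t)) \<le> (\<Sum>j<N. x j)"
          unfolding F_def x_def
          by (rule order_trans[OF norm_sum]) (auto simp: norm_mult norm_power intro!: sum_mono mult_right_mono c)
        hence "norm (F N (cis t)) powr p \<le> (\<Sum>j<N. x j) powr p" using p by (intro powr_mono2) auto
        also have "\<dots> \<le> (\<Sum>j<N. (2 ^ (j + 1) * x j) powr p)" by (rule powr_sum_dyadic_le[OF x0 p])
        also have "\<dots> = (\<Sum>j<N. a j * norm (poly ((Dpoly ^^ j) T) (cis t)) powr p)"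
          unfolding a_def x_def by (simp add: powr_mult mult.assoc)
        finally have "ennreal (norm (F N (cis t)) powr p) \<le> ennreal (\<Sum>j<N. a j * norm (poly ((Dpoly ^^ j) T) (cis t)) powr p)"
          by (rule ennreal_leI)
        also have "\<dots> = (\<Sum>j<N. ennreal (a j) * ennreal (norm (poly ((Dpoly ^^ j) T) (cis t)) powr p))"
          unfolding a_def by (simp add: sum_ennreal[symmetric] ennreal_mult)
        finally show "ennreal (norm (F N (cis t)) powr p) \<le> (\<Sum>j<N. ennreal (a j) * ennreal (norm (poly ((Dpoly ^^ j) T) (cis t)) powr p))" .
      qed
      also have "\<dots> = (\<Sum>j<N. ennreal (a j) * Jnorm p (poly ((Dpoly ^^ j) T)))"
        unfolding Jnorm_def by (subst nn_integral_sum) (auto simp: nn_integral_cmult)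
      also have "\<dots> \<le> (\<Sum>j<N. ennreal (a j) * (ennreal (((CB * real n) powr p) ^ j) * Jnorm p (poly T)))"
        by (intro sum_mono mult_left_mono bj n deg) auto
      also have "\<dots> = ennreal (\<Sum>j<N. a j * ((CB * real n) powr p) ^ j) * Jnorm p (poly T)"
        unfolding a_def by (simp add: sum_ennreal[symmetric] ennreal_mult sum_distrib_right mult.assoc)
      also have "\<dots> \<le> ennreal C * Jnorm p (poly T)"
      proof (intro mult_right_mono ennreal_leI)
        have "a j * ((CB * real n) powr p) ^ j \<le> (2 * K) powr p * \<rho> ^ j" for j
        proof -
          have "2 ^ (j + 1) * (K * R ^ j * \<bar>h\<bar> ^ j) = (2 * K) * (2 * (R * \<bar>h\<bar>)) ^ j" by (simp add: power_mult_distrib)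
          hence "a j = (2 * K) powr p * ((2 * (R * \<bar>h\<bar>)) powr p) ^ j"
            by (simp only: a_def powr_mult[of "2 * K"] power_powr_commute)
          hence "a j * ((CB * real n) powr p) ^ j = (2 * K) powr p * ((2 * (R * \<bar>h\<bar>)) powr p * (CB * real n) powr p) ^ j"
            by (simp add: power_mult_distrib)
          also have "\<dots> \<le> (2 * K) powr p * \<rho> ^ j" by (intro mult_left_mono power_mono small) auto
          finally show ?thesis .
        qed
        hence "(\<Sum>j<N. a j * ((CB * real n) powr p) ^ j) \<le> (\<Sum>j<N. (2 * K) powr p * \<rho> ^ j)" by (rule sum_mono)
        also have "\<dots> = (2 * K) powr p * (\<Sum>j<N. \<rho> ^ j)" by (simp add: sum_distrib_left)
        also have "(\<Sum>j<N. \<rho> ^ j) \<le> (\<Sum>j. \<rho> ^ j)" using rho by (intro sum_le_suminf summable_geometric) auto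
        also have "(\<Sum>j. \<rho> ^ j) = 1 / (1 - \<rho>)" using rho by (intro suminf_geometric) auto
        finally show "(\<Sum>j<N. a j * ((CB * real n) powr p) ^ j) \<le> C" by (simp add: C_def mult_left_mono)
      qed auto
      finally show ?thesis .
    qed
    have lim: "(\<lambda>N. norm (F N (cis t))) \<longlonglongrightarrow> norm (poly (pmul (\<lambda>k. \<Sum>j. c j * of_real (real k * h) ^ j) T) (cis t))" for t
    proof -
      define z where "z = cis t"
      have s: "(\<lambda>j. c j * of_real (real k * h) ^ j) sums (\<Sum>j. c j * of_real (real k * h) ^ j)" if k: "k \<le> n" for k
      proof (rule summable_sums[OF summable_norm_cancel[OF summable_comparison_test'[where g = "\<lambda>j. K * (1 / 4) ^ j" and N = 0]]])
        show "summable (\<lambda>j. K * (1 / 4) ^ j)" by (intro summable_mult summable_geometric) auto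
        fix j
        have "R * \<bar>real k * h\<bar> \<le> R * (\<bar>h\<bar> * real n)" using R k by (intro mult_left_mono abs_nat_mult_le) auto
        also have "\<dots> \<le> R * c0" using h R by (intro mult_left_mono) auto
        also have "\<dots> \<le> 1 / 4" using c0a by (simp add: mult_ac)
        finally have "(R * \<bar>real k * h\<bar>) ^ j \<le> (1 / 4) ^ j" using R by (intro power_mono) auto
        hence "K * (R * \<bar>real k * h\<bar>) ^ j \<le> K * (1 / 4) ^ j" using K by (intro mult_left_mono) auto
        moreover have "norm (c j * of_real (real k * h) ^ j) \<le> K * R ^ j * \<bar>real k * h\<bar> ^ j"
          unfolding norm_mult norm_power norm_of_real by (intro mult_right_mono c) auto
        ultimately show "norm (norm (c j * of_real (real k * h) ^ j)) \<le> K * (1 / 4) ^ j"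
          by (simp add: power_mult_distrib mult.assoc)
      qed
      have "(\<lambda>j. \<Sum>k\<le>n. coeff T k * z ^ k * (c j * of_real (real k * h) ^ j)) sums
         (\<Sum>k\<le>n. coeff T k * z ^ k * (\<Sum>j. c j * of_real (real k * h) ^ j))"
        by (intro sums_sum sums_mult s) auto
      moreover have "(\<Sum>k\<le>n. coeff T k * z ^ k * (c j * of_real (real k * h) ^ j)) = c j * of_real h ^ j * poly ((Dpoly ^^ j) T) z" for j
        using poly_eq_sum_atMost[OF order_trans[OF degree_Dpoly_funpow_le deg], of j z]
        by (simp add: coeff_Dpoly_funpow sum_distrib_left power_mult_distrib mult_ac)
      moreover have "(\<Sum>k\<le>n. coeff T k * z ^ k * (\<Sum>j. c j * of_real (real k * h) ^ j)) = poly (pmul (\<lambda>k. \<Sum>j. c j * of_real (real k * h) ^ j) T) z"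
        unfolding poly_pmul[OF deg] by (simp add: mult_ac)
      ultimately have "(\<lambda>N. F N z) \<longlonglongrightarrow> poly (pmul (\<lambda>k. \<Sum>j. c j * of_real (real k * h) ^ j) T) z"
        unfolding F_def sums_def by simp
      thus ?thesis unfolding z_def by (rule tendsto_norm)
    qed
    show "Jnorm p (poly (pmul (\<lambda>k. \<Sum>j. c j * of_real (real k * h) ^ j) T)) \<le> ennreal C * Jnorm p (poly T)"
      by (rule Jnorm_limit_le[where f = F and ?n0.0 = 0, OF lim p Fm bound])
  qed
qed

text \<open>Cauchy's estimates on the circle of radius r/2 provide the geometric bound on the Taylor
  coefficients.\<close>

lemma holomorphic_multiplier:
  assumes p: "0 < p" and f: "f holomorphic_on ball 0 r" and r: "0 < r"
  shows "\<exists>c0>0. \<exists>C>0. \<forall>n\<ge>1. \<forall>T h. degree T \<le> n \<longrightarrow> \<bar>h\<bar> * real n \<le> c0 \<longrightarrow>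
    Jnorm p (poly (pmul (\<lambda>k. f (of_real (real k * h))) T)) \<le> ennreal C * Jnorm p (poly T)"
proof -
  define c where "c = (\<lambda>j. (deriv ^^ j) f 0 / fact j)"
  have cont: "continuous_on (cball 0 (r / 2)) f"
    by (rule holomorphic_on_imp_continuous_on[OF holomorphic_on_subset[OF f]]) (use r in auto)
  hence "bounded (f ` cball 0 (r / 2))" by (intro compact_imp_bounded compact_continuous_image) auto
  then obtain K where K: "\<And>z. z \<in> cball 0 (r / 2) \<Longrightarrow> norm (f z) \<le> K" unfolding bounded_iff by blast
  have cb: "norm (c j) \<le> K * (2 / r) ^ j" for j
  proof -
    have "norm ((deriv ^^ j) f 0) \<le> fact j * K / (r / 2) ^ j"
      by (rule Cauchy_inequality[OF holomorphic_on_subset[OF f] cont]) (use r K in auto)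
    thus ?thesis by (simp add: c_def norm_divide power_divide field_simps)
  qed
  have ser: "(\<Sum>j. c j * w ^ j) = f w" if "norm w < r" for w
    using holomorphic_power_series[OF f, of w] that by (simp add: c_def sums_iff)
  have "0 < 2 / r" using r by simp
  from power_series_multiplier[OF p cb this] obtain c0 C where c0: "c0 > 0" and C: "C > 0" and
    m: "\<And>n T h. 1 \<le> n \<Longrightarrow> degree T \<le> n \<Longrightarrow> \<bar>h\<bar> * real n \<le> c0 \<Longrightarrow>
    Jnorm p (poly (pmul (\<lambda>k. \<Sum>j. c j * of_real (real k * h) ^ j) T)) \<le> ennreal C * Jnorm p (poly T)" by blast
  define c1 where "c1 = min c0 (r / 2)"
  have c1: "c1 > 0" using c0 r by (simp add: c1_def)
  show ?thesis
  proof (rule exI[of _ c1], intro conjI c1, rule exI[of _ C], intro conjI C allI impI)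
    fix n :: nat and T :: "complex poly" and h :: real
    assume n: "1 \<le> n" and deg: "degree T \<le> n" and h: "\<bar>h\<bar> * real n \<le> c1"
    have "pmul (\<lambda>k. f (of_real (real k * h))) T = pmul (\<lambda>k. \<Sum>j. c j * of_real (real k * h) ^ j) T"
    proof (rule pmul_cong)
      fix k assume "coeff T k \<noteq> 0"
      hence "k \<le> n" using deg le_degree order_trans by blast
      hence "\<bar>real k * h\<bar> \<le> \<bar>h\<bar> * real n" by (rule abs_nat_mult_le)
      also have "\<dots> < r" using h r by (simp add: c1_def)
      finally have "norm (complex_of_real (real k * h)) < r" by (subst norm_of_real)
      from ser[OF this] show "f (of_real (real k * h)) = (\<Sum>j. c j * of_real (real k * h) ^ j)" by simp
    qed
    thus "Jnorm p (poly (pmul (\<lambda>k. f (of_real (real k * h))) T)) \<le> ennreal C * Jnorm p (poly T)"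
      using m[OF n deg, of h] h by (simp add: c1_def)
  qed
qed

text \<open>The arguments add without a jump: that of i x is plus or minus pi/2, that of w is
  smaller than pi/2 in modulus, so their sum stays inside (-pi, pi).\<close>

lemma powr_mult_imag:
  fixes x :: real and w :: complex
  assumes x: "x \<noteq> 0" and w: "0 < Re w"
  shows "(\<i> * of_real x * w) powr a = (\<i> * of_real x) powr a * w powr a"
proof -
  have w0: "w \<noteq> 0" using w by auto
  have x0: "\<i> * of_real x \<noteq> 0" using x by simp
  have "\<bar>Im (Ln w)\<bar> < pi / 2" by (rule iffD2[OF Re_Ln_pos_lt[OF w0] w])
  moreover have "\<bar>Im (Ln (\<i> * of_real x))\<bar> \<le> pi / 2" by (rule iffD2[OF Re_Ln_pos_le[OF x0]]) simp
  ultimately have "Ln (\<i> * of_real x * w) = Ln (\<i> * of_real x) + Ln w"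
    using w0 x0 by (intro Ln_times_simple) auto
  thus ?thesis using w0 x0 by (simp add: powr_def distrib_left exp_add)
qed

text \<open>1 - e^(-ix) = i x \<phi>(x) with \<phi> entire and \<phi>(0) = 1. Near 0 the two symbols
  are therefore the powers of i x of order \<alpha> and \<alpha> + \<theta>, times nonvanishing
  holomorphic factors; halving x in the second changes only that factor.\<close>

lemma fsym_quotient:
  fixes \<alpha> \<theta> :: real
  shows "\<exists>r>0. \<exists>f. f holomorphic_on ball 0 r \<and> (\<forall>x. x \<noteq> 0 \<longrightarrow> \<bar>x\<bar> < r \<longrightarrow>
     fsym \<alpha> x = (\<i> * of_real x) powr (- of_real \<theta>) * (f (of_real x) * fsym (\<alpha> + \<theta>) (x / 2)))"
proof -
  define g where "g = (\<lambda>z::complex. 1 - exp (- \<i> * z))"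
  define \<phi> where "\<phi> = (\<lambda>z. (if z = 0 then deriv g 0 else (g z - g 0) / (z - 0)) / \<i>)"
  have dg: "deriv g 0 = \<i>" unfolding g_def by (rule DERIV_imp_deriv) (auto intro!: derivative_eq_intros)
  have gh: "g holomorphic_on UNIV" unfolding g_def by (intro holomorphic_intros)
  have ph: "\<phi> holomorphic_on UNIV" unfolding \<phi>_def by (intro holomorphic_intros pole_lemma gh) auto
  have p0: "\<phi> 0 = 1" by (simp add: \<phi>_def dg)
  have peq: "1 - cis (- x) = \<i> * of_real x * \<phi> (of_real x)" for x
    by (auto simp: \<phi>_def g_def cis_conv_exp)
  have "isCont \<phi> 0" using holomorphic_on_imp_continuous_on[OF ph] by (simp add: continuous_on_eq_continuous_at)
  then obtain r where r: "0 < r" "\<And>z. dist z 0 < r \<Longrightarrow> dist (\<phi> z) (\<phi> 0) < 1"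
    unfolding continuous_at_eps_delta by (meson zero_less_one)
  have rep: "0 < Re (\<phi> z)" if "norm z < r" for z
  proof -
    have "norm (\<phi> z - 1) < 1" using r(2)[of z] that by (simp add: dist_norm p0)
    hence "\<bar>Re (\<phi> z - 1)\<bar> < 1" using abs_Re_le_cmod le_less_trans by blast
    thus ?thesis by simp
  qed
  \<comment> \<open>The exponential corrects the phases cis(\<alpha> x) and cis((\<alpha> +
    \<theta>) x/2); the rest is what remains of both powers once i x is taken out. Near 0 all bases
    have positive real part.\<close>
  define f where "f = (\<lambda>z. exp (\<i> * (of_real \<alpha> * z - of_real (\<alpha> + \<theta>) * (z / 2))) * (\<phi> z powr of_real \<alpha>) /
     (\<phi> (z / 2) / 2) powr of_real (\<alpha> + \<theta>))"
  have nz: "\<phi> z \<notin> \<real>\<^sub>\<le>\<^sub>0" "\<phi> (z / 2) / 2 \<notin> \<real>\<^sub>\<le>\<^sub>0" "\<phi> (z / 2) \<noteq> 0" if "norm z < r" for z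
  proof -
    have "norm (z / 2) = norm z / 2" by (simp add: norm_divide)
    hence "norm (z / 2) < r" using that r(1) by linarith
    thus "\<phi> z \<notin> \<real>\<^sub>\<le>\<^sub>0" "\<phi> (z / 2) / 2 \<notin> \<real>\<^sub>\<le>\<^sub>0" "\<phi> (z / 2) \<noteq> 0"
      using rep[OF that] rep[of "z / 2"] by (auto simp: complex_nonpos_Reals_iff)
  qed
  have "f holomorphic_on ball 0 r" unfolding f_def
  proof (intro holomorphic_intros)
    show "\<phi> holomorphic_on ball 0 r" by (rule holomorphic_on_subset[OF ph]) auto
    have "(\<phi> \<circ> (\<lambda>z. z / 2)) holomorphic_on ball 0 r"
      by (intro holomorphic_on_compose holomorphic_intros holomorphic_on_subset[OF ph]) auto
    thus "(\<lambda>z. \<phi> (z / 2)) holomorphic_on ball 0 r" by (simp add: o_def)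
  qed (use nz in \<open>auto simp: powr_def\<close>)
  moreover have "fsym \<alpha> x = (\<i> * of_real x) powr (- of_real \<theta>) * (f (of_real x) * fsym (\<alpha> + \<theta>) (x / 2))"
    if x: "x \<noteq> 0" "\<bar>x\<bar> < r" for x
  proof -
    define z where "z = complex_of_real x"
    have zr: "norm z < r" using x by (simp add: z_def)
    have 1: "(1 - cis (- x)) powr of_real \<alpha> = (\<i> * z) powr of_real \<alpha> * \<phi> z powr of_real \<alpha>"
      unfolding peq z_def by (intro powr_mult_imag x rep) (use x in auto)
    have e: "1 - cis (- (x / 2)) = \<i> * of_real x * (\<phi> (z / 2) / 2)"
      unfolding peq z_def by simp
    have "norm (z / 2) = norm z / 2" by (simp add: norm_divide)
    hence "norm (z / 2) < r" using zr r(1) by linarith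
    hence pos: "0 < Re (\<phi> (z / 2) / 2)" using rep[of "z / 2"] by simp
    have 2: "(1 - cis (- (x / 2))) powr of_real (\<alpha> + \<theta>) = (\<i> * z) powr of_real (\<alpha> + \<theta>) * (\<phi> (z / 2) / 2) powr of_real (\<alpha> + \<theta>)"
      using powr_mult_imag[OF x(1) pos, of "of_real (\<alpha> + \<theta>)"] unfolding e by (simp only: z_def)
    have iz: "\<i> * z \<noteq> 0" using x by (simp add: z_def)
    have 3: "(\<i> * z) powr (- of_real \<theta>) * (\<i> * z) powr of_real (\<alpha> + \<theta>) = (\<i> * z) powr of_real \<alpha>"
      using iz by (simp add: powr_add[symmetric])
    have 4: "exp (\<i> * (of_real \<alpha> * z - of_real (\<alpha> + \<theta>) * (z / 2))) * cis ((\<alpha> + \<theta>) * (x / 2)) = cis (\<alpha> * x)"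
      unfolding cis_conv_exp z_def exp_add[symmetric] by (simp add: algebra_simps)
    have 5: "(\<phi> (z / 2) / 2) powr of_real (\<alpha> + \<theta>) \<noteq> 0" using nz(3)[OF zr] by (simp add: powr_def)
    have "(\<i> * z) powr (- of_real \<theta>) * (f z * fsym (\<alpha> + \<theta>) (x / 2)) =
       (exp (\<i> * (of_real \<alpha> * z - of_real (\<alpha> + \<theta>) * (z / 2))) * cis ((\<alpha> + \<theta>) * (x / 2))) *
       ((\<i> * z) powr (- of_real \<theta>) * (\<i> * z) powr of_real (\<alpha> + \<theta>)) * \<phi> z powr of_real \<alpha>"
      unfolding fsym_def 2 f_def using 5 by (simp add: field_simps del: of_real_add)
    also have "\<dots> = fsym \<alpha> x" unfolding 3 4 fsym_def 1 by (simp add: mult_ac)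
    finally show ?thesis by (simp add: z_def)
  qed
  ultimately show ?thesis using r(1) by blast
qed

text \<open>The multiplier factors into the difference of order \<alpha> + \<theta> with step h/2, a
  bounded holomorphic multiplier and (i k h)^(-\<theta>). The last splits into (i h)^(-\<theta>),
  whose modulus is |h|^(-\<theta>), and the fractional integral k^(-\<theta>), which alone raises
  the exponent from p to q.\<close>

theorem fdiff_low_frequency:
  fixes p q \<alpha> \<theta> :: real
  assumes p: "0 < p" "p < q" and th: "\<theta> = 1 / p - 1 / q" and al: "0 < \<alpha>"
  shows "\<exists>c>0. \<exists>C>0. \<forall>n\<ge>1. \<forall>T h A. degree T \<le> n \<longrightarrow> h \<noteq> 0 \<longrightarrow> \<bar>h\<bar> * real n \<le> c \<longrightarrow> 0 \<le> A \<longrightarrow>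
    Jnorm p (poly (fdiff (\<alpha> + \<theta>) (h / 2) T)) \<le> ennreal (A powr p) \<longrightarrow>
    Jnorm q (poly (fdiff \<alpha> h T)) \<le> ennreal ((C * (\<bar>h\<bar> powr (- \<theta>) * A)) powr q)"
proof -
  have thp: "0 < \<theta>" unfolding th using p by (simp add: frac_less2)
  have q: "0 < q" using p by simp
  obtain r f where r: "0 < r" and f: "f holomorphic_on ball 0 r" and
    eq: "\<And>x. x \<noteq> 0 \<Longrightarrow> \<bar>x\<bar> < r \<Longrightarrow> fsym \<alpha> x = (\<i> * of_real x) powr (- of_real \<theta>) * (f (of_real x) * fsym (\<alpha> + \<theta>) (x / 2))"
    using fsym_quotient[of \<alpha> \<theta>] by blast
  obtain c0 C1 where c0: "c0 > 0" and C1: "C1 > 0" and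
    m: "\<And>n T h. 1 \<le> n \<Longrightarrow> degree T \<le> n \<Longrightarrow> \<bar>h\<bar> * real n \<le> c0 \<Longrightarrow>
    Jnorm p (poly (pmul (\<lambda>k. f (of_real (real k * h))) T)) \<le> ennreal C1 * Jnorm p (poly T)"
    using holomorphic_multiplier[OF p(1) f r] by blast
  from hardy_littlewood[OF p th] obtain C2 where C2: "C2 > 0" and
    hl: "\<And>T A. coeff T 0 = 0 \<Longrightarrow> 0 \<le> A \<Longrightarrow> Jnorm p (poly T) \<le> ennreal (A powr p) \<Longrightarrow>
     Jnorm q (poly (fracint \<theta> T)) \<le> ennreal ((C2 * A) powr q)" by blast
  define c where "c = min c0 (r / 2)"
  have c: "c > 0" using c0 r by (simp add: c_def)
  define C where "C = C2 * C1 powr (1 / p)"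
  have C: "C > 0" using C1 C2 by (simp add: C_def)
  show ?thesis
  proof (rule exI[of _ c], intro conjI c, rule exI[of _ C], intro conjI C allI impI)
    fix n :: nat and T :: "complex poly" and h A :: real
    assume n: "1 \<le> n" and deg: "degree T \<le> n" and h: "h \<noteq> 0" "\<bar>h\<bar> * real n \<le> c" and A: "0 \<le> A"
      and J: "Jnorm p (poly (fdiff (\<alpha> + \<theta>) (h / 2) T)) \<le> ennreal (A powr p)"
    define S where "S = fdiff (\<alpha> + \<theta>) (h / 2) T"
    define U where "U = pmul (\<lambda>k. f (of_real (real k * h))) S"
    define w where "w = (\<i> * of_real h) powr (- complex_of_real \<theta>)"
    have degS: "degree S \<le> n" unfolding S_def fdiff_def using degree_pmul_le deg order_trans by blast
    have U0: "coeff U 0 = 0" unfolding U_def S_def fdiff_def using al thp by simp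
    have JU: "Jnorm p (poly U) \<le> ennreal ((C1 powr (1 / p) * A) powr p)"
    proof -
      have "Jnorm p (poly U) \<le> ennreal C1 * Jnorm p (poly S)"
        unfolding U_def by (rule m[OF n degS]) (use h in \<open>auto simp: c_def\<close>)
      also have "\<dots> \<le> ennreal C1 * ennreal (A powr p)" using J unfolding S_def by (intro mult_left_mono) auto
      also have "\<dots> = ennreal ((C1 powr (1 / p) * A) powr p)"
        using C1 A p by (simp add: powr_mult powr_powr ennreal_mult)
      finally show ?thesis .
    qed
    have rep: "fdiff \<alpha> h T = smult w (fracint \<theta> U)"
    proof (rule poly_eqI)
      fix k
      show "coeff (fdiff \<alpha> h T) k = coeff (smult w (fracint \<theta> U)) k"
      proof (cases "k = 0 \<or> coeff T k = 0")
        case True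
        thus ?thesis using al by (auto simp: fdiff_def fracint_def U_def S_def)
      next
        case False
        hence k: "0 < k" "k \<le> n" using deg le_degree order_trans by blast+
        have kh: "real k * h \<noteq> 0" using k h by simp
        have "\<bar>real k * h\<bar> \<le> \<bar>h\<bar> * real n" by (rule abs_nat_mult_le[OF k(2)])
        also have "\<dots> < r" using h r by (simp add: c_def)
        finally have "fsym \<alpha> (real k * h) = (\<i> * of_real (real k * h)) powr (- of_real \<theta>) * (f (of_real (real k * h)) * fsym (\<alpha> + \<theta>) (real k * h / 2))"
          by (intro eq kh)
        also have "(\<i> * of_real (real k * h)) powr (- complex_of_real \<theta>) = w * of_real (real k powr (- \<theta>))"
        proof -
          have "(\<i> * of_real h * of_real (real k)) powr (- complex_of_real \<theta>) = w * of_real (real k) powr (- complex_of_real \<theta>)"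
            unfolding w_def by (rule powr_mult_imag) (use h k in auto)
          also have "of_real (real k) powr (- complex_of_real \<theta>) = of_real (real k powr (- \<theta>))"
            using powr_of_real[of "real k" "- \<theta>"] by simp
          finally show ?thesis by (simp add: mult_ac)
        qed
        finally show ?thesis by (simp add: fdiff_def fracint_def U_def S_def mult_ac)
      qed
    qed
    have nw: "norm w = \<bar>h\<bar> powr (- \<theta>)" unfolding w_def
      by (subst norm_powr_real_powr') (auto simp: norm_mult)
    have "Jnorm q (poly (fdiff \<alpha> h T)) = ennreal ((\<bar>h\<bar> powr (- \<theta>)) powr q) * Jnorm q (poly (fracint \<theta> U))"
      unfolding rep Jnorm_smult[OF q] nw ..
    also have "\<dots> \<le> ennreal ((\<bar>h\<bar> powr (- \<theta>)) powr q) * ennreal ((C2 * (C1 powr (1 / p) * A)) powr q)"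
      by (intro mult_left_mono hl U0 JU) (use C1 A in auto)
    also have "\<dots> = ennreal ((C * (\<bar>h\<bar> powr (- \<theta>) * A)) powr q)"
      using C1 C2 A by (simp add: C_def ennreal_mult'[symmetric] powr_mult mult_ac)
    finally show "Jnorm q (poly (fdiff \<alpha> h T)) \<le> ennreal ((C * (\<bar>h\<bar> powr (- \<theta>) * A)) powr q)" .
  qed
qed

subsection \<open>Summation of dyadic blocks\<close>

text \<open>Since \<open>u\<close> grows geometrically, the terms are summed from the crossing point \<open>u = 1\<close> in both
  directions; the induction tracks the partial sums by \<open>K u\<close> before and by \<open>const - K2 u powr (-a)\<close> after it.\<close>

lemma geometric_min_sum_le:
  fixes u m :: "nat \<Rightarrow> real" and l a :: real
  assumes l: "1 < l" and a: "0 < a" and u: "\<And>j. 0 \<le> u j" "\<And>j. l * u j \<le> u (Suc j)"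
    and m: "\<And>j. m j \<le> u j" "\<And>j. 1 < u j \<Longrightarrow> m j \<le> u j powr (- a)" 
  shows "(\<Sum>j<N. m j) \<le> l / (l - 1) + 1 + 1 / (l powr a - 1)"
proof -
  \<comment> \<open>Fixed points of the two recursions: K/l + 1 = K while u \<le> 1, and K2 l^a = K2
    + 1 afterwards.\<close>
  define K where "K = l / (l - 1)"
  define K2 where "K2 = 1 / (l powr a - 1)"
  have la: "1 < l powr a" using l a by (simp add: gr_one_powr)
  have K: "0 < K" "K / l + 1 = K" using l by (auto simp: K_def field_simps)
  have K2: "0 < K2" "K2 * l powr a = K2 + 1" using la by (auto simp: K2_def field_simps)
  have inv: "(\<Sum>j<Suc N. m j) \<le> (if u N \<le> 1 then K * u N else K + 1 + K2 - K2 * u N powr (- a))" for N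
  proof (induction N)
    case 0
    show ?case
    proof (cases "u 0 \<le> 1")
      case True
      have "1 \<le> K" using l by (simp add: K_def)
      hence "1 * u 0 \<le> K * u 0" using u(1) by (intro mult_right_mono) auto
      thus ?thesis using True m(1)[of 0] by simp
    next
      case False
      hence "u 0 powr (- a) \<le> 1" using a by (simp add: powr_minus_divide divide_le_eq_1 ge_one_powr_ge_zero)
      hence "(1 + K2) * u 0 powr (- a) \<le> (1 + K2) * 1" using K2 by (intro mult_left_mono) auto
      thus ?thesis using False m(2)[of 0] K(1) by (simp add: algebra_simps)
    qed
  next
    case (Suc N)
    show ?case
    proof (cases "u (Suc N) \<le> 1")
      case True
      have "1 * u N \<le> l * u N" using l u by (intro mult_right_mono) auto
      hence uN: "u N \<le> 1" using u(2)[of N] True by simp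
      have "K * u N \<le> K * (u (Suc N) / l)" using u(2)[of N] l K(1) by (intro mult_left_mono) (auto simp: field_simps)
      hence "(\<Sum>j<Suc (Suc N). m j) \<le> K * (u (Suc N) / l) + u (Suc N)" using Suc uN m(1)[of "Suc N"] by simp
      also have "\<dots> = (K / l + 1) * u (Suc N)" by (simp add: algebra_simps)
      finally show ?thesis using True K by simp
    next
      case False
      hence u1: "1 < u (Suc N)" by simp
      have p1: "u (Suc N) powr (- a) \<le> 1"
        using u1 a by (simp add: powr_minus_divide divide_le_eq_1 ge_one_powr_ge_zero)
      show ?thesis
      proof (cases "u N \<le> 1")
        case True
        have "K * u N \<le> K * 1" using True K by (intro mult_left_mono) auto
        moreover have "(1 + K2) * u (Suc N) powr (- a) \<le> (1 + K2) * 1" using K2 p1 by (intro mult_left_mono) auto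
        ultimately show ?thesis using Suc True False m(2)[OF u1] by (simp add: algebra_simps)
      next
        case uN: False
        have "u (Suc N) powr (- a) \<le> (l * u N) powr (- a)"
          using u(2)[of N] uN l a by (intro powr_mono2') auto
        also have "\<dots> = u N powr (- a) / l powr a" using l uN by (simp add: powr_mult powr_minus_divide)
        finally have "u (Suc N) powr (- a) * l powr a \<le> u N powr (- a)"
          using less_trans[OF zero_less_one la] by (simp only: pos_le_divide_eq)
        hence "K2 * (u (Suc N) powr (- a) * l powr a) \<le> K2 * u N powr (- a)" using K2 by (intro mult_left_mono) auto
        moreover have "K2 * (u (Suc N) powr (- a) * l powr a) = (K2 + 1) * u (Suc N) powr (- a)"
          by (simp add: K2(2)[symmetric])
        ultimately show ?thesis using Suc uN False m(2)[OF u1] by (simp add: algebra_simps)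
      qed
    qed
  qed
  show ?thesis
  proof (cases N)
    case 0
    thus ?thesis using K K2 unfolding K_def[symmetric] K2_def[symmetric] by simp
  next
    case (Suc M)
    have "(if u M \<le> 1 then K * u M else K + 1 + K2 - K2 * u M powr (- a)) \<le> K + 1 + K2"
    proof (cases "u M \<le> 1")
      case True
      have "K * u M \<le> K * 1" using True K by (intro mult_left_mono) auto
      thus ?thesis using True K2 by simp
    next
      case False
      have "0 \<le> K2 * u M powr (- a)" using K2 by simp
      thus ?thesis using False by simp
    qed
    from order_trans[OF inv[of M] this] show ?thesis unfolding Suc K_def K2_def .
  qed
qed

text \<open>Let R be the sum on the right and \<rho> = R^(1/q). Every single term gives x_j^p
  Y_j^(q-p) \<le> \<rho>^q, that is x_j/\<rho> \<le> (Y_j/\<rho>)^(-a) with a = (q - p)/p. Together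
  with x_j \<le> Y_j this is the setting of \<open>geometric_min_sum_le\<close> for u = Y/\<rho>, so
  the sum of the x_j is at most D \<rho>.\<close>

lemma geometric_majorant_sum:
  fixes p q l :: real
  assumes p: "0 < p" "p < q" and l: "1 < l"
  shows "\<exists>C>0. \<forall>x Y :: nat \<Rightarrow> real. (\<forall>j. 0 \<le> x j \<and> x j \<le> Y j \<and> l * Y j \<le> Y (Suc j)) \<longrightarrow>
     (\<forall>N. (\<Sum>j<N. x j) powr q \<le> C * (\<Sum>j<N. x j powr p * Y j powr (q - p)))"
proof -
  define a where "a = (q - p) / p"
  have a: "0 < a" using p by (simp add: a_def)
  have q: "0 < q" using p by simp
  define D where "D = l / (l - 1) + 1 + 1 / (l powr a - 1)"
  have la: "1 < l powr a" using l a by (simp add: gr_one_powr)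
  have D: "0 < D" unfolding D_def using l la by (intro add_pos_pos) auto
  show ?thesis
  proof (intro exI[of _ "D powr q"] conjI allI impI)
    fix x Y :: "nat \<Rightarrow> real" and N
    assume *: "\<forall>j. 0 \<le> x j \<and> x j \<le> Y j \<and> l * Y j \<le> Y (Suc j)"
    hence x: "0 \<le> x j" "x j \<le> Y j" and Y: "l * Y j \<le> Y (Suc j)" "0 \<le> Y j" for j using order_trans by blast+
    define R where "R = (\<Sum>j<N. x j powr p * Y j powr (q - p))"
    show "(\<Sum>j<N. x j) powr q \<le> D powr q * (\<Sum>j<N. x j powr p * Y j powr (q - p))"
    proof (cases "R = 0")
      case True
      hence "x j powr p * Y j powr (q - p) = 0" if "j < N" for j
        using that unfolding R_def by (subst (asm) sum_nonneg_eq_0_iff) auto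
      hence "x j = 0" if "j < N" for j using that x[of j] by fastforce
      thus ?thesis by simp
    next
      case False
      have R: "0 < R" using False by (simp add: R_def sum_nonneg less_le)
      define \<rho> where "\<rho> = R powr (1 / q)"
      have rho: "0 < \<rho>" using R by (simp add: \<rho>_def)
      have rq: "\<rho> powr q = R" using R q by (simp add: \<rho>_def powr_powr)
      define m where "m = (\<lambda>j. if j < N then x j / \<rho> else 0)"
      have "(\<Sum>j<N. m j) \<le> l / (l - 1) + 1 + 1 / (l powr a - 1)"
      proof (rule geometric_min_sum_le[OF l a, where u = "\<lambda>j. Y j / \<rho>"])
        fix j
        show "0 \<le> Y j / \<rho>" using Y rho by simp
        show "l * (Y j / \<rho>) \<le> Y (Suc j) / \<rho>" using Y rho by (simp add: divide_right_mono)
        show "m j \<le> Y j / \<rho>" using x[of j] Y[of j] rho by (auto simp: m_def divide_right_mono)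
        assume "1 < Y j / \<rho>"
        hence Yj: "0 < Y j" using rho by (simp add: field_simps)
        show "m j \<le> (Y j / \<rho>) powr (- a)"
        proof (cases "j < N")
          case True
          have "x j powr p * Y j powr (q - p) \<le> R" unfolding R_def
            by (rule member_le_sum) (use True in auto)
          hence "x j powr p \<le> \<rho> powr q / Y j powr (q - p)" using Yj by (simp add: rq field_simps)
          hence "(x j powr p) powr (1 / p) \<le> (\<rho> powr q / Y j powr (q - p)) powr (1 / p)"
            using p by (intro powr_mono2) auto
          hence "x j \<le> \<rho> powr (q / p) / Y j powr a"
            using p x[of j] by (simp add: powr_powr powr_divide a_def)
          also have "\<rho> powr (q / p) = \<rho> * \<rho> powr a"
          proof -
            have "q / p = 1 + a" using p by (simp add: a_def field_simps)
            thus ?thesis using rho by (simp add: powr_add)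
          qed
          also have "\<rho> * \<rho> powr a / Y j powr a = \<rho> * (Y j / \<rho>) powr (- a)"
            using Yj rho by (simp add: powr_divide powr_minus_divide)
          finally show ?thesis using True rho by (simp add: m_def field_simps)
        qed (simp add: m_def)
      qed
      moreover have "(\<Sum>j<N. m j) = (\<Sum>j<N. x j) / \<rho>" by (simp add: m_def sum_divide_distrib)
      ultimately have "(\<Sum>j<N. x j) \<le> D * \<rho>" using rho by (simp add: D_def field_simps)
      hence "(\<Sum>j<N. x j) powr q \<le> (D * \<rho>) powr q" using x q by (intro powr_mono2 sum_nonneg) auto
      also have "\<dots> = D powr q * R" using D rho by (simp add: powr_mult rq)
      finally show ?thesis by (simp add: R_def)
    qed
  qed (use D in auto)
qed

text \<open>Nikolskii bounds block l uniformly by a multiple of 2^(l/p) b_l, but these bounds need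
  not grow geometrically. They are enlarged to Y_l, with Y_l^q proportional to 2^l W_l and W the
  convolution of the numbers \<beta>_l^q with powers of s. This forces growth at a fixed rate, while
  the sum of the W_l stays comparable to that of the \<beta>_l^q.\<close>

theorem block_sum:
  fixes p q \<theta> B :: real
  assumes p: "0 < p" "p < q" and th: "\<theta> = 1 / p - 1 / q" and B: "0 < B"
  shows "\<exists>C>0. \<forall>(g :: nat \<Rightarrow> complex poly) b N.
    (\<forall>l. degree (g l) \<le> B * 2 ^ l \<and> 0 \<le> b l \<and> Jnorm p (poly (g l)) \<le> ennreal (b l powr p)) \<longrightarrow>
    Jnorm q (poly (\<Sum>l<N. g l)) \<le> ennreal (C * (\<Sum>l<N. (2 powr (real l * \<theta>) * b l) powr q))"
proof -
  have q: "0 < q" using p by simp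
  from nikolskii[OF p(1)] obtain CN where CN: "CN > 0" and
    nik: "\<And>n P z. 1 \<le> n \<Longrightarrow> degree P \<le> n \<Longrightarrow> norm z = 1 \<Longrightarrow>
     ennreal (norm (poly P z) powr p) \<le> ennreal (CN * real n) * Jnorm p (poly P)" by blast
  define l0 where "l0 = sqrt 2 powr (1 / q)"
  have l0: "1 < l0" unfolding l0_def using q by (simp add: gr_one_powr)
  from geometric_majorant_sum[OF p l0] obtain C0 where C0: "C0 > 0" and
    maj: "\<And>x Y N. (\<forall>j. 0 \<le> x j \<and> x j \<le> Y j \<and> l0 * Y j \<le> Y (Suc j)) \<Longrightarrow>
     (\<Sum>j<N. x j) powr q \<le> C0 * (\<Sum>j<N. x j powr p * Y j powr (q - p))" by blast
  define \<kappa> where "\<kappa> = (CN * (B + 1)) powr (1 / p)"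
  have kp: "0 < \<kappa>" using CN B by (simp add: \<kappa>_def)
  \<comment> \<open>Between 1/2 and 1: s < 1 makes the convolution summable, and 2 s = sqrt 2 > 1 is
    the growth rate of 2^l W_l, recorded as \<open>l0\<close> for Y.\<close>
  define s where "s = 1 / sqrt (2::real)"
  have s: "0 < s" "s < 1" by (auto simp: s_def real_less_rsqrt)
  define C where "C = C0 * \<kappa> powr (q - p) * (1 / (1 - s))"
  have C: "0 < C" using C0 kp s by (simp add: C_def)
  show ?thesis
  proof (intro exI[of _ C] conjI C allI impI)
    fix g :: "nat \<Rightarrow> complex poly" and b :: "nat \<Rightarrow> real" and N
    assume *: "\<forall>l. degree (g l) \<le> B * 2 ^ l \<and> 0 \<le> b l \<and> Jnorm p (poly (g l)) \<le> ennreal (b l powr p)"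
    have deg: "degree (g l) \<le> B * 2 ^ l" and b: "0 \<le> b l" and J: "Jnorm p (poly (g l)) \<le> ennreal (b l powr p)" for l
      using * by auto
    define \<beta> where "\<beta> = (\<lambda>l. 2 powr (real l * \<theta>) * b l)"
    have beta: "0 \<le> \<beta> l" for l using b by (simp add: \<beta>_def)
    define W where "W = (\<lambda>l. \<Sum>m\<le>l. s ^ (l - m) * \<beta> m powr q)"
    have W0: "0 \<le> W l" for l unfolding W_def using s by (intro sum_nonneg) auto
    have Wb: "\<beta> l powr q \<le> W l" for l
    proof -
      have "s ^ (l - l) * \<beta> l powr q \<le> W l" unfolding W_def
        by (rule member_le_sum) (use s in auto)
      thus ?thesis by simp
    qed
    have WS: "s * W l \<le> W (Suc l)" for l
    proof -
      have "s * W l = (\<Sum>m\<le>l. s ^ (Suc l - m) * \<beta> m powr q)"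
        unfolding W_def sum_distrib_left by (intro sum.cong refl) (simp add: Suc_diff_le mult.assoc)
      also have "\<dots> \<le> W (Suc l)" unfolding W_def by (intro sum_mono2) (use s in auto)
      finally show ?thesis .
    qed
    define Y where "Y = (\<lambda>l. \<kappa> * 2 powr (real l / q) * W l powr (1 / q))"
    have sup: "norm (poly (g l) z) \<le> \<kappa> * 2 powr (real l / p) * b l" if z: "norm z = 1" for l z
    proof -
      define n where "n = nat \<lceil>B * 2 ^ l\<rceil>"
      have Bl: "0 < B * 2 ^ l" using B by simp
      have n: "1 \<le> n" using Bl unfolding n_def by linarith
      have dn: "degree (g l) \<le> n" using deg[of l] unfolding n_def by linarith
      have nB: "real n \<le> (B + 1) * 2 ^ l"
      proof -
        have "real n \<le> B * 2 ^ l + 1" using Bl unfolding n_def by linarith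
        also have "\<dots> \<le> B * 2 ^ l + 2 ^ l" by simp
        finally show ?thesis by (simp add: algebra_simps)
      qed
      have "ennreal (norm (poly (g l) z) powr p) \<le> ennreal (CN * real n) * Jnorm p (poly (g l))" by (rule nik[OF n dn z])
      also have "\<dots> \<le> ennreal (CN * ((B + 1) * 2 ^ l)) * ennreal (b l powr p)"
        using CN nB by (intro mult_mono ennreal_leI J mult_left_mono) auto
      also have "\<dots> = ennreal (CN * ((B + 1) * 2 ^ l) * b l powr p)" by (rule ennreal_mult''[symmetric]) simp
      finally have "norm (poly (g l) z) powr p \<le> CN * ((B + 1) * 2 ^ l) * b l powr p"
        using CN B by (subst (asm) ennreal_le_iff) auto
      hence "(norm (poly (g l) z) powr p) powr (1 / p) \<le> (CN * (B + 1) * 2 powr (real l) * b l powr p) powr (1 / p)"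
        using p by (intro powr_mono2) (auto simp: powr_realpow mult.assoc)
      also have "\<dots> = \<kappa> * 2 powr (real l / p) * b l"
        using b[of l] p by (simp add: \<kappa>_def powr_mult[of "CN * (B + 1) * 2 powr real l"] powr_mult[of "CN * (B + 1)"] powr_powr)
      finally show ?thesis using p by (simp add: powr_powr)
    qed
    have e1: "2 powr (real l / p) * b l = 2 powr (real l / q) * \<beta> l" for l
      unfolding \<beta>_def mult.assoc[symmetric] powr_add[symmetric] by (simp add: th algebra_simps)
    have YB: "\<kappa> * 2 powr (real l / p) * b l \<le> Y l" for l
    proof -
      have "\<beta> l = (\<beta> l powr q) powr (1 / q)" using beta[of l] q by (simp add: powr_powr)
      also have "\<dots> \<le> W l powr (1 / q)" using Wb[of l] q by (intro powr_mono2) auto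
      finally have "\<kappa> * 2 powr (real l / q) * \<beta> l \<le> Y l" unfolding Y_def using kp by (intro mult_left_mono) auto
      thus ?thesis by (simp add: mult.assoc e1)
    qed
    have Y0: "0 \<le> Y l" for l using kp by (simp add: Y_def)
    have Ygrow: "l0 * Y l \<le> Y (Suc l)" for l
    proof -
      have "l0 * Y l = \<kappa> * 2 powr (real l / q) * (sqrt 2 powr (1 / q) * W l powr (1 / q))" by (simp add: Y_def l0_def)
      also have "sqrt 2 powr (1 / q) * W l powr (1 / q) = (2 * (s * W l)) powr (1 / q)"
      proof -
        have "2 * s = sqrt 2" by (simp add: s_def real_div_sqrt)
        hence "2 * (s * W l) = sqrt 2 * W l" by simp
        thus ?thesis by (simp only: powr_mult)
      qed
      also have "\<dots> \<le> (2 * W (Suc l)) powr (1 / q)"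
        using WS[of l] s W0[of l] q by (intro powr_mono2) auto
      also have "\<dots> = 2 powr (1 / q) * W (Suc l) powr (1 / q)" by (rule powr_mult)
      finally have "l0 * Y l \<le> \<kappa> * (2 powr (real l / q) * 2 powr (1 / q)) * W (Suc l) powr (1 / q)"
        using kp by (simp add: mult_left_mono mult.assoc)
      also have "2 powr (real l / q) * 2 powr (1 / q) = 2 powr (real (Suc l) / q)"
        by (simp add: powr_add[symmetric] add_divide_distrib add.commute)
      finally show ?thesis by (simp add: Y_def)
    qed
    have "Jnorm q (poly (\<Sum>l<N. g l)) \<le> (\<integral>\<^sup>+t. (\<Sum>l<N. ennreal (C0 * Y l powr (q - p)) * ennreal (norm (poly (g l) (cis t)) powr p)) \<partial>circ)"
      unfolding Jnorm_def
    proof (rule nn_integral_mono)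
      fix t
      have "norm (poly (\<Sum>l<N. g l) (cis t)) \<le> (\<Sum>l<N. norm (poly (g l) (cis t)))"
        unfolding poly_sum by (rule norm_sum)
      hence "norm (poly (\<Sum>l<N. g l) (cis t)) powr q \<le> (\<Sum>l<N. norm (poly (g l) (cis t))) powr q"
        using q by (intro powr_mono2) auto
      also have "\<dots> \<le> C0 * (\<Sum>l<N. norm (poly (g l) (cis t)) powr p * Y l powr (q - p))"
      proof (rule maj, intro allI conjI)
        fix j
        show "norm (poly (g j) (cis t)) \<le> Y j" using order_trans[OF sup YB, of "cis t" j] by simp
      qed (use Ygrow in auto)
      also have "\<dots> = (\<Sum>l<N. (C0 * Y l powr (q - p)) * norm (poly (g l) (cis t)) powr p)"
        by (simp add: sum_distrib_left mult_ac)
      finally have "ennreal (norm (poly (\<Sum>l<N. g l) (cis t)) powr q) \<le> ennreal (\<Sum>l<N. (C0 * Y l powr (q - p)) * norm (poly (g l) (cis t)) powr p)"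
        by (rule ennreal_leI)
      also have "\<dots> = (\<Sum>l<N. ennreal (C0 * Y l powr (q - p)) * ennreal (norm (poly (g l) (cis t)) powr p))"
        using C0 by (simp add: sum_ennreal[symmetric] ennreal_mult)
      finally show "ennreal (norm (poly (\<Sum>l<N. g l) (cis t)) powr q) \<le> (\<Sum>l<N. ennreal (C0 * Y l powr (q - p)) * ennreal (norm (poly (g l) (cis t)) powr p))" .
    qed
    also have "\<dots> = (\<Sum>l<N. ennreal (C0 * Y l powr (q - p)) * Jnorm p (poly (g l)))"
      unfolding Jnorm_def by (subst nn_integral_sum) (auto simp: nn_integral_cmult)
    also have "\<dots> \<le> (\<Sum>l<N. ennreal (C0 * Y l powr (q - p)) * ennreal (b l powr p))"
      by (intro sum_mono mult_left_mono J) auto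
    also have "\<dots> = ennreal (\<Sum>l<N. C0 * Y l powr (q - p) * b l powr p)"
      using C0 by (simp add: sum_ennreal[symmetric] ennreal_mult)
    also have "\<dots> \<le> ennreal (C * (\<Sum>l<N. \<beta> l powr q))"
    proof (rule ennreal_leI)
      have "Y l powr (q - p) * b l powr p \<le> \<kappa> powr (q - p) * W l" for l
      proof -
        have "\<kappa> * (2 powr (real l / p) * b l) \<le> Y l" using YB[of l] by (simp add: mult.assoc)
        hence "b l \<le> Y l / (\<kappa> * 2 powr (real l / p))" using kp by (simp add: field_simps)
        hence "b l powr p \<le> (Y l / (\<kappa> * 2 powr (real l / p))) powr p" using b p by (intro powr_mono2) auto
        also have "\<dots> = Y l powr p / (\<kappa> powr p * 2 powr real l)"
          using p by (simp add: powr_divide powr_mult powr_powr)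
        finally have "Y l powr (q - p) * b l powr p \<le> Y l powr (q - p) * (Y l powr p / (\<kappa> powr p * 2 powr real l))"
          by (rule mult_left_mono) simp
        also have "\<dots> = Y l powr q / (\<kappa> powr p * 2 powr real l)" by (simp add: powr_add[symmetric])
        also have "Y l powr q = \<kappa> powr q * 2 powr real l * W l"
          using q W0[of l] by (simp add: Y_def powr_mult powr_powr)
        also have "\<kappa> powr q * 2 powr real l * W l / (\<kappa> powr p * 2 powr real l) = \<kappa> powr (q - p) * W l"
          using kp by (simp add: powr_diff)
        finally show ?thesis .
      qed
      hence "(\<Sum>l<N. C0 * Y l powr (q - p) * b l powr p) \<le> (\<Sum>l<N. C0 * (\<kappa> powr (q - p) * W l))"
        unfolding mult.assoc using C0 by (intro sum_mono mult_left_mono) auto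
      also have "\<dots> = C0 * \<kappa> powr (q - p) * (\<Sum>l<N. W l)" by (simp add: sum_distrib_left mult.assoc)
      also have "(\<Sum>l<N. W l) \<le> 1 / (1 - s) * (\<Sum>l<N. \<beta> l powr q)"
      proof -
        \<comment> \<open>The second summand is what the indices below N will still contribute to
          later W_l. With it included, the induction balances at every step.\<close>
        have "(\<Sum>l<N. W l) + s / (1 - s) * (if N = 0 then 0 else W (N - 1)) \<le> 1 / (1 - s) * (\<Sum>l<N. \<beta> l powr q)"
        proof (induction N)
          case (Suc N)
          have W: "W N = \<beta> N powr q + s * (if N = 0 then 0 else W (N - 1))"
          proof (cases N)
            case (Suc M)
            have "s * W M = (\<Sum>m\<le>M. s ^ (N - m) * \<beta> m powr q)"
              unfolding W_def sum_distrib_left Suc by (intro sum.cong refl) (simp add: Suc_diff_le mult.assoc)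
            thus ?thesis using Suc by (simp add: W_def)
          qed (simp add: W_def)
          have i: "1 + s / (1 - s) = 1 / (1 - s)" using s by (simp add: field_simps)
          have "(\<Sum>l<Suc N. W l) + s / (1 - s) * W N = (\<Sum>l<N. W l) + (1 + s / (1 - s)) * W N"
            by (simp add: algebra_simps)
          also have "\<dots> = ((\<Sum>l<N. W l) + s / (1 - s) * (if N = 0 then 0 else W (N - 1))) + 1 / (1 - s) * \<beta> N powr q"
            unfolding i by (subst W) (simp add: algebra_simps)
          also have "\<dots> \<le> 1 / (1 - s) * (\<Sum>l<N. \<beta> l powr q) + 1 / (1 - s) * \<beta> N powr q" using Suc by simp
          finally show ?case by (simp add: algebra_simps)
        qed simp
        moreover have "0 \<le> s / (1 - s) * (if N = 0 then 0 else W (N - 1))" using s W0 by auto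
        ultimately show ?thesis by linarith
      qed
      finally show "(\<Sum>l<N. C0 * Y l powr (q - p) * b l powr p) \<le> C * (\<Sum>l<N. \<beta> l powr q)"
        using C0 kp by (simp add: C_def mult_left_mono mult.assoc)
    qed
    finally show "Jnorm q (poly (\<Sum>l<N. g l)) \<le> ennreal (C * (\<Sum>l<N. (2 powr (real l * \<theta>) * b l) powr q))"
      by (simp add: \<beta>_def)
  qed
qed

subsection \<open>Dyadic decomposition of a Hardy space function\<close>

text \<open>The coefficients are repeated means of zeros and ones. The bound lets the Taylor tail
  control the error of a section to which the multiplier has been applied.\<close>

lemma norm_vp_le: assumes n: "1 \<le> n" shows "norm (vp N n k) \<le> 1"
proof -
  have "norm (coeff (vp_poly A n N) j) \<le> 1" for A j
  proof (induction N arbitrary: j)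
    case 0
    show ?case by (simp add: vp_poly_def geom_poly_def coeff_sum)
  next
    case (Suc N)
    have "vp_poly A n (Suc N) = smult (1 / of_nat n) (vp_poly A n N * geom_poly n)"
      by (simp add: vp_poly_def mult_ac)
    hence "norm (coeff (vp_poly A n (Suc N)) j) = norm (\<Sum>i<n. if i \<le> j then coeff (vp_poly A n N) (j - i) else 0) / real n"
      by (simp add: coeff_mult_geom norm_divide)
    also have "\<dots> \<le> (\<Sum>i<n. 1) / real n"
      by (intro divide_right_mono sum_norm_le) (use Suc in auto)
    also have "\<dots> = 1" using n by simp
    finally show ?case .
  qed
  thus ?thesis by (simp add: vp_def)
qed

section \<open>Taylor sections of a slice and their fractional differences\<close>

definition tcoef :: "(complex \<Rightarrow> complex) \<Rightarrow> nat \<Rightarrow> complex" where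
  "tcoef f k = (deriv ^^ k) f 0 / fact k"

definition spoly :: "(complex \<Rightarrow> complex) \<Rightarrow> real \<Rightarrow> (nat \<Rightarrow> complex) \<Rightarrow> nat \<Rightarrow> complex poly" where
  "spoly f \<rho> \<mu> n = (\<Sum>k\<le>n. monom (\<mu> k * tcoef f k * of_real \<rho> ^ k) k)"

lemma coeff_spoly: "coeff (spoly f \<rho> \<mu> n) k = (if k \<le> n then \<mu> k * tcoef f k * of_real \<rho> ^ k else 0)"
  unfolding spoly_def by (simp add: coeff_sum)

lemma degree_spoly_le: "degree (spoly f \<rho> \<mu> n) \<le> n"
  by (rule degree_le) (auto simp: coeff_spoly)

text \<open>The remainder of the majorant series at radius \<rho>, doubled because a multiplier of
  modulus at most 1 may differ from 1 by 2.\<close>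

definition tail :: "(complex \<Rightarrow> complex) \<Rightarrow> real \<Rightarrow> nat \<Rightarrow> real" where
  "tail f \<rho> m = 2 * (\<Sum>k. norm (tcoef f (k + m)) * \<rho> ^ (k + m))"

lemma taylor_sums:
  assumes f: "f holomorphic_on ball 0 1" and r: "0 < \<rho>" "\<rho> < 1" and w: "norm w \<le> 1"
  shows "(\<lambda>k. tcoef f k * of_real \<rho> ^ k * w ^ k) sums f (of_real \<rho> * w)"
proof -
  have "norm (of_real \<rho> * w) \<le> \<rho> * 1" using r w unfolding norm_mult by (intro mult_mono) auto
  hence "of_real \<rho> * w \<in> ball 0 1" using r by simp
  from holomorphic_power_series[OF f this] show ?thesis
    by (simp add: tcoef_def power_mult_distrib mult.assoc)
qed

lemma taylor_summable:
  assumes f: "f holomorphic_on ball 0 1" and r: "0 < \<rho>" "\<rho> < 1"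
  shows "summable (\<lambda>k. norm (tcoef f k) * \<rho> ^ k)"
proof -
  define s where "s = (\<rho> + 1) / 2"
  have s: "0 < s" "s < 1" "\<rho> < s" using r by (auto simp: s_def)
  have "summable (\<lambda>k. tcoef f k * of_real s ^ k)"
    using taylor_sums[OF f s(1,2), of 1] by (simp add: sums_iff)
  from powser_insidea[OF this, of "of_real \<rho>"] show ?thesis
    using s r by (simp add: norm_mult norm_power)
qed

lemma tail_nonneg:
  assumes f: "f holomorphic_on ball 0 1" and r: "0 < \<rho>" "\<rho> < 1"
  shows "0 \<le> tail f \<rho> m"
  unfolding tail_def using r
  by (intro mult_nonneg_nonneg suminf_nonneg summable_ignore_initial_segment[of "\<lambda>k. norm (tcoef f k) * \<rho> ^ k"] taylor_summable f) auto

lemma tail_tendsto_0: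
  assumes f: "f holomorphic_on ball 0 1" and r: "0 < \<rho>" "\<rho> < 1"
  shows "tail f \<rho> \<longlonglongrightarrow> 0"
proof -
  let ?a = "\<lambda>k. norm (tcoef f k) * \<rho> ^ k"
  note s = taylor_summable[OF f r]
  have "tail f \<rho> = (\<lambda>m. 2 * (suminf ?a - (\<Sum>k<m. ?a k)))"
    unfolding tail_def by (rule ext, subst suminf_minus_initial_segment[OF s]) simp
  moreover have "(\<lambda>m. 2 * (suminf ?a - (\<Sum>k<m. ?a k))) \<longlonglongrightarrow> 2 * (suminf ?a - suminf ?a)"
    by (intro tendsto_intros summable_LIMSEQ s)
  ultimately show ?thesis by simp
qed

lemma spoly_approx:
  assumes f: "f holomorphic_on ball 0 1" and r: "0 < \<rho>" "\<rho> < 1"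
    and mu: "\<And>k. norm (\<mu> k) \<le> 1" "\<And>k. k < m \<Longrightarrow> \<mu> k = 1" "m \<le> Suc n" and w: "norm w \<le> 1"
  shows "norm (poly (spoly f \<rho> \<mu> n) w - f (of_real \<rho> * w)) \<le> tail f \<rho> m"
proof -
  define \<nu> where "\<nu> = (\<lambda>k. if k \<le> n then \<mu> k else 0)"
  have nu: "norm (\<nu> k - 1) \<le> 2" for k
    using norm_triangle_ineq4[of "\<mu> k" 1] mu(1)[of k] by (auto simp: \<nu>_def)
  have nu1: "\<nu> k = 1" if "k < m" for k using that mu by (auto simp: \<nu>_def)
  have "poly (spoly f \<rho> \<mu> n) w = (\<Sum>k\<le>n. \<nu> k * tcoef f k * of_real \<rho> ^ k * w ^ k)"
    by (subst poly_eq_sum_atMost[OF degree_spoly_le]) (auto simp: coeff_spoly \<nu>_def intro!: sum.cong)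
  moreover have "(\<lambda>k. \<nu> k * tcoef f k * of_real \<rho> ^ k * w ^ k) sums (\<Sum>k\<le>n. \<nu> k * tcoef f k * of_real \<rho> ^ k * w ^ k)"
    by (rule sums_finite) (auto simp: \<nu>_def)
  ultimately have "(\<lambda>k. \<nu> k * tcoef f k * of_real \<rho> ^ k * w ^ k - tcoef f k * of_real \<rho> ^ k * w ^ k) sums
     (poly (spoly f \<rho> \<mu> n) w - f (of_real \<rho> * w))"
    using sums_diff[OF _ taylor_sums[OF f r w]] by simp
  moreover have "\<nu> k * tcoef f k * of_real \<rho> ^ k * w ^ k - tcoef f k * of_real \<rho> ^ k * w ^ k = (\<nu> k - 1) * (tcoef f k * of_real \<rho> ^ k * w ^ k)" for k
    by (simp add: algebra_simps)
  ultimately have D: "(\<lambda>k. (\<nu> k - 1) * (tcoef f k * of_real \<rho> ^ k * w ^ k)) sums (poly (spoly f \<rho> \<mu> n) w - f (of_real \<rho> * w))"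
    by simp
  hence "(\<lambda>k. (\<nu> (k + m) - 1) * (tcoef f (k + m) * of_real \<rho> ^ (k + m) * w ^ (k + m))) sums
      ((poly (spoly f \<rho> \<mu> n) w - f (of_real \<rho> * w)) - (\<Sum>k<m. (\<nu> k - 1) * (tcoef f k * of_real \<rho> ^ k * w ^ k)))"
    by (rule sums_split_initial_segment)
  hence D': "(\<lambda>k. (\<nu> (k + m) - 1) * (tcoef f (k + m) * of_real \<rho> ^ (k + m) * w ^ (k + m))) sums
      (poly (spoly f \<rho> \<mu> n) w - f (of_real \<rho> * w))" by (simp add: nu1)
  have s: "summable (\<lambda>k. 2 * (norm (tcoef f (k + m)) * \<rho> ^ (k + m)))"
    by (intro summable_mult summable_ignore_initial_segment taylor_summable f r)
  have b: "norm ((\<nu> (k + m) - 1) * (tcoef f (k + m) * of_real \<rho> ^ (k + m) * w ^ (k + m))) \<le> 2 * (norm (tcoef f (k + m)) * \<rho> ^ (k + m))" for k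
  proof -
    have "norm w ^ (k + m) \<le> 1" using w by (simp add: power_le_one)
    hence "norm (tcoef f (k + m)) * \<rho> ^ (k + m) * norm w ^ (k + m) \<le> norm (tcoef f (k + m)) * \<rho> ^ (k + m) * 1"
      using r by (intro mult_left_mono) auto
    hence "norm (\<nu> (k + m) - 1) * (norm (tcoef f (k + m)) * \<rho> ^ (k + m) * norm w ^ (k + m)) \<le> 2 * (norm (tcoef f (k + m)) * \<rho> ^ (k + m))"
      by (intro mult_mono[OF nu]) (use r in auto)
    thus ?thesis using r by (simp add: norm_mult norm_power)
  qed
  have "norm (\<Sum>k. (\<nu> (k + m) - 1) * (tcoef f (k + m) * of_real \<rho> ^ (k + m) * w ^ (k + m))) \<le> (\<Sum>k. 2 * (norm (tcoef f (k + m)) * \<rho> ^ (k + m)))"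
    by (rule norm_suminf_le[OF b s])
  also have "\<dots> = tail f \<rho> m" unfolding tail_def
    by (rule suminf_mult) (intro summable_ignore_initial_segment taylor_summable f r)
  finally show ?thesis using D' by (simp add: sums_iff)
qed

text \<open>All nodes of the difference lie on |w| = 1, where P is within e of the slice, and the
  binomial coefficients are absolutely summable. The series of errors converges by comparison, and
  the value of the series for f is read off from it.\<close>

lemma frac_diff_approx:
  assumes f: "f holomorphic_on ball 0 1" and r: "0 < \<rho>" "\<rho> < 1" and g: "0 < \<gamma>"
    and P: "\<And>w. norm w = 1 \<Longrightarrow> norm (poly P w - f (of_real \<rho> * w)) \<le> e" and z: "norm z = 1"
  shows "norm (poly (fdiff \<gamma> h P) z - frac_diff \<gamma> h f (of_real \<rho> * z)) \<le> (\<Sum>n. \<bar>\<gamma> gchoose n\<bar>) * e"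
proof -
  define u where "u = (\<lambda>n. cis ((\<gamma> - real n) * h) * z)"
  have u: "norm (u n) = 1" for n by (simp add: u_def norm_mult z)
  have F: "frac_diff \<gamma> h f (of_real \<rho> * z) = (\<Sum>n. binc \<gamma> n * f (of_real \<rho> * u n))"
    unfolding frac_diff_def binc_def u_def by (simp add: cis_conv_exp mult_ac)
  note S = fdiff_sums[OF g, of P h z, folded u_def]
  have S': "(\<lambda>n. binc \<gamma> n * poly P (u n)) sums poly (fdiff \<gamma> h P) z" using S by (simp add: u_def)
  have b: "norm (binc \<gamma> n * (poly P (u n) - f (of_real \<rho> * u n))) \<le> \<bar>\<gamma> gchoose n\<bar> * e" for n
    unfolding norm_mult norm_binc by (intro mult_left_mono P u) auto
  have s: "summable (\<lambda>n. \<bar>\<gamma> gchoose n\<bar> * e)" by (intro summable_mult2 summable_gbinomial g)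
  have D: "summable (\<lambda>n. binc \<gamma> n * (poly P (u n) - f (of_real \<rho> * u n)))"
    by (rule summable_norm_cancel[OF summable_comparison_test'[OF s, of 0]]) (use b in auto)
  have "(\<lambda>n. binc \<gamma> n * poly P (u n) - binc \<gamma> n * (poly P (u n) - f (of_real \<rho> * u n))) sums
     (poly (fdiff \<gamma> h P) z - (\<Sum>n. binc \<gamma> n * (poly P (u n) - f (of_real \<rho> * u n))))"
    by (intro sums_diff S' summable_sums D)
  hence "frac_diff \<gamma> h f (of_real \<rho> * z) = poly (fdiff \<gamma> h P) z - (\<Sum>n. binc \<gamma> n * (poly P (u n) - f (of_real \<rho> * u n)))"
    unfolding F by (simp add: algebra_simps sums_iff)
  hence "norm (poly (fdiff \<gamma> h P) z - frac_diff \<gamma> h f (of_real \<rho> * z)) = norm (\<Sum>n. binc \<gamma> n * (poly P (u n) - f (of_real \<rho> * u n)))"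
    by simp
  also have "\<dots> \<le> (\<Sum>n. \<bar>\<gamma> gchoose n\<bar> * e)" by (rule norm_suminf_le[OF b s])
  also have "\<dots> = (\<Sum>n. \<bar>\<gamma> gchoose n\<bar>) * e" by (rule suminf_mult2[symmetric, OF summable_gbinomial[OF g]])
  finally show ?thesis .
qed

lemma frac_diff_tendsto:
  assumes f: "f holomorphic_on ball 0 1" and r: "0 < \<rho>" "\<rho> < 1" and g: "0 < \<gamma>"
    and P: "\<And>i w. norm w = 1 \<Longrightarrow> norm (poly (P i) w - f (of_real \<rho> * w)) \<le> e i" and e: "e \<longlonglongrightarrow> 0" and z: "norm z = 1"
  shows "(\<lambda>i. poly (fdiff \<gamma> h (P i)) z) \<longlonglongrightarrow> frac_diff \<gamma> h f (of_real \<rho> * z)"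
proof (rule LIM_zero_cancel, rule Lim_null_comparison)
  show "\<forall>\<^sub>F i in sequentially. norm (poly (fdiff \<gamma> h (P i)) z - frac_diff \<gamma> h f (of_real \<rho> * z)) \<le> (\<Sum>n. \<bar>\<gamma> gchoose n\<bar>) * e i"
    by (intro always_eventually allI frac_diff_approx f r g P z)
  show "(\<lambda>i. (\<Sum>n. \<bar>\<gamma> gchoose n\<bar>) * e i) \<longlonglongrightarrow> 0" using tendsto_mult_left[OF e] by simp
qed

lemma taylor_poly_approx:
  assumes "f holomorphic_on ball 0 1" "0 < \<rho>" "\<rho> < 1" "norm w = 1"
  shows "norm (poly (spoly f \<rho> (\<lambda>_. 1) m) w - f (of_real \<rho> * w)) \<le> tail f \<rho> m"
  by (rule spoly_approx) (use assms in auto)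

text \<open>A pointwise limit of continuous functions, the differences of Taylor sections.
  Measurability allows the set integral in the norm to be read as an integral over
  \<open>circ\<close>.\<close>

lemma frac_diff_slice_measurable:
  assumes f: "f holomorphic_on ball 0 1" and r: "0 < \<rho>" "\<rho> < 1" and g: "0 < \<gamma>"
  shows "(\<lambda>t. norm (frac_diff \<gamma> h f (of_real \<rho> * cis t))) \<in> borel_measurable borel"
proof (rule borel_measurable_LIMSEQ_real)
  show "(\<lambda>t. norm (poly (fdiff \<gamma> h (spoly f \<rho> (\<lambda>_. 1) i)) (cis t))) \<in> borel_measurable borel" for i
    by (rule norm_poly_cis_measurable)
  fix t
  show "(\<lambda>i. norm (poly (fdiff \<gamma> h (spoly f \<rho> (\<lambda>_. 1) i)) (cis t))) \<longlonglongrightarrow> norm (frac_diff \<gamma> h f (of_real \<rho> * cis t))"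
    by (intro tendsto_norm frac_diff_tendsto[OF f r g taylor_poly_approx[OF f r] tail_tendsto_0[OF f r]]) auto
qed

lemma Hp_norm_slice:
  assumes f: "f holomorphic_on ball 0 1" and r: "0 < \<rho>" "\<rho> < 1" and g: "0 < \<gamma>"
  shows "(\<integral>\<^sup>+t\<in>{0..2 * pi}. ennreal (norm (frac_diff \<gamma> h f (complex_of_real \<rho> * exp (\<i> * complex_of_real t))) powr p) \<partial>lborel)
     = Jnorm p (\<lambda>z. frac_diff \<gamma> h f (of_real \<rho> * z))"
proof -
  define F where "F = (\<lambda>t. norm (frac_diff \<gamma> h f (of_real \<rho> * cis t)))"
  have [measurable]: "F \<in> borel_measurable borel"
    unfolding F_def by (rule frac_diff_slice_measurable[OF f r g])
  have "(\<lambda>t. ennreal (F t powr p)) \<in> borel_measurable borel" by measurable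
  from nn_integral_circ[OF this] show ?thesis unfolding Jnorm_def cis_conv_exp[symmetric] F_def by simp
qed

lemma epowr_le_imp:
  assumes "epowr x (1 / p) \<le> ennreal W" "0 \<le> W" "0 < p"
  shows "x \<le> ennreal (W powr p)"
proof (cases "x = \<infinity>")
  case True
  thus ?thesis using assms by (simp add: epowr_def top_unique)
next
  case False
  then obtain y where y: "x = ennreal y" "0 \<le> y" by (cases x) auto
  have "y powr (1 / p) \<le> W" using assms y False by (simp add: epowr_def)
  hence "(y powr (1 / p)) powr p \<le> W powr p" using assms by (intro powr_mono2) auto
  thus ?thesis using y assms by (simp add: powr_powr ennreal_leI)
qed

lemma epowr_mono_real:
  assumes "x \<le> ennreal c * y" "0 < c" "0 < q" "y < top"
  shows "epowr x (1 / q) \<le> ennreal (c powr (1 / q)) * epowr y (1 / q)"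
proof -
  obtain v where v: "y = ennreal v" "0 \<le> v" using assms by (cases y) auto
  have "x \<le> ennreal (c * v)" using assms v by (simp add: ennreal_mult)
  moreover from this obtain u where u: "x = ennreal u" "0 \<le> u"
    by (cases x) (auto simp: top_unique)
  ultimately have "u \<le> c * v" using v assms by (subst (asm) u, subst (asm) ennreal_le_iff) auto
  hence "u powr (1 / q) \<le> (c * v) powr (1 / q)" using u assms by (intro powr_mono2) auto
  also have "\<dots> = c powr (1 / q) * v powr (1 / q)" by (rule powr_mult)
  finally have "ennreal (u powr (1 / q)) \<le> ennreal (c powr (1 / q) * v powr (1 / q))" by (rule ennreal_leI)
  thus ?thesis using u v by (simp add: epowr_def ennreal_mult)
qed

text \<open>Since \<mu> vanishes beyond n, the polynomial equals \<mu> applied to the difference of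
  a Taylor section of any order m \<ge> n. The multiplier bound for polynomials thus reaches f: the
  section can be taken as close to the slice as the given e demands.\<close>

lemma multiplier_frac_diff_le:
  assumes f: "f holomorphic_on ball 0 1" and r: "0 < \<rho>" "\<rho> < 1" and g: "0 < \<gamma>" and p: "0 < p"
    and C: "0 < C" "\<And>P. Jnorm p (poly (pmul \<mu> P)) \<le> ennreal C * Jnorm p (poly P)"
    and mu: "\<And>k. n < k \<Longrightarrow> \<mu> k = 0"
    and W: "0 \<le> W" "Jnorm p (\<lambda>z. frac_diff \<gamma> h f (of_real \<rho> * z)) \<le> ennreal (W powr p)"
  shows "Jnorm p (poly (fdiff \<gamma> h (spoly f \<rho> \<mu> n))) \<le> ennreal (C * 2 powr p * W powr p)"
proof (rule ennreal_le_epsilon)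
  fix e :: real assume e: "0 < e"
  define B where "B = (\<Sum>n. \<bar>\<gamma> gchoose n\<bar>)"
  have B: "0 \<le> B" unfolding B_def by (rule suminf_nonneg[OF summable_gbinomial[OF g]]) simp
  have "(\<lambda>m. (B * tail f \<rho> m) powr p) \<longlonglongrightarrow> (B * 0) powr p"
    by (rule tendsto_powr'[OF tendsto_mult_left[OF tail_tendsto_0[OF f r]] tendsto_const])
       (use p B tail_nonneg[OF f r] in auto)
  hence "(\<lambda>m. C * 2 powr p * ((B * tail f \<rho> m) powr p * (2 * pi))) \<longlonglongrightarrow> C * 2 powr p * ((B * 0) powr p * (2 * pi))"
    by (intro tendsto_mult_left tendsto_mult_right)
  hence "\<forall>\<^sub>F m in sequentially. C * 2 powr p * ((B * tail f \<rho> m) powr p * (2 * pi)) < e"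
    using e p by (intro order_tendstoD) auto
  then obtain M where M: "\<And>m. M \<le> m \<Longrightarrow> C * 2 powr p * ((B * tail f \<rho> m) powr p * (2 * pi)) < e"
    unfolding eventually_sequentially by blast
  define m where "m = max M n"
  define S where "S = spoly f \<rho> (\<lambda>_. 1) m"
  have rep: "fdiff \<gamma> h (spoly f \<rho> \<mu> n) = pmul \<mu> (fdiff \<gamma> h S)"
    by (rule poly_eqI) (auto simp: fdiff_def S_def coeff_spoly m_def mu not_le)
  have "Jnorm p (poly (fdiff \<gamma> h S)) \<le> ennreal (2 powr p) * (Jnorm p (\<lambda>z. frac_diff \<gamma> h f (of_real \<rho> * z)) + Jnorm p (\<lambda>_. of_real (B * tail f \<rho> m)))"
  proof (rule Jnorm_triangle_le[OF _ p frac_diff_slice_measurable[OF f r g]])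
    fix t
    have "norm (poly (fdiff \<gamma> h S) (cis t) - frac_diff \<gamma> h f (of_real \<rho> * cis t)) \<le> B * tail f \<rho> m"
      unfolding B_def S_def by (intro frac_diff_approx f r g taylor_poly_approx) auto
    also have "\<dots> \<le> norm (complex_of_real (B * tail f \<rho> m))" by (subst norm_of_real) simp
    finally show "norm (poly (fdiff \<gamma> h S) (cis t)) \<le> norm (frac_diff \<gamma> h f (of_real \<rho> * cis t)) + norm (complex_of_real (B * tail f \<rho> m))"
      using norm_triangle_ineq2[of "poly (fdiff \<gamma> h S) (cis t)" "frac_diff \<gamma> h f (of_real \<rho> * cis t)"] by linarith
  qed simp
  also have "\<dots> \<le> ennreal (2 powr p) * (ennreal (W powr p) + ennreal ((B * tail f \<rho> m) powr p * (2 * pi)))"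
  proof (intro mult_left_mono add_mono W(2))
    have "0 \<le> B * tail f \<rho> m" using B tail_nonneg[OF f r] by simp
    thus "Jnorm p (\<lambda>_. complex_of_real (B * tail f \<rho> m)) \<le> ennreal ((B * tail f \<rho> m) powr p * (2 * pi))"
      unfolding Jnorm_def by (subst norm_of_real) (simp add: emeasure_circ ennreal_mult)
  qed auto
  finally have "Jnorm p (poly (fdiff \<gamma> h (spoly f \<rho> \<mu> n))) \<le> ennreal C * (ennreal (2 powr p) * (ennreal (W powr p) + ennreal ((B * tail f \<rho> m) powr p * (2 * pi))))"
    unfolding rep by (rule order_trans[OF C(2) mult_left_mono]) simp
  also have "\<dots> = ennreal (C * 2 powr p * W powr p + C * 2 powr p * ((B * tail f \<rho> m) powr p * (2 * pi)))"
    using C(1) by (simp add: ennreal_mult'[symmetric] ennreal_plus[symmetric] distrib_left mult.assoc del: ennreal_plus)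
  also have "\<dots> \<le> ennreal (C * 2 powr p * W powr p + e)"
    using M[of m] by (intro ennreal_leI) (simp add: m_def)
  also have "\<dots> = ennreal (C * 2 powr p * W powr p) + ennreal e" using C e by (intro ennreal_plus) auto
  finally show "Jnorm p (poly (fdiff \<gamma> h (spoly f \<rho> \<mu> n))) \<le> ennreal (C * 2 powr p * W powr p) + ennreal e" .
qed

section \<open>Dyadic levels and the blocks between them\<close>

definition lv :: "real \<Rightarrow> nat \<Rightarrow> nat \<Rightarrow> complex" where
  "lv p j k = (if j = 0 then (if k = 0 then 1 else 0) else vp (vpN p) (2 ^ (j - 1)) k)"

definition dyadic :: "(complex \<Rightarrow> complex) \<Rightarrow> real \<Rightarrow> real \<Rightarrow> nat \<Rightarrow> complex poly" where
  "dyadic f \<rho> p j = spoly f \<rho> (lv p j) ((vpN p + 1) * 2 ^ j)"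

lemma norm_lv_le: "norm (lv p j k) \<le> 1"
  by (auto simp: lv_def intro!: norm_vp_le)

text \<open>At j = 0 the exponent j - 1 is truncated to 0, so the claim concerns k = 0 alone: level
  0 keeps just the constant term, which every difference annihilates.\<close>

lemma lv_eq_1: "k < 2 ^ (j - 1) \<Longrightarrow> lv p j k = 1"
  by (cases j) (auto simp: lv_def intro!: vp_eq_1)

lemma lv_eq_0:
  assumes "(vpN p + 1) * 2 ^ j < k"
  shows "lv p j k = 0"
proof (cases j)
  case 0
  thus ?thesis using assms by (simp add: lv_def)
next
  case (Suc i)
  have "(vpN p + 1) * 2 ^ i \<le> (vpN p + 1) * 2 ^ j" unfolding Suc by simp
  hence "(vpN p + 1) * 2 ^ i < k" using assms by linarith
  hence "vp (vpN p) (2 ^ i) k = 0" by (intro vp_eq_0) auto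
  thus ?thesis by (simp add: lv_def Suc)
qed

lemma degree_dyadic_le: "degree (dyadic f \<rho> p j) \<le> (vpN p + 1) * 2 ^ j"
  unfolding dyadic_def by (rule degree_spoly_le)

lemma degree_dyadic_Suc_le: "degree (dyadic f \<rho> p (Suc i)) \<le> (vpN p + 1) * 2 ^ i"
proof (rule degree_le, intro allI impI)
  fix k assume "(vpN p + 1) * 2 ^ i < k"
  hence "vp (vpN p) (2 ^ i) k = 0" by (intro vp_eq_0) auto
  thus "coeff (dyadic f \<rho> p (Suc i)) k = 0" by (simp add: dyadic_def coeff_spoly lv_def)
qed

lemma fdiff_dyadic_0: "0 < \<gamma> \<Longrightarrow> fdiff \<gamma> h (dyadic f \<rho> p 0) = 0"
  by (rule poly_eqI) (auto simp: fdiff_def dyadic_def coeff_spoly lv_def)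

lemma Jnorm_0 [simp]: "0 < p \<Longrightarrow> Jnorm p (poly 0) = 0"
  by (simp add: Jnorm_def)

text \<open>Uniform in the level j: the de la Vallee-Poussin operators are bounded uniformly in n,
  and the difference of level 0 is zero.\<close>

lemma fdiff_dyadic_le:
  assumes p: "0 < p" and g: "0 < \<gamma>"
  shows "\<exists>C>0. \<forall>f \<rho> h j W. f holomorphic_on ball 0 1 \<longrightarrow> 0 < \<rho> \<longrightarrow> \<rho> < 1 \<longrightarrow> 0 \<le> W \<longrightarrow>
    Jnorm p (\<lambda>z. frac_diff \<gamma> h f (of_real \<rho> * z)) \<le> ennreal (W powr p) \<longrightarrow>
    Jnorm p (poly (fdiff \<gamma> h (dyadic f \<rho> p j))) \<le> ennreal (C * W powr p)"
proof -
  from vpop_bounded[OF p] obtain C where C: "C > 0" and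
    b: "\<And>n P. 1 \<le> n \<Longrightarrow> Jnorm p (poly (vpop p n P)) \<le> ennreal C * Jnorm p (poly P)" by blast
  show ?thesis
  proof (intro exI[of _ "C * 2 powr p"] conjI allI impI)
    fix f \<rho> h j W
    assume a: "f holomorphic_on ball 0 1" "0 < \<rho>" "\<rho> < 1" "0 \<le> W"
      "Jnorm p (\<lambda>z. frac_diff \<gamma> h f (of_real \<rho> * z)) \<le> ennreal (W powr p)"
    show "Jnorm p (poly (fdiff \<gamma> h (dyadic f \<rho> p j))) \<le> ennreal (C * 2 powr p * W powr p)"
    proof (cases j)
      case 0
      thus ?thesis using p g by (simp add: fdiff_dyadic_0)
    next
      case (Suc i)
      have e: "lv p j = vp (vpN p) (2 ^ i)" by (rule ext) (simp add: lv_def Suc)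
      show ?thesis unfolding dyadic_def
      proof (rule multiplier_frac_diff_le[OF a(1-3) g p C _ _ a(4,5)])
        show "Jnorm p (poly (pmul (lv p j) P)) \<le> ennreal C * Jnorm p (poly P)" for P
          using b[of "2 ^ i" P] unfolding e vpop_def by simp
      qed (rule lv_eq_0)
    qed
  qed (use C in auto)
qed

lemma shift_diff_funpow: "1 \<le> M \<Longrightarrow> (shift_diff h ^^ M) P = fdiff (real M) h P"
proof -
  assume M: "1 \<le> M"
  have "coeff ((shift_diff h ^^ M) P) k = (cis (real k * h) - 1) ^ M * coeff P k" for k
    by (induction M arbitrary: P) (auto simp: shift_diff_def)
  thus ?thesis using M by (intro poly_eqI) (simp add: fdiff_def fsym_nat)
qed

lemma fdiff_fdiff: "fdiff (a + b) h P = fdiff a h (fdiff b h P)"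
  unfolding fdiff_def pmul_pmul by (simp add: fsym_add)

lemma fdiff_diff: "fdiff \<gamma> h (P - Q) = fdiff \<gamma> h P - fdiff \<gamma> h Q"
  unfolding fdiff_def by (rule pmul_diff_poly)

lemma fdiff_add: "fdiff \<gamma> h (P + Q) = fdiff \<gamma> h P + fdiff \<gamma> h Q"
  unfolding fdiff_def by (rule pmul_add_poly)

lemma ennreal_divide_bound:
  assumes "ennreal a * x \<le> ennreal b" "0 < a" "0 \<le> b"
  shows "x \<le> ennreal (b / a)"
proof (cases x)
  case (real r)
  have "ennreal (a * r) \<le> ennreal b" using assms real by (simp add: ennreal_mult)
  hence "a * r \<le> b" using assms(3) by (subst (asm) ennreal_le_iff)
  hence "r \<le> b / a" using assms(2) by (simp add: field_simps)
  thus ?thesis using real by (simp add: ennreal_leI)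
next
  case top
  thus ?thesis using assms by (simp add: ennreal_mult_top top_unique)
qed

lemma block_estimate:
  assumes p: "0 < p" and g: "0 < \<beta>"
  shows "\<exists>c>0. \<forall>c'. 0 < c' \<longrightarrow> c' \<le> c \<longrightarrow> (\<exists>C>0. \<forall>f \<rho> l W. f holomorphic_on ball 0 1 \<longrightarrow> 0 < \<rho> \<longrightarrow> \<rho> < 1 \<longrightarrow> 0 \<le> W \<longrightarrow>
    Jnorm p (\<lambda>z. frac_diff \<beta> (c' / 2 ^ l) f (of_real \<rho> * z)) \<le> ennreal (W powr p) \<longrightarrow>
    Jnorm p (poly (dyadic f \<rho> p (Suc l) - dyadic f \<rho> p l)) \<le> ennreal ((C * W) powr p))"
proof -
  obtain c1 where c1: "c1 > 0" and bsp: "\<forall>M. \<exists>C>0. \<forall>m\<ge>1. \<forall>n\<ge>1. \<forall>P h. degree P \<le> n \<longrightarrow> (\<forall>k<m. coeff P k = 0) \<longrightarrow> 0 < h \<longrightarrow> h * real n \<le> c1 \<longrightarrow>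
    ennreal ((h * real m) powr (p * real M)) * Jnorm p (poly P) \<le> ennreal C * Jnorm p (poly ((shift_diff h ^^ M) P))"
    using block_shift_diff_power[OF p] by (elim exE conjE)
  \<comment> \<open>Large enough that M - \<beta> exceeds 1/p, hence is positive and above 1/p - 1,
    as boundedness of the difference of that order requires.\<close>
  define M where "M = nat \<lceil>\<beta> + 1 / p\<rceil> + 1"
  have M: "1 \<le> M" "\<beta> + 1 / p < real M" unfolding M_def by simp linarith
  obtain CM where CM: "CM > 0" and bs: "\<forall>m\<ge>1. \<forall>n\<ge>1. \<forall>P h. degree P \<le> n \<longrightarrow> (\<forall>k<m. coeff P k = 0) \<longrightarrow> 0 < h \<longrightarrow> h * real n \<le> c1 \<longrightarrow>
    ennreal ((h * real m) powr (p * real M)) * Jnorm p (poly P) \<le> ennreal CM * Jnorm p (poly ((shift_diff h ^^ M) P))"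
    using bsp[THEN spec[of _ M]] by (elim exE conjE)
  have pp: "0 < 1 / p" using p by simp
  have Mb: "0 < real M - \<beta>" "1 / p - 1 < real M - \<beta>" using M(2) pp by linarith+
  from fdiff_bounded[OF p Mb(1)] Mb(2) obtain CD where CD: "CD > 0" and
    fb: "\<And>h P. Jnorm p (poly (fdiff (real M - \<beta>) h P)) \<le> ennreal CD * Jnorm p (poly P)" by blast
  from fdiff_dyadic_le[OF p g] obtain CL where CL: "CL > 0" and
    dy: "\<And>f \<rho> h j W. f holomorphic_on ball 0 1 \<Longrightarrow> 0 < \<rho> \<Longrightarrow> \<rho> < 1 \<Longrightarrow> 0 \<le> W \<Longrightarrow>
    Jnorm p (\<lambda>z. frac_diff \<beta> h f (of_real \<rho> * z)) \<le> ennreal (W powr p) \<Longrightarrow>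
    Jnorm p (poly (fdiff \<beta> h (dyadic f \<rho> p j))) \<le> ennreal (CL * W powr p)" by blast
  define N1 where "N1 = vpN p + 1"
  \<comment> \<open>For h \<le> c/2^l and frequencies up to N1 2^(l+1) this gives h n \<le>
    c1.\<close>
  define c where "c = c1 / (2 * real N1)"
  have c: "0 < c" using c1 by (simp add: c_def N1_def)
  show ?thesis
  proof (rule exI[of _ c], intro conjI c allI impI)
    fix c' assume c': "0 < c'" "c' \<le> c"
    define K where "K = CM * CD * 2 powr p * 2 * CL / (c' / 2) powr (p * real M)"
    have K: "0 < K" using CM CD CL c' by (simp add: K_def)
    show "\<exists>C>0. \<forall>f \<rho> l W. f holomorphic_on ball 0 1 \<longrightarrow> 0 < \<rho> \<longrightarrow> \<rho> < 1 \<longrightarrow> 0 \<le> W \<longrightarrow>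
      Jnorm p (\<lambda>z. frac_diff \<beta> (c' / 2 ^ l) f (of_real \<rho> * z)) \<le> ennreal (W powr p) \<longrightarrow>
      Jnorm p (poly (dyadic f \<rho> p (Suc l) - dyadic f \<rho> p l)) \<le> ennreal ((C * W) powr p)"
    proof (rule exI[of _ "K powr (1 / p)"], intro conjI allI impI)
      fix f \<rho> l W
      assume a: "f holomorphic_on ball 0 1" "0 < \<rho>" "\<rho> < 1" "0 \<le> W"
        "Jnorm p (\<lambda>z. frac_diff \<beta> (c' / 2 ^ l) f (of_real \<rho> * z)) \<le> ennreal (W powr p)"
      define h where "h = c' / 2 ^ l"
      define g where "g = dyadic f \<rho> p (Suc l) - dyadic f \<rho> p l"
      define n :: nat where "n = N1 * 2 ^ Suc l"
      define m :: nat where "m = 2 ^ (l - 1)"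
      have h: "0 < h" using c' by (simp add: h_def)
      have m1: "1 \<le> m" by (simp add: m_def)
      have "0 < n" by (simp add: n_def N1_def)
      hence n1: "1 \<le> n" by linarith
      have degg: "degree g \<le> n"
      proof -
        have "degree (dyadic f \<rho> p l) \<le> n"
          by (rule order_trans[OF degree_dyadic_le]) (simp add: n_def N1_def)
        thus ?thesis unfolding g_def n_def N1_def using degree_dyadic_le[of f \<rho> p "Suc l"]
          by (intro degree_diff_le) auto
      qed
      have low: "\<forall>k<m. coeff g k = 0"
      proof (intro allI impI)
        fix k assume k: "k < m"
        have k1: "lv p l k = 1" using k unfolding m_def by (rule lv_eq_1)
        have "k < 2 ^ l" using k unfolding m_def by (rule less_le_trans) simp
        hence k2: "lv p (Suc l) k = 1" by (intro lv_eq_1) simp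
        have "k \<le> 2 ^ l" using \<open>k < 2 ^ l\<close> by simp
        also have "\<dots> \<le> (vpN p + 1) * 2 ^ l" by simp
        finally have k3: "k \<le> (vpN p + 1) * 2 ^ l" .
        also have "\<dots> \<le> (vpN p + 1) * 2 ^ Suc l" by simp
        finally show "coeff g k = 0" using k3 by (simp add: g_def dyadic_def coeff_spoly k1 k2 del: power_Suc)
      qed
      have hn: "h * real n \<le> c1"
      proof -
        have "h * real n = c' * (2 * real N1)" by (simp add: h_def n_def)
        also have "\<dots> \<le> c * (2 * real N1)" using c' by (intro mult_right_mono) auto
        finally show ?thesis by (simp add: c_def N1_def)
      qed
      have hm: "c' / 2 \<le> h * real m"
      proof -
        have "(2::real) ^ l \<le> 2 * 2 ^ (l - 1)" by (cases l) auto
        thus ?thesis using c' by (simp add: h_def m_def field_simps)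
      qed
      have "ennreal ((c' / 2) powr (p * real M)) * Jnorm p (poly g) \<le> ennreal ((h * real m) powr (p * real M)) * Jnorm p (poly g)"
        using hm c' p by (intro mult_right_mono ennreal_leI powr_mono2) auto
      also have "\<dots> \<le> ennreal CM * Jnorm p (poly ((shift_diff h ^^ M) g))"
        using bs m1 n1 degg low h hn by simp
      also have "(shift_diff h ^^ M) g = fdiff (real M - \<beta>) h (fdiff \<beta> h g)"
        unfolding shift_diff_funpow[OF M(1)] using fdiff_fdiff[of "real M - \<beta>" \<beta> h g] by simp
      also have "ennreal CM * Jnorm p (poly (fdiff (real M - \<beta>) h (fdiff \<beta> h g))) \<le> ennreal CM * (ennreal CD * Jnorm p (poly (fdiff \<beta> h g)))"
        by (intro mult_left_mono fb) auto
      also have "Jnorm p (poly (fdiff \<beta> h g)) \<le> ennreal (2 powr p) * (Jnorm p (poly (fdiff \<beta> h (dyadic f \<rho> p (Suc l)))) + Jnorm p (poly (fdiff \<beta> h (dyadic f \<rho> p l))))"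
        unfolding g_def fdiff_diff by (rule Jnorm_triangle_le[OF _ p]) (auto intro: norm_triangle_ineq4)
      also have "\<dots> \<le> ennreal (2 powr p) * (ennreal (CL * W powr p) + ennreal (CL * W powr p))"
        using dy[OF a(1-4) a(5)] unfolding h_def by (intro mult_left_mono add_mono) auto
      also have "\<dots> = ennreal (2 powr p * 2 * CL * W powr p)"
        using CL by (simp add: ennreal_mult'[symmetric] ennreal_plus[symmetric] del: ennreal_plus)
      finally have "ennreal ((c' / 2) powr (p * real M)) * Jnorm p (poly g) \<le> ennreal CM * (ennreal CD * ennreal (2 powr p * 2 * CL * W powr p))"
        by (simp add: mult_left_mono)
      also have "\<dots> = ennreal (CM * CD * 2 powr p * 2 * CL * W powr p)"
        using CM CD CL by (simp add: ennreal_mult'[symmetric] mult.assoc)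
      finally have "Jnorm p (poly g) \<le> ennreal (CM * CD * 2 powr p * 2 * CL * W powr p / (c' / 2) powr (p * real M))"
        using CM CD CL c' by (intro ennreal_divide_bound) auto
      also have "CM * CD * 2 powr p * 2 * CL * W powr p / (c' / 2) powr (p * real M) = (K powr (1 / p) * W) powr p"
        using K p a(4) by (simp add: powr_mult powr_powr) (simp add: K_def)
      finally show "Jnorm p (poly (dyadic f \<rho> p (Suc l) - dyadic f \<rho> p l)) \<le> ennreal ((K powr (1 / p) * W) powr p)"
        unfolding g_def .
    qed (use K in auto)
  qed
qed

lemma dyadic_approx:
  assumes "f holomorphic_on ball 0 1" "0 < \<rho>" "\<rho> < 1" "norm w = 1"
  shows "norm (poly (dyadic f \<rho> p i) w - f (of_real \<rho> * w)) \<le> tail f \<rho> (2 ^ (i - 1))"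
  unfolding dyadic_def
proof (rule spoly_approx)
  have "(2::nat) ^ (i - 1) \<le> 2 ^ i" by (intro power_increasing) auto
  also have "\<dots> \<le> (vpN p + 1) * 2 ^ i" by simp
  finally show "2 ^ (i - 1) \<le> Suc ((vpN p + 1) * 2 ^ i)" by simp
qed (use assms in \<open>auto intro: norm_lv_le lv_eq_1\<close>)

lemma dyadic_tail_tendsto:
  assumes f: "f holomorphic_on ball 0 1" "0 < \<rho>" "\<rho> < 1"
  shows "(\<lambda>i. tail f \<rho> (2 ^ (i - 1))) \<longlonglongrightarrow> 0"
proof (rule filterlim_compose[OF tail_tendsto_0[OF f]])
  have "i \<le> 2 ^ (i - 1)" for i :: nat using less_exp[of "i - 1"] by linarith
  thus "filterlim (\<lambda>i. 2 ^ (i - 1) :: nat) sequentially sequentially"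
    by (intro filterlim_at_top_mono[OF filterlim_ident]) (auto intro!: always_eventually)
qed

text \<open>\<open>W\<close> stands for the modulus of order \<alpha> + \<theta> and
  \<open>S\<close> for the dyadic sum replacing the integral; finite sets of levels avoid any
  question of convergence. The first term of the bound comes from the low part, \<open>S\<close>
  from the blocks.\<close>

theorem slice_estimate:
  fixes p q \<alpha> \<theta> :: real
  assumes p: "0 < p" "p < q" and th: "\<theta> = 1 / p - 1 / q" and al: "0 < \<alpha>" "\<alpha> \<in> \<nat> \<or> 1 / q - 1 < \<alpha>"
  shows "\<exists>c>0. \<exists>C>0. \<forall>f \<rho> h W S. f holomorphic_on ball 0 1 \<longrightarrow> 0 < \<rho> \<longrightarrow> \<rho> < 1 \<longrightarrow> h \<noteq> 0 \<longrightarrow> (\<forall>s. 0 \<le> W s) \<longrightarrow>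
    (\<forall>s. s \<noteq> 0 \<longrightarrow> 2 * \<bar>s\<bar> \<le> \<bar>h\<bar> \<longrightarrow> Jnorm p (\<lambda>z. frac_diff (\<alpha> + \<theta>) s f (of_real \<rho> * z)) \<le> ennreal (W \<bar>s\<bar> powr p)) \<longrightarrow>
    (\<forall>F. finite F \<longrightarrow> (\<forall>l\<in>F. 2 * (c / 2 ^ l) \<le> \<bar>h\<bar>) \<longrightarrow> (\<Sum>l\<in>F. ((c / 2 ^ l) powr (- \<theta>) * W (c / 2 ^ l)) powr q) \<le> S) \<longrightarrow>
    Jnorm q (\<lambda>z. frac_diff \<alpha> h f (of_real \<rho> * z)) \<le> ennreal (C * ((\<bar>h\<bar> powr (- \<theta>) * W (\<bar>h\<bar> / 2)) powr q + S))"
proof -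
  have q: "0 < q" using p by simp
  have thp: "0 < \<theta>" unfolding th using p by (simp add: frac_less2)
  define \<beta> where "\<beta> = \<alpha> + \<theta>"
  have be: "0 < \<beta>" using al thp by (simp add: \<beta>_def)
  define N1 where "N1 = vpN p + 1"
  have N1: "1 \<le> N1" by (simp add: N1_def)
  obtain c1 where c1: "c1 > 0" and blk: "\<forall>c'. 0 < c' \<longrightarrow> c' \<le> c1 \<longrightarrow> (\<exists>C>0. \<forall>f \<rho> l W. f holomorphic_on ball 0 1 \<longrightarrow> 0 < \<rho> \<longrightarrow> \<rho> < 1 \<longrightarrow> 0 \<le> W \<longrightarrow>
    Jnorm p (\<lambda>z. frac_diff \<beta> (c' / 2 ^ l) f (of_real \<rho> * z)) \<le> ennreal (W powr p) \<longrightarrow>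
    Jnorm p (poly (dyadic f \<rho> p (Suc l) - dyadic f \<rho> p l)) \<le> ennreal ((C * W) powr p))"
    using block_estimate[OF p(1) be] by (elim exE conjE)
  obtain c2 C2 where c2: "c2 > 0" and C2: "C2 > 0" and low: "\<forall>n\<ge>1. \<forall>T h A. degree T \<le> n \<longrightarrow> h \<noteq> 0 \<longrightarrow> \<bar>h\<bar> * real n \<le> c2 \<longrightarrow> 0 \<le> A \<longrightarrow>
    Jnorm p (poly (fdiff \<beta> (h / 2) T)) \<le> ennreal (A powr p) \<longrightarrow>
    Jnorm q (poly (fdiff \<alpha> h T)) \<le> ennreal ((C2 * (\<bar>h\<bar> powr (- \<theta>) * A)) powr q)"
    using fdiff_low_frequency[OF p th al(1)] unfolding \<beta>_def by (elim exE conjE)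
  have low': "Jnorm q (poly (fdiff \<alpha> h T)) \<le> ennreal ((C2 * (\<bar>h\<bar> powr (- \<theta>) * A)) powr q)"
    if "1 \<le> n" "degree T \<le> n" "h \<noteq> 0" "\<bar>h\<bar> * real n \<le> c2" "0 \<le> A"
      "Jnorm p (poly (fdiff \<beta> (h / 2) T)) \<le> ennreal (A powr p)" for n T h A
    using low that by simp
  \<comment> \<open>The second entry serves the low part: at the last level i before the blocks
    start, |h| 2^i N1 \<le> 2 c N1 \<le> c2.\<close>
  define c where "c = min c1 (c2 / (2 * real N1))"
  have c: "0 < c" "c \<le> c1" using c1 c2 N1 by (auto simp: c_def)
  have cN: "2 * c * real N1 \<le> c2"
  proof -
    have "c * (2 * real N1) \<le> c2 / (2 * real N1) * (2 * real N1)" by (intro mult_right_mono) (auto simp: c_def)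
    thus ?thesis using N1 by (simp add: mult_ac)
  qed
  obtain C1 where C1: "C1 > 0" and blk': "\<forall>f \<rho> l W. f holomorphic_on ball 0 1 \<longrightarrow> 0 < \<rho> \<longrightarrow> \<rho> < 1 \<longrightarrow> 0 \<le> W \<longrightarrow>
    Jnorm p (\<lambda>z. frac_diff \<beta> (c / 2 ^ l) f (of_real \<rho> * z)) \<le> ennreal (W powr p) \<longrightarrow>
    Jnorm p (poly (dyadic f \<rho> p (Suc l) - dyadic f \<rho> p l)) \<le> ennreal ((C1 * W) powr p)"
    using blk c by (elim allE[of _ c]) auto
  from fdiff_bounded[OF q al] obtain C3 where C3: "C3 > 0" and
    fb: "\<And>h P. Jnorm q (poly (fdiff \<alpha> h P)) \<le> ennreal C3 * Jnorm q (poly P)" by blast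
  from fdiff_dyadic_le[OF p(1) be] obtain CL where CL: "CL > 0" and
    dy: "\<And>f \<rho> h j W. f holomorphic_on ball 0 1 \<Longrightarrow> 0 < \<rho> \<Longrightarrow> \<rho> < 1 \<Longrightarrow> 0 \<le> W \<Longrightarrow>
    Jnorm p (\<lambda>z. frac_diff \<beta> h f (of_real \<rho> * z)) \<le> ennreal (W powr p) \<Longrightarrow>
    Jnorm p (poly (fdiff \<beta> h (dyadic f \<rho> p j))) \<le> ennreal (CL * W powr p)" by blast
  have N2: "0 < 2 * real N1" using N1 by simp
  obtain C4 where C4: "C4 > 0" and bsum: "\<forall>(g :: nat \<Rightarrow> complex poly) b N.
    (\<forall>l. degree (g l) \<le> (2 * real N1) * 2 ^ l \<and> 0 \<le> b l \<and> Jnorm p (poly (g l)) \<le> ennreal (b l powr p)) \<longrightarrow>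
    Jnorm q (poly (\<Sum>l<N. g l)) \<le> ennreal (C4 * (\<Sum>l<N. (2 powr (real l * \<theta>) * b l) powr q))"
    using block_sum[OF p th N2] by (elim exE conjE)
  define D where "D = (C2 * CL powr (1 / p)) powr q"
  define E where "E = C3 * C4 * (c powr \<theta> * C1) powr q"
  have D: "0 < D" and E: "0 < E" using C1 C2 C3 C4 CL c by (auto simp: D_def E_def)
  define C where "C = 2 powr q * (D + E)"
  have C: "0 < C" using D E by (simp add: C_def)
  show ?thesis
  proof (rule exI[of _ c], intro conjI c(1), rule exI[of _ C], intro conjI C allI impI)
    fix f :: "complex \<Rightarrow> complex" and \<rho> h :: real and W :: "real \<Rightarrow> real" and S :: real
    assume f: "f holomorphic_on ball 0 1" "0 < \<rho>" "\<rho> < 1" and h: "h \<noteq> 0" and W: "\<forall>s. 0 \<le> W s"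
      and om: "\<forall>s. s \<noteq> 0 \<longrightarrow> 2 * \<bar>s\<bar> \<le> \<bar>h\<bar> \<longrightarrow> Jnorm p (\<lambda>z. frac_diff (\<alpha> + \<theta>) s f (of_real \<rho> * z)) \<le> ennreal (W \<bar>s\<bar> powr p)"
      and S: "\<forall>F. finite F \<longrightarrow> (\<forall>l\<in>F. 2 * (c / 2 ^ l) \<le> \<bar>h\<bar>) \<longrightarrow> (\<Sum>l\<in>F. ((c / 2 ^ l) powr (- \<theta>) * W (c / 2 ^ l)) powr q) \<le> S"
    have W0: "0 \<le> W s" for s using W by blast
    have S0: "0 \<le> S" using S[THEN spec[of _ "{}"]] by simp
    have om': "Jnorm p (\<lambda>z. frac_diff \<beta> s f (of_real \<rho> * z)) \<le> ennreal (W \<bar>s\<bar> powr p)" if "s \<noteq> 0" "2 * \<bar>s\<bar> \<le> \<bar>h\<bar>" for s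
      using om that unfolding \<beta>_def by blast
    define T where "T = dyadic f \<rho> p"
    define X where "X = (\<bar>h\<bar> powr (- \<theta>) * W (\<bar>h\<bar> / 2)) powr q"
    have X0: "0 \<le> X" by (simp add: X_def)
    define Q where "Q = (\<lambda>j::nat. 2 * (c / 2 ^ j) \<le> \<bar>h\<bar>)"
    have exQ: "\<exists>j. Q j"
    proof -
      have "(\<lambda>j. 2 * (c * (1 / 2) ^ j)) \<longlonglongrightarrow> 2 * (c * 0)" by (intro tendsto_intros LIMSEQ_power_zero) auto
      hence "\<forall>\<^sub>F j in sequentially. 2 * (c * (1 / 2) ^ j) < \<bar>h\<bar>" by (rule order_tendstoD(2)) (use h in simp)
      then obtain j where "2 * (c * (1 / 2) ^ j) < \<bar>h\<bar>" by (auto simp: eventually_sequentially)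
      thus ?thesis by (intro exI[of _ j]) (simp add: Q_def power_one_over field_simps)
    qed
    \<comment> \<open>The first level whose block step c/2^j is at most |h|/2. Failure of this at
      the preceding level limits the degree of the low part; if j0 = 0 the low part is a constant
      and its difference vanishes.\<close>
    define j0 where "j0 = (LEAST j. Q j)"
    have Qj0: "Q j0" unfolding j0_def using exQ by (rule LeastI_ex)
    have Qge: "Q l" if "j0 \<le> l" for l
    proof -
      have "(2::real) ^ j0 \<le> 2 ^ l" using that by (intro power_increasing) auto
      hence "c / 2 ^ l \<le> c / 2 ^ j0" using c by (intro divide_left_mono) auto
      thus ?thesis using Qj0 unfolding Q_def by linarith
    qed
    have lowT: "Jnorm q (poly (fdiff \<alpha> h (T j0))) \<le> ennreal (D * X)"
    proof (cases j0)
      case 0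
      thus ?thesis using fdiff_dyadic_0[OF al(1)] q by (simp add: T_def)
    next
      case (Suc i)
      have "\<not> Q i" using not_less_Least[of i Q] Suc unfolding j0_def by simp
      hence "\<bar>h\<bar> * 2 ^ i \<le> 2 * c" by (simp add: Q_def field_simps)
      hence "\<bar>h\<bar> * 2 ^ i * real N1 \<le> 2 * c * real N1" by (intro mult_right_mono) auto
      hence hn: "\<bar>h\<bar> * real (N1 * 2 ^ i) \<le> c2" using cN by (simp add: mult_ac)
      have n1: "1 \<le> N1 * 2 ^ i" using N1 by simp
      have dT: "degree (T j0) \<le> N1 * 2 ^ i" unfolding T_def Suc N1_def by (rule degree_dyadic_Suc_le)
      have "Jnorm p (poly (fdiff \<beta> (h / 2) (T j0))) \<le> ennreal (CL * W (\<bar>h\<bar> / 2) powr p)"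
        unfolding T_def using om'[of "h / 2"] h by (intro dy f W0) auto
      also have "CL * W (\<bar>h\<bar> / 2) powr p = (CL powr (1 / p) * W (\<bar>h\<bar> / 2)) powr p"
        using CL p W0 by (simp add: powr_mult powr_powr)
      finally have "Jnorm q (poly (fdiff \<alpha> h (T j0))) \<le> ennreal ((C2 * (\<bar>h\<bar> powr (- \<theta>) * (CL powr (1 / p) * W (\<bar>h\<bar> / 2)))) powr q)"
        using W0 CL by (intro low'[OF n1 dT h hn]) auto
      also have "(C2 * (\<bar>h\<bar> powr (- \<theta>) * (CL powr (1 / p) * W (\<bar>h\<bar> / 2)))) powr q = D * X"
        using C2 W0 by (simp add: D_def X_def powr_mult mult_ac)
      finally show ?thesis .
    qed
    \<comment> \<open>Set to zero below j0, so that indices keep their dyadic meaning and the block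
      sum can start from 0.\<close>
    define g where "g = (\<lambda>l. if l < j0 then 0 else T (Suc l) - T l)"
    define b where "b = (\<lambda>l. if l < j0 then 0 else C1 * W (c / 2 ^ l))"
    have gb: "degree (g l) \<le> (2 * real N1) * 2 ^ l \<and> 0 \<le> b l \<and> Jnorm p (poly (g l)) \<le> ennreal (b l powr p)" for l
    proof (cases "l < j0")
      case True
      thus ?thesis using p by (simp add: g_def b_def)
    next
      case False
      have "degree (T (Suc l) - T l) \<le> N1 * 2 ^ Suc l"
        unfolding T_def N1_def
        by (intro degree_diff_le degree_dyadic_le order_trans[OF degree_dyadic_le]) auto
      hence "real (degree (g l)) \<le> real (N1 * 2 ^ Suc l)"
        by (subst of_nat_le_iff) (use False in \<open>simp add: g_def\<close>)
      moreover have "Jnorm p (poly (g l)) \<le> ennreal (b l powr p)"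
      proof -
        have "0 < c / 2 ^ l" using c by simp
        moreover have "2 * (c / 2 ^ l) \<le> \<bar>h\<bar>" using Qge[of l] False by (simp add: Q_def)
        ultimately have "Jnorm p (\<lambda>z. frac_diff \<beta> (c / 2 ^ l) f (of_real \<rho> * z)) \<le> ennreal (W (c / 2 ^ l) powr p)"
          using om'[of "c / 2 ^ l"] c by simp
        thus ?thesis using False blk' f W0[of "c / 2 ^ l"] by (simp add: g_def b_def T_def)
      qed
      ultimately show ?thesis using False C1 W0 by (simp add: b_def mult_ac)
    qed
    have tel: "T i = T j0 + (\<Sum>l<i. g l)" if "j0 \<le> i" for i
      using that
    proof (induction i rule: dec_induct)
      case base
      have "(\<Sum>l<j0. g l) = 0" by (intro sum.neutral) (auto simp: g_def)
      thus ?case by simp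
    next
      case (step n)
      thus ?case by (simp add: g_def)
    qed
    have tailT: "Jnorm q (poly (fdiff \<alpha> h (\<Sum>l<i. g l))) \<le> ennreal (E * S)" for i
    proof -
      have "(\<Sum>l<i. (2 powr (real l * \<theta>) * b l) powr q) = (\<Sum>l\<in>{l. l < i \<and> j0 \<le> l}. (2 powr (real l * \<theta>) * b l) powr q)"
        using q by (intro sum.mono_neutral_right) (auto simp: b_def)
      also have "\<dots> = (\<Sum>l\<in>{l. l < i \<and> j0 \<le> l}. (c powr \<theta> * C1) powr q * ((c / 2 ^ l) powr (- \<theta>) * W (c / 2 ^ l)) powr q)"
      proof (intro sum.cong refl)
        fix l assume "l \<in> {l. l < i \<and> j0 \<le> l}"
        hence bl: "b l = C1 * W (c / 2 ^ l)" by (simp add: b_def)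
        have "c powr \<theta> * (c / 2 ^ l) powr (- \<theta>) = 2 powr (real l * \<theta>)"
        proof -
          have "(2::real) ^ l = 2 powr real l" by (simp add: powr_realpow)
          hence "(c / 2 ^ l) powr (- \<theta>) = c powr (- \<theta>) * 2 powr (real l * \<theta>)"
            using c by (simp add: powr_divide powr_powr powr_minus_divide)
          thus ?thesis using c by (simp add: powr_minus_divide)
        qed
        hence "2 powr (real l * \<theta>) * b l = (c powr \<theta> * C1) * ((c / 2 ^ l) powr (- \<theta>) * W (c / 2 ^ l))"
          unfolding bl by (simp add: mult_ac)
        thus "(2 powr (real l * \<theta>) * b l) powr q = (c powr \<theta> * C1) powr q * ((c / 2 ^ l) powr (- \<theta>) * W (c / 2 ^ l)) powr q"
          by (simp only: powr_mult)
      qed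
      also have "\<dots> = (c powr \<theta> * C1) powr q * (\<Sum>l\<in>{l. l < i \<and> j0 \<le> l}. ((c / 2 ^ l) powr (- \<theta>) * W (c / 2 ^ l)) powr q)"
        by (simp add: sum_distrib_left)
      also have "\<dots> \<le> (c powr \<theta> * C1) powr q * S"
      proof (intro mult_left_mono)
        have "finite {l. l < i \<and> j0 \<le> l}" by simp
        moreover have "\<forall>l\<in>{l. l < i \<and> j0 \<le> l}. 2 * (c / 2 ^ l) \<le> \<bar>h\<bar>" using Qge by (simp add: Q_def)
        ultimately show "(\<Sum>l\<in>{l. l < i \<and> j0 \<le> l}. ((c / 2 ^ l) powr (- \<theta>) * W (c / 2 ^ l)) powr q) \<le> S"
          using S by blast
      qed simp
      finally have s: "(\<Sum>l<i. (2 powr (real l * \<theta>) * b l) powr q) \<le> (c powr \<theta> * C1) powr q * S" .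
      have "Jnorm q (poly (fdiff \<alpha> h (\<Sum>l<i. g l))) \<le> ennreal C3 * Jnorm q (poly (\<Sum>l<i. g l))" by (rule fb)
      also have "Jnorm q (poly (\<Sum>l<i. g l)) \<le> ennreal (C4 * (\<Sum>l<i. (2 powr (real l * \<theta>) * b l) powr q))"
        using bsum gb by blast
      also have "\<dots> \<le> ennreal (C4 * ((c powr \<theta> * C1) powr q * S))"
        using C4 by (intro ennreal_leI mult_left_mono s) auto
      finally have "Jnorm q (poly (fdiff \<alpha> h (\<Sum>l<i. g l))) \<le> ennreal C3 * ennreal (C4 * ((c powr \<theta> * C1) powr q * S))"
        by (simp add: mult_left_mono)
      also have "\<dots> = ennreal (E * S)" using C3 by (simp add: ennreal_mult'[symmetric] E_def mult.assoc)
      finally show ?thesis .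
    qed
    have bound: "Jnorm q (poly (fdiff \<alpha> h (T i))) \<le> ennreal (C * (X + S))" if i: "j0 \<le> i" for i
    proof -
      have "Jnorm q (poly (fdiff \<alpha> h (T i))) \<le> ennreal (2 powr q) * (Jnorm q (poly (fdiff \<alpha> h (T j0))) + Jnorm q (poly (fdiff \<alpha> h (\<Sum>l<i. g l))))"
        unfolding tel[OF i] fdiff_add by (rule Jnorm_triangle_le[OF _ q]) (auto intro: norm_triangle_ineq)
      also have "\<dots> \<le> ennreal (2 powr q) * (ennreal (D * X) + ennreal (E * S))"
        by (intro mult_left_mono add_mono lowT tailT) auto
      also have "\<dots> = ennreal (2 powr q * (D * X + E * S))"
        using D E X0 S0 by (simp add: ennreal_mult'[symmetric] ennreal_plus[symmetric] del: ennreal_plus)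
      also have "\<dots> \<le> ennreal (C * (X + S))"
      proof (rule ennreal_leI)
        have "D * X + E * S \<le> (D + E) * (X + S)" using D E X0 S0 by (simp add: algebra_simps)
        thus "2 powr q * (D * X + E * S) \<le> C * (X + S)" unfolding C_def mult.assoc by (intro mult_left_mono) auto
      qed
      finally show ?thesis .
    qed
    have lim: "(\<lambda>i. norm (poly (fdiff \<alpha> h (T i)) (cis t))) \<longlonglongrightarrow> norm (frac_diff \<alpha> h f (of_real \<rho> * cis t))" for t
      unfolding T_def
      by (intro tendsto_norm frac_diff_tendsto[OF f al(1) dyadic_approx[OF f] dyadic_tail_tendsto[OF f]]) auto
    show "Jnorm q (\<lambda>z. frac_diff \<alpha> h f (of_real \<rho> * z)) \<le> ennreal (C * ((\<bar>h\<bar> powr (- \<theta>) * W (\<bar>h\<bar> / 2)) powr q + S))"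
      unfolding X_def[symmetric]
      by (rule Jnorm_limit_le[where f = "\<lambda>i. poly (fdiff \<alpha> h (T i))" and ?n0.0 = j0, OF lim q norm_poly_cis_measurable bound])
  qed
qed

subsection \<open>The integral of the modulus\<close>

lemma nn_integral_ge_disjoint_sum:
  fixes \<phi> :: "real \<Rightarrow> ennreal"
  assumes F: "finite F" and A: "\<And>l. l \<in> F \<Longrightarrow> A l \<in> sets borel" "disjoint_family_on A F"
    and c: "\<And>l t. l \<in> F \<Longrightarrow> t \<in> A l \<Longrightarrow> c l \<le> \<phi> t"
  shows "(\<Sum>l\<in>F. c l * emeasure lborel (A l)) \<le> (\<integral>\<^sup>+t. \<phi> t \<partial>lborel)"
proof -
  have "(\<Sum>l\<in>F. c l * emeasure lborel (A l)) = (\<integral>\<^sup>+t. (\<Sum>l\<in>F. c l * indicator (A l) t) \<partial>lborel)"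
    using A(1) by (subst nn_integral_sum) (auto simp: nn_integral_cmult_indicator)
  also have "\<dots> \<le> (\<integral>\<^sup>+t. \<phi> t \<partial>lborel)"
  proof (rule nn_integral_mono)
    fix t
    show "(\<Sum>l\<in>F. c l * indicator (A l) t) \<le> \<phi> t"
    proof (cases "\<exists>l\<in>F. t \<in> A l")
      case True
      then obtain l where l: "l \<in> F" "t \<in> A l" by blast
      have "(\<Sum>i\<in>F. c i * indicator (A i) t) = c l * indicator (A l) t + (\<Sum>i\<in>F - {l}. c i * indicator (A i) t)"
        by (rule sum.remove[OF F l(1)])
      also have "(\<Sum>i\<in>F - {l}. c i * indicator (A i) t) = 0"
        using A(2) l by (intro sum.neutral) (auto simp: disjoint_family_on_def indicator_def)
      finally show ?thesis using c[OF l] l by simp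
    next
      case False
      hence "(\<Sum>l\<in>F. c l * indicator (A l) t) = 0" by (intro sum.neutral) auto
      thus ?thesis by simp
    qed
  qed
  finally show ?thesis .
qed

lemma epowr_mono:
  assumes "x \<le> y" "0 < a"
  shows "epowr x a \<le> epowr y a"
proof (cases "y = \<infinity>")
  case False
  hence "x \<noteq> \<infinity>" using assms(1) by (auto simp: top_unique)
  moreover have "enn2real x \<le> enn2real y" using assms(1) False by (intro enn2real_mono) (auto simp: less_top)
  ultimately show ?thesis using False assms(2) by (auto simp: epowr_def intro!: ennreal_leI powr_mono2)
qed (simp add: epowr_def)

lemma Hp_modulus_mono: "s \<le> t \<Longrightarrow> Hp_modulus p \<gamma> f s \<le> Hp_modulus p \<gamma> f t"
  unfolding Hp_modulus_def by (rule SUP_subset_mono) auto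

definition ulyanov_integral :: "real \<Rightarrow> real \<Rightarrow> real \<Rightarrow> real \<Rightarrow> (complex \<Rightarrow> complex) \<Rightarrow> real \<Rightarrow> ennreal" where
  "ulyanov_integral p q \<beta> \<theta> f \<delta> =
     (\<integral>\<^sup>+t\<in>{0<..<\<delta>}. epowr (Hp_modulus p \<beta> f t / ennreal (t powr \<theta>)) q / ennreal t \<partial>lborel)"

text \<open>On [u, 2u) the modulus is at least its value at u, while t^\<theta> and t are at most
  (2u)^\<theta> and 2u. The interval has length u, so it contributes at least 2^(-\<theta> q - 1)
  times the summand. \<open>w\<close> is merely a real lower bound, since the modulus may still be
  infinite here.\<close>

lemma ulyanov_integral_ge:
  assumes q: "0 < q" and th: "0 < \<theta>" and F: "finite F" and u: "\<And>l. l \<in> F \<Longrightarrow> 0 < u l \<and> 2 * u l \<le> \<delta>"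
    and dis: "disjoint_family_on (\<lambda>l. {u l..<2 * u l}) F" and w: "\<And>l. l \<in> F \<Longrightarrow> 0 \<le> w l \<and> ennreal (w l) \<le> Hp_modulus p \<beta> f (u l)"
  shows "ennreal (\<Sum>l\<in>F. (u l powr (- \<theta>) * w l) powr q) \<le> ennreal (2 * (2 powr \<theta>) powr q) * ulyanov_integral p q \<beta> \<theta> f \<delta>"
proof -
  define c where "c = (\<lambda>l. (w l / (2 * u l) powr \<theta>) powr q / (2 * u l))"
  have c0: "0 \<le> c l" if "l \<in> F" for l using u[OF that] by (simp add: c_def)
  have "(\<Sum>l\<in>F. ennreal (c l) * emeasure lborel {u l..<2 * u l}) \<le> ulyanov_integral p q \<beta> \<theta> f \<delta>"
    unfolding ulyanov_integral_def
  proof (rule nn_integral_ge_disjoint_sum[OF F _ dis])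
    fix l t assume l: "l \<in> F" and t: "t \<in> {u l..<2 * u l}"
    have tp: "0 < t" "t < \<delta>" using t u[OF l] by auto
    have pos: "0 < t powr \<theta>" "0 < (2 * u l) powr \<theta>" using tp u[OF l] by auto
    have "ennreal (w l / (2 * u l) powr \<theta>) \<le> ennreal (w l / t powr \<theta>)"
      using t tp th w[OF l] pos by (intro ennreal_leI divide_left_mono powr_mono2) auto
    also have "\<dots> = ennreal (w l) / ennreal (t powr \<theta>)" using w[OF l] pos by (simp add: divide_ennreal)
    also have "\<dots> \<le> Hp_modulus p \<beta> f t / ennreal (t powr \<theta>)"
      using w[OF l] Hp_modulus_mono[of "u l" t p \<beta> f] t by (intro divide_right_mono_ennreal) (auto intro: order_trans)
    finally have "epowr (ennreal (w l / (2 * u l) powr \<theta>)) q \<le> epowr (Hp_modulus p \<beta> f t / ennreal (t powr \<theta>)) q"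
      using q by (intro epowr_mono)
    hence 1: "ennreal ((w l / (2 * u l) powr \<theta>) powr q) \<le> epowr (Hp_modulus p \<beta> f t / ennreal (t powr \<theta>)) q"
      using w[OF l] by (simp add: epowr_def)
    have "ennreal (c l) \<le> ennreal ((w l / (2 * u l) powr \<theta>) powr q / t)"
      unfolding c_def using t tp by (intro ennreal_leI divide_left_mono) auto
    also have "\<dots> = ennreal ((w l / (2 * u l) powr \<theta>) powr q) / ennreal t" using tp by (simp add: divide_ennreal)
    also have "\<dots> \<le> epowr (Hp_modulus p \<beta> f t / ennreal (t powr \<theta>)) q / ennreal t" by (intro divide_right_mono_ennreal 1)
    finally show "ennreal (c l) \<le> epowr (Hp_modulus p \<beta> f t / ennreal (t powr \<theta>)) q / ennreal t * indicator {0<..<\<delta>} t"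
      using tp by simp
  qed auto
  also have "(\<Sum>l\<in>F. ennreal (c l) * emeasure lborel {u l..<2 * u l}) = (\<Sum>l\<in>F. ennreal (c l * u l))"
    using u c0 by (intro sum.cong refl) (auto simp: ennreal_mult less_imp_le)
  also have "\<dots> = ennreal (\<Sum>l\<in>F. c l * u l)" using u c0 by (intro sum_ennreal) (auto simp: less_imp_le)
  finally have 1: "ennreal (\<Sum>l\<in>F. c l * u l) \<le> ulyanov_integral p q \<beta> \<theta> f \<delta>" .
  have "(\<Sum>l\<in>F. (u l powr (- \<theta>) * w l) powr q) = 2 * (2 powr \<theta>) powr q * (\<Sum>l\<in>F. c l * u l)"
    unfolding sum_distrib_left
  proof (intro sum.cong refl)
    fix l assume l: "l \<in> F"
    have "w l / (2 * u l) powr \<theta> = (u l powr (- \<theta>) * w l) / 2 powr \<theta>"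
      using u[OF l] by (simp add: powr_mult powr_minus_divide)
    hence "c l * u l = ((u l powr (- \<theta>) * w l) / 2 powr \<theta>) powr q / 2" using u[OF l] by (simp add: c_def)
    also have "\<dots> = (u l powr (- \<theta>) * w l) powr q / (2 powr \<theta>) powr q / 2" using w[OF l] by (simp add: powr_divide)
    finally show "(u l powr (- \<theta>) * w l) powr q = 2 * (2 powr \<theta>) powr q * (c l * u l)" by simp
  qed
  also have "ennreal \<dots> = ennreal (2 * (2 powr \<theta>) powr q) * ennreal (\<Sum>l\<in>F. c l * u l)"
    by (rule ennreal_mult') simp
  also have "\<dots> \<le> ennreal (2 * (2 powr \<theta>) powr q) * ulyanov_integral p q \<beta> \<theta> f \<delta>"
    by (intro mult_left_mono 1) auto
  finally show ?thesis .
qed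

text \<open>If the modulus at u were infinite, every nonnegative real w would be a lower bound for
  it, and the single interval [u, 2u) would already exceed the integral.\<close>

lemma modulus_finite:
  assumes q: "0 < q" and th: "0 < \<theta>" and u: "0 < u" "2 * u \<le> \<delta>" and I: "ulyanov_integral p q \<beta> \<theta> f \<delta> < top"
  shows "Hp_modulus p \<beta> f u < top"
proof (rule ccontr)
  assume "\<not> Hp_modulus p \<beta> f u < top"
  hence inf: "Hp_modulus p \<beta> f u = top" by (simp add: less_top[symmetric])
  obtain v where v: "ulyanov_integral p q \<beta> \<theta> f \<delta> = ennreal v" "0 \<le> v"
    using I by (cases "ulyanov_integral p q \<beta> \<theta> f \<delta>") auto
  define K where "K = 2 * (2 powr \<theta>) powr q * v + 1"
  have K: "0 < K" using v by (simp add: K_def add_nonneg_pos)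
  define w where "w = K powr (1 / q) * u powr \<theta>"
  have "(u powr (- \<theta>) * w) powr q = K"
    using u q K by (simp add: w_def powr_minus_divide powr_powr)
  moreover have "ennreal (\<Sum>l\<in>{0::nat}. (u powr (- \<theta>) * w) powr q) \<le> ennreal (2 * (2 powr \<theta>) powr q) * ulyanov_integral p q \<beta> \<theta> f \<delta>"
    by (rule ulyanov_integral_ge[OF q th]) (use u inf in \<open>auto simp: disjoint_family_on_def w_def\<close>)
  ultimately have "ennreal K \<le> ennreal (2 * (2 powr \<theta>) powr q * v)" using v by (simp add: ennreal_mult')
  hence "K \<le> 2 * (2 powr \<theta>) powr q * v" using v by (subst (asm) ennreal_le_iff) auto
  thus False by (simp add: K_def)
qed

theorem theorem11p5:
  fixes p q \<alpha> \<theta> :: real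
  assumes "0 < p" and "p < q"
    and "\<theta> = 1 / p - 1 / q"
    and "\<alpha> \<in> (\<nat> - {0}) \<union> {max (1 / q - 1) 0<..}"
    and "\<alpha> + \<theta> \<in> (\<nat> - {0}) \<union> {1 / p - 1<..}"
  shows "\<exists>C::real. 0 < C \<and>
    (\<forall>f \<in> hardy_space p. \<forall>\<delta> \<in> {0<..<1}.
       Hp_modulus q \<alpha> f \<delta> \<le>
         ennreal C *
         epowr (\<integral>\<^sup>+t\<in>{0<..<\<delta>}.
                  epowr (Hp_modulus p (\<alpha> + \<theta>) f t / ennreal (t powr \<theta>)) q / ennreal t \<partial>lborel)
           (1 / q))"
proof -
  note p = assms(1,2) and th = assms(3)
  have q: "0 < q" using p by simp
  have thp: "0 < \<theta>" unfolding th using p by (simp add: frac_less2)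
  have al: "0 < \<alpha>" "\<alpha> \<in> \<nat> \<or> 1 / q - 1 < \<alpha>" using assms(4) by (auto elim!: Nats_cases)
  have be: "0 < \<alpha> + \<theta>" using al thp by simp
  obtain c C where c: "c > 0" and C: "C > 0" and main: "\<forall>f \<rho> h W S. f holomorphic_on ball 0 1 \<longrightarrow> 0 < \<rho> \<longrightarrow> \<rho> < 1 \<longrightarrow> h \<noteq> 0 \<longrightarrow> (\<forall>s. 0 \<le> W s) \<longrightarrow>
    (\<forall>s. s \<noteq> 0 \<longrightarrow> 2 * \<bar>s\<bar> \<le> \<bar>h\<bar> \<longrightarrow> Jnorm p (\<lambda>z. frac_diff (\<alpha> + \<theta>) s f (of_real \<rho> * z)) \<le> ennreal (W \<bar>s\<bar> powr p)) \<longrightarrow>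
    (\<forall>F. finite F \<longrightarrow> (\<forall>l\<in>F. 2 * (c / 2 ^ l) \<le> \<bar>h\<bar>) \<longrightarrow> (\<Sum>l\<in>F. ((c / 2 ^ l) powr (- \<theta>) * W (c / 2 ^ l)) powr q) \<le> S) \<longrightarrow>
    Jnorm q (\<lambda>z. frac_diff \<alpha> h f (of_real \<rho> * z)) \<le> ennreal (C * ((\<bar>h\<bar> powr (- \<theta>) * W (\<bar>h\<bar> / 2)) powr q + S))"
    using slice_estimate[OF p th al] by (elim exE conjE)
  define K where "K = 2 * (2 powr \<theta>) powr q"
  have K: "0 < K" by (simp add: K_def)
  \<comment> \<open>The low part and the sum over the blocks are each bounded through K times the
    integral, hence the 2.\<close>
  define C' where "C' = C * (2 * K)"
  have C': "0 < C'" using C K by (simp add: C'_def)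
  show ?thesis
  proof (intro exI[of _ "C' powr (1 / q)"] conjI ballI)
    fix f \<delta> assume "f \<in> hardy_space p" and de: "\<delta> \<in> {0<..<1::real}"
    hence f: "f holomorphic_on ball 0 1" by (simp add: hardy_space_def)
    define I where "I = ulyanov_integral p q (\<alpha> + \<theta>) \<theta> f \<delta>"
    have "Hp_modulus q \<alpha> f \<delta> \<le> ennreal (C' powr (1 / q)) * epowr I (1 / q)"
    proof (cases "I = top")
      case True
      thus ?thesis using C' by (simp add: epowr_def ennreal_mult_top)
    next
      case False
      hence I: "I < top" by (simp add: less_top)
      then obtain v where v: "I = ennreal v" "0 \<le> v" by (cases I) auto
      define W where "W = (\<lambda>s. enn2real (Hp_modulus p (\<alpha> + \<theta>) f s))"
      have W0: "\<forall>s. 0 \<le> W s" by (simp add: W_def)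
      have Wfin: "Hp_modulus p (\<alpha> + \<theta>) f s = ennreal (W s)" if "0 < s" "2 * s \<le> \<delta>" for s
        using modulus_finite[OF q thp that I[unfolded I_def]] by (simp add: W_def ennreal_enn2real)
      have slice: "Jnorm q (\<lambda>z. frac_diff \<alpha> h f (of_real \<rho> * z)) \<le> ennreal C' * I"
        if h: "\<bar>h\<bar> \<le> \<delta>" and r: "0 < \<rho>" "\<rho> < 1" for h \<rho>
      proof (cases "h = 0")
        case True
        \<comment> \<open>The slice estimate excludes step 0. There every polynomial difference
          vanishes because \<open>fsym \<alpha> 0 = 0\<close>, and the limit over dyadic levels
          carries this over to f.\<close>
        have z: "fdiff \<alpha> 0 P = 0" for P by (rule poly_eqI) (use al in \<open>simp add: fdiff_def\<close>)
        have lim: "(\<lambda>i. norm (poly (fdiff \<alpha> 0 (dyadic f \<rho> p i)) (cis t))) \<longlonglongrightarrow> norm (frac_diff \<alpha> 0 f (of_real \<rho> * cis t))" for t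
          by (intro tendsto_norm frac_diff_tendsto[OF f r al(1) dyadic_approx[OF f r] dyadic_tail_tendsto[OF f r]]) auto
        have "norm (frac_diff \<alpha> 0 f (of_real \<rho> * cis t)) = 0" for t
          using lim[of t] unfolding z by (simp add: LIMSEQ_const_iff)
        thus ?thesis using True by (simp add: Jnorm_def)
      next
        case False
        have om: "\<forall>s. s \<noteq> 0 \<longrightarrow> 2 * \<bar>s\<bar> \<le> \<bar>h\<bar> \<longrightarrow> Jnorm p (\<lambda>z. frac_diff (\<alpha> + \<theta>) s f (of_real \<rho> * z)) \<le> ennreal (W \<bar>s\<bar> powr p)"
        proof (intro allI impI)
          fix s :: real assume s: "s \<noteq> 0" "2 * \<bar>s\<bar> \<le> \<bar>h\<bar>"
          have "epowr (Jnorm p (\<lambda>z. frac_diff (\<alpha> + \<theta>) s f (of_real \<rho> * z))) (1 / p) \<le> Hp_norm p (frac_diff (\<alpha> + \<theta>) s f)"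
            unfolding Hp_norm_def Hp_norm_slice[OF f r be, of s p, symmetric] by (rule SUP_upper) (use r in auto)
          also have "\<dots> \<le> Hp_modulus p (\<alpha> + \<theta>) f \<bar>s\<bar>" unfolding Hp_modulus_def by (rule SUP_upper) auto
          also have "\<dots> = ennreal (W \<bar>s\<bar>)" using s h by (intro Wfin) auto
          finally show "Jnorm p (\<lambda>z. frac_diff (\<alpha> + \<theta>) s f (of_real \<rho> * z)) \<le> ennreal (W \<bar>s\<bar> powr p)"
            using W0 p by (intro epowr_le_imp) auto
        qed
        have S: "\<forall>F. finite F \<longrightarrow> (\<forall>l\<in>F. 2 * (c / 2 ^ l) \<le> \<bar>h\<bar>) \<longrightarrow> (\<Sum>l\<in>F. ((c / 2 ^ l) powr (- \<theta>) * W (c / 2 ^ l)) powr q) \<le> K * v"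
        proof (intro allI impI)
          fix F :: "nat set" assume F: "finite F" and l: "\<forall>l\<in>F. 2 * (c / 2 ^ l) \<le> \<bar>h\<bar>"
          have dis: "disjoint_family_on (\<lambda>l. {c / 2 ^ l..<2 * (c / 2 ^ l)}) F"
          proof -
            have "{c / 2 ^ m..<2 * (c / 2 ^ m)} \<inter> {c / 2 ^ n..<2 * (c / 2 ^ n)} = {}" if "m < n" for m n :: nat
            proof -
              have "(2::real) ^ Suc m \<le> 2 ^ n" using that by (intro power_increasing) auto
              hence "c / 2 ^ n \<le> c / 2 ^ Suc m" using c by (intro divide_left_mono) auto
              hence "2 * (c / 2 ^ n) \<le> c / 2 ^ m" by simp
              thus ?thesis by auto
            qed
            thus ?thesis unfolding disjoint_family_on_def by (metis Int_commute nat_neq_iff)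
          qed
          have "ennreal (\<Sum>l\<in>F. ((c / 2 ^ l) powr (- \<theta>) * W (c / 2 ^ l)) powr q) \<le> ennreal K * I"
            unfolding K_def I_def
            by (rule ulyanov_integral_ge[OF q thp F _ dis]) (use c l h Wfin W0 in \<open>force+\<close>)
          also have "\<dots> = ennreal (K * v)" using K v by (simp add: ennreal_mult)
          finally show "(\<Sum>l\<in>F. ((c / 2 ^ l) powr (- \<theta>) * W (c / 2 ^ l)) powr q) \<le> K * v"
            using K v by (subst (asm) ennreal_le_iff) auto
        qed
        define u where "u = \<bar>h\<bar> / 2"
        have u: "0 < u" "2 * u \<le> \<delta>" using False h by (auto simp: u_def)
        \<comment> \<open>When |h| = \<delta>, the argument u = |h|/2 is the largest one for which
          [u, 2u) still fits into the range of integration; replacing |h|^(-\<theta>) by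
          u^(-\<theta>) only increases the term.\<close>
        have X: "(\<bar>h\<bar> powr (- \<theta>) * W (\<bar>h\<bar> / 2)) powr q \<le> K * v"
        proof -
          have "(\<bar>h\<bar> powr (- \<theta>) * W (\<bar>h\<bar> / 2)) powr q \<le> (u powr (- \<theta>) * W u) powr q"
            unfolding u_def[symmetric] using u False thp q W0
            by (intro powr_mono2 mult_right_mono powr_mono2') (auto simp: u_def)
          moreover have "ennreal (\<Sum>l\<in>{0::nat}. (u powr (- \<theta>) * W u) powr q) \<le> ennreal K * I"
            unfolding K_def I_def
            by (rule ulyanov_integral_ge[OF q thp]) (use u Wfin[OF u] W0 in \<open>auto simp: disjoint_family_on_def\<close>)
          hence "ennreal ((u powr (- \<theta>) * W u) powr q) \<le> ennreal (K * v)" using K v by (simp add: ennreal_mult)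
          hence "(u powr (- \<theta>) * W u) powr q \<le> K * v" using K v by (subst (asm) ennreal_le_iff) auto
          ultimately show ?thesis by linarith
        qed
        have "Jnorm q (\<lambda>z. frac_diff \<alpha> h f (of_real \<rho> * z)) \<le> ennreal (C * ((\<bar>h\<bar> powr (- \<theta>) * W (\<bar>h\<bar> / 2)) powr q + K * v))"
          using main f r False W0 om S by blast
        also have "\<dots> \<le> ennreal (C * (K * v + K * v))"
          using C by (intro ennreal_leI mult_left_mono[OF add_right_mono[OF X]]) auto
        also have "\<dots> = ennreal C' * I" using C' v by (simp add: C'_def ennreal_mult'[symmetric] mult_ac)
        finally show ?thesis .
      qed
      show ?thesis unfolding Hp_modulus_def Hp_norm_def
      proof (intro SUP_least)
        fix h \<rho> :: real assume h: "h \<in> {h. \<bar>h\<bar> \<le> \<delta>}" and r: "\<rho> \<in> {0<..<1}"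
        have r': "0 < \<rho>" "\<rho> < 1" using r by auto
        show "epowr (\<integral>\<^sup>+t\<in>{0..2 * pi}. ennreal (norm (frac_diff \<alpha> h f (complex_of_real \<rho> * exp (\<i> * complex_of_real t))) powr q) \<partial>lborel) (1 / q)
           \<le> ennreal (C' powr (1 / q)) * epowr I (1 / q)"
          unfolding Hp_norm_slice[OF f r' al(1)]
          by (rule epowr_mono_real[OF slice C' q I]) (use h r' in auto)
      qed
    qed
    thus "Hp_modulus q \<alpha> f \<delta> \<le> ennreal (C' powr (1 / q)) *
         epowr (\<integral>\<^sup>+t\<in>{0<..<\<delta>}. epowr (Hp_modulus p (\<alpha> + \<theta>) f t / ennreal (t powr \<theta>)) q / ennreal t \<partial>lborel) (1 / q)"
      unfolding I_def ulyanov_integral_def .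
  qed (use C' in auto)
qed

end
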